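(* Let $R$ be a commutative ring, $M$ a finitely generated flat $R$-module, and $\phi:R\rightarrow S$ a homomorphism of commutative rings whose kernel is contained in the Jacobson radical of $R$. Then $M$ is a projective $R$-module if and only if $M\otimes_{R}S$ is a projective $S$-module.
   Context: All rings are commutative (with identity), and ring maps are unital. *)

theory Defs
  imports "HOL-Algebra.Algebra"
begin

section \<open>Rings and modules\<close>

definition jacobson_radical :: "('r, 'x) ring_scheme \<Rightarrow> 'r set" where
  "jacobson_radical R = {a \<in> carrier R. \<forall>I. maximalideal I R \<longrightarrow> a \<in> I}"

definition finitely_generated_module ::
    "('r, 'x) ring_scheme \<Rightarrow> ('r, 'm, 'z) module_scheme \<Rightarrow> bool" where
  "finitely_generated_module R M \<longleftrightarrow>
     (\<exists>A. finite A \<and> A \<subseteq> carrier M \<and>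
        (\<forall>x \<in> carrier M. \<exists>c \<in> A \<rightarrow> carrier R. x = (\<Oplus>\<^bsub>M\<^esub>a\<in>A. c a \<odot>\<^bsub>M\<^esub> a)))"

definition linear_maps ::
    "('r, 'x) ring_scheme \<Rightarrow> ('r, 'm, 'z) module_scheme \<Rightarrow> ('r, 'n, 'w) module_scheme
      \<Rightarrow> ('m \<Rightarrow> 'n) set" where
  "linear_maps R M N = {f \<in> carrier M \<rightarrow> carrier N.
     (\<forall>x \<in> carrier M. \<forall>y \<in> carrier M. f (x \<oplus>\<^bsub>M\<^esub> y) = f x \<oplus>\<^bsub>N\<^esub> f y) \<and>
     (\<forall>a \<in> carrier R. \<forall>x \<in> carrier M. f (a \<odot>\<^bsub>M\<^esub> x) = a \<odot>\<^bsub>N\<^esub> f x)}"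

text \<open>
  A module is projective if maps out of it lift along surjections. A definition cannot quantify
  over all types, so the test modules are taken in types that are large enough to contain the
  free module on the set \<open>carrier M\<close> and \<open>M\<close> itself. That this entails the lifting property for
  test modules in arbitrary types is shown in \<open>projective_module_lift\<close> below.
\<close>

definition projective_module ::
    "('r, 'x) ring_scheme \<Rightarrow> ('r, 'm, 'z) module_scheme \<Rightarrow> bool" where
  "projective_module R M \<longleftrightarrow>
     (\<forall>(N :: ('r, 'm \<Rightarrow> 'r) module) (P :: ('r, 'm) module) g f.
        module R N \<and> module R P \<and>
        g \<in> linear_maps R N P \<and> g ` carrier N = carrier P \<and> f \<in> linear_maps R M P \<longrightarrow>
        (\<exists>h \<in> linear_maps R M N. \<forall>x \<in> carrier M. g (h x) = f x))"


section \<open>Tensor products\<close>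

text \<open>
  The tensor product of \<open>M\<close> and \<open>N\<close> over \<open>R\<close> is the free Abelian group on
  \<open>carrier M \<times> carrier N\<close> modulo the subgroup generated by the usual relations. Its elements
  are cosets; the pure tensor of \<open>x\<close> and \<open>y\<close> is the coset of \<open>frag_of (x, y)\<close>.
\<close>

definition tensor_relations ::
    "('r, 'x) ring_scheme \<Rightarrow> ('r, 'm, 'z) module_scheme \<Rightarrow> ('r, 'n, 'w) module_scheme
      \<Rightarrow> ('m \<times> 'n \<Rightarrow>\<^sub>0 int) set" where
  "tensor_relations R M N =
     {frag_of (x \<oplus>\<^bsub>M\<^esub> x', y) - frag_of (x, y) - frag_of (x', y) | x x' y.
        x \<in> carrier M \<and> x' \<in> carrier M \<and> y \<in> carrier N} \<union>
     {frag_of (x, y \<oplus>\<^bsub>N\<^esub> y') - frag_of (x, y) - frag_of (x, y') | x y y'.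
        x \<in> carrier M \<and> y \<in> carrier N \<and> y' \<in> carrier N} \<union>
     {frag_of (a \<odot>\<^bsub>M\<^esub> x, y) - frag_of (x, a \<odot>\<^bsub>N\<^esub> y) | a x y.
        a \<in> carrier R \<and> x \<in> carrier M \<and> y \<in> carrier N}"

definition tensor_null ::
    "('r, 'x) ring_scheme \<Rightarrow> ('r, 'm, 'z) module_scheme \<Rightarrow> ('r, 'n, 'w) module_scheme
      \<Rightarrow> ('m \<times> 'n \<Rightarrow>\<^sub>0 int) set" where
  "tensor_null R M N =
     generate (free_Abelian_group (carrier M \<times> carrier N)) (tensor_relations R M N)"

definition tensor_group ::
    "('r, 'x) ring_scheme \<Rightarrow> ('r, 'm, 'z) module_scheme \<Rightarrow> ('r, 'n, 'w) module_scheme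
      \<Rightarrow> ('m \<times> 'n \<Rightarrow>\<^sub>0 int) set monoid" where
  "tensor_group R M N = free_Abelian_group (carrier M \<times> carrier N) Mod tensor_null R M N"

definition tensor_class ::
    "('r, 'x) ring_scheme \<Rightarrow> ('r, 'm, 'z) module_scheme \<Rightarrow> ('r, 'n, 'w) module_scheme
      \<Rightarrow> ('m \<times> 'n \<Rightarrow>\<^sub>0 int) \<Rightarrow> ('m \<times> 'n \<Rightarrow>\<^sub>0 int) set" where
  "tensor_class R M N u =
     tensor_null R M N #>\<^bsub>free_Abelian_group (carrier M \<times> carrier N)\<^esub> u"

text \<open>
  For a linear map \<open>g\<close> from \<open>N\<close> to \<open>N'\<close>, \<open>tensor_map R M N' g\<close> is the map from the tensor
  product of \<open>M\<close> and \<open>N\<close> to that of \<open>M\<close> and \<open>N'\<close> induced by the identity of \<open>M\<close> and \<open>g\<close>: all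
  elements of a coset have images in one and the same coset (\<open>tensor_map_class\<close> below).
\<close>

definition tensor_lift :: "('n \<Rightarrow> 'k) \<Rightarrow> ('m \<times> 'n \<Rightarrow>\<^sub>0 int) \<Rightarrow> ('m \<times> 'k \<Rightarrow>\<^sub>0 int)" where
  "tensor_lift g = frag_extend (\<lambda>(x, y). frag_of (x, g y))"

definition tensor_map ::
    "('r, 'x) ring_scheme \<Rightarrow> ('r, 'm, 'z) module_scheme \<Rightarrow> ('r, 'k, 'w) module_scheme
      \<Rightarrow> ('n \<Rightarrow> 'k) \<Rightarrow> ('m \<times> 'n \<Rightarrow>\<^sub>0 int) set \<Rightarrow> ('m \<times> 'k \<Rightarrow>\<^sub>0 int) set" where
  "tensor_map R M N' g U = (\<Union>u\<in>U. tensor_class R M N' (tensor_lift g u))"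

text \<open>
  A module is flat if tensoring with it preserves injectivity. Again the test modules have to
  be taken in a fixed type; up to isomorphism, \<open>(nat \<Rightarrow> 'r) set\<close> contains all finitely generated
  \<open>R\<close>-modules, as quotients of finite powers of \<open>R\<close>. That this entails the defining property
  for test modules in arbitrary types is shown in \<open>flat_module_inj\<close> below.
\<close>

definition flat_module ::
    "('r, 'x) ring_scheme \<Rightarrow> ('r, 'm, 'z) module_scheme \<Rightarrow> bool" where
  "flat_module R M \<longleftrightarrow>
     (\<forall>(N :: ('r, (nat \<Rightarrow> 'r) set) module) (N' :: ('r, (nat \<Rightarrow> 'r) set) module) g.
        module R N \<and> module R N' \<and> g \<in> linear_maps R N N' \<and> inj_on g (carrier N) \<longrightarrow>
        inj_on (tensor_map R M N' g) (carrier (tensor_group R M N)))"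


section \<open>Base change along a ring homomorphism\<close>

definition restrict_scalars ::
    "('r \<Rightarrow> 's) \<Rightarrow> ('s, 'y) ring_scheme \<Rightarrow> ('r, 's) module" where
  "restrict_scalars \<phi> S =
     \<lparr>carrier = carrier S, monoid.mult = monoid.mult S, monoid.one = \<one>\<^bsub>S\<^esub>, ring.zero = \<zero>\<^bsub>S\<^esub>,
      ring.add = ring.add S, smult = (\<lambda>a s. \<phi> a \<otimes>\<^bsub>S\<^esub> s)\<rparr>"

text \<open>
  The tensor product of \<open>M\<close> and \<open>S\<close> over \<open>R\<close> as an \<open>S\<close>-module, where \<open>s\<close> acts by multiplication
  on the second factor. The multiplicative fields of the record play no role for modules.
\<close>

definition base_change ::
    "('r, 'x) ring_scheme \<Rightarrow> ('r \<Rightarrow> 's) \<Rightarrow> ('s, 'y) ring_scheme \<Rightarrow> ('r, 'm, 'z) module_scheme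
      \<Rightarrow> ('s, ('m \<times> 's \<Rightarrow>\<^sub>0 int) set) module" where
  "base_change R \<phi> S M = (let T = tensor_group R M (restrict_scalars \<phi> S) in
     \<lparr>carrier = carrier T, monoid.mult = undefined, monoid.one = undefined, ring.zero = \<one>\<^bsub>T\<^esub>,
      ring.add = monoid.mult T,
      smult = (\<lambda>s. tensor_map R M (restrict_scalars \<phi> S) (\<lambda>t. s \<otimes>\<^bsub>S\<^esub> t))\<rparr>)"


section \<open>Basic facts\<close>

subsection \<open>Tensor products\<close>

lemma tensor_relations_cases [consumes 1, case_names add_left add_right smult]:
  assumes "u \<in> tensor_relations R M N"
  obtains x x' y where "u = frag_of (x \<oplus>\<^bsub>M\<^esub> x', y) - frag_of (x, y) - frag_of (x', y)"
      "x \<in> carrier M" "x' \<in> carrier M" "y \<in> carrier N"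
    | x y y' where "u = frag_of (x, y \<oplus>\<^bsub>N\<^esub> y') - frag_of (x, y) - frag_of (x, y')"
      "x \<in> carrier M" "y \<in> carrier N" "y' \<in> carrier N"
    | a x y where "u = frag_of (a \<odot>\<^bsub>M\<^esub> x, y) - frag_of (x, a \<odot>\<^bsub>N\<^esub> y)"
      "a \<in> carrier R" "x \<in> carrier M" "y \<in> carrier N"
  using assms unfolding tensor_relations_def by blast

lemma keys_diff_subset:
  assumes "Poly_Mapping.keys u \<subseteq> A" "Poly_Mapping.keys v \<subseteq> A"
  shows "Poly_Mapping.keys (u - v) \<subseteq> A"
  using assms keys_diff[of u v] by blast

lemma keys_add_subset:
  assumes "Poly_Mapping.keys u \<subseteq> A" "Poly_Mapping.keys v \<subseteq> A"
  shows "Poly_Mapping.keys (u + v) \<subseteq> A"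
  using assms Poly_Mapping.keys_add[of u v] by blast

lemma tensor_relations_carrier:
  assumes "module R M" "module R N" "u \<in> tensor_relations R M N"
  shows "Poly_Mapping.keys u \<subseteq> carrier M \<times> carrier N"
proof -
  interpret M: module R M by fact
  interpret N: module R N by fact
  show ?thesis
    using assms(3)
    by (cases rule: tensor_relations_cases) (simp_all add: keys_diff_subset)
qed

lemma tensor_null_subgroup:
  assumes "module R M" "module R N"
  shows "subgroup (tensor_null R M N) (free_Abelian_group (carrier M \<times> carrier N))"
  unfolding tensor_null_def
  by (rule group.generate_is_subgroup) (use tensor_relations_carrier[OF assms] in auto)

lemma tensor_null_keys:
  assumes "module R M" "module R N" "u \<in> tensor_null R M N"
  shows "Poly_Mapping.keys u \<subseteq> carrier M \<times> carrier N"
  using subgroup.subset[OF tensor_null_subgroup[OF assms(1,2)]] assms(3)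
  by (auto simp: free_Abelian_group_def)

lemma tensor_null_zero: "0 \<in> tensor_null R M N"
  unfolding tensor_null_def
  using generate.one[of "free_Abelian_group (carrier M \<times> carrier N)"] by simp

lemma tensor_null_incl: "u \<in> tensor_relations R M N \<Longrightarrow> u \<in> tensor_null R M N"
  unfolding tensor_null_def by (rule generate.incl)

lemma tensor_null_add:
  "u \<in> tensor_null R M N \<Longrightarrow> v \<in> tensor_null R M N \<Longrightarrow> u + v \<in> tensor_null R M N"
  unfolding tensor_null_def
  using generate.eng[of u "free_Abelian_group (carrier M \<times> carrier N)" _ v] by simp

lemma tensor_null_minus:
  assumes "module R M" "module R N" "u \<in> tensor_null R M N"
  shows "- u \<in> tensor_null R M N"
  using subgroup.m_inv_closed[OF tensor_null_subgroup[OF assms(1,2)] assms(3)]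
    tensor_null_keys[OF assms] by simp

lemma tensor_null_diff:
  assumes "module R M" "module R N" "u \<in> tensor_null R M N" "v \<in> tensor_null R M N"
  shows "u - v \<in> tensor_null R M N"
  using tensor_null_add[OF assms(3) tensor_null_minus[OF assms(1,2,4)]] by simp

lemma tensor_null_induct [consumes 3, case_names zero relation diff]:
  assumes M: "module R M" and N: "module R N" and u: "u \<in> tensor_null R M N"
    and zero: "P 0"
    and relation: "\<And>u. u \<in> tensor_relations R M N \<Longrightarrow> P u"
    and diff: "\<And>u v. u \<in> tensor_null R M N \<Longrightarrow> v \<in> tensor_null R M N \<Longrightarrow> P u \<Longrightarrow> P v \<Longrightarrow> P (u - v)"
  shows "P u"
proof -
  let ?F = "free_Abelian_group (carrier M \<times> carrier N)"
  have neg: "P (- v)" if "v \<in> tensor_null R M N" "P v" for v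
    using diff[OF tensor_null_zero that(1) zero that(2)] by simp
  show ?thesis
    using u[unfolded tensor_null_def]
  proof (induction rule: generate.induct)
    case one
    then show ?case using zero by simp
  next
    case (incl h)
    then show ?case by (rule relation)
  next
    case (inv h)
    then show ?case
      using neg[OF tensor_null_incl relation] tensor_relations_carrier[OF M N] by simp
  next
    case (eng h1 h2)
    then have h: "h1 \<in> tensor_null R M N" "h2 \<in> tensor_null R M N"
      by (simp_all add: tensor_null_def)
    have "P (h1 - - h2)"
      by (rule diff[OF h(1) tensor_null_minus[OF M N h(2)] eng(3) neg[OF h(2) eng(4)]])
    then show ?case by simp
  qed
qed

lemma tensor_lift_frag_of [simp]: "tensor_lift g (frag_of (x, y)) = frag_of (x, g y)"
  by (simp add: tensor_lift_def)

lemma tensor_lift_zero [simp]: "tensor_lift g 0 = 0"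
  by (simp add: tensor_lift_def)

lemma tensor_lift_diff: "tensor_lift g (u - v) = tensor_lift g u - tensor_lift g v"
  by (simp add: tensor_lift_def frag_extend_diff)

lemma tensor_lift_add: "tensor_lift g (u + v) = tensor_lift g u + tensor_lift g v"
  by (simp add: tensor_lift_def frag_extend_add)

lemma tensor_lift_compose: "tensor_lift h (tensor_lift g u) = tensor_lift (\<lambda>y. h (g y)) u"
  using subset_UNIV[of "Poly_Mapping.keys u"]
  by (induction u rule: frag_induction) (auto simp: tensor_lift_diff)

lemma tensor_lift_cong:
  assumes "\<And>x y. (x, y) \<in> Poly_Mapping.keys u \<Longrightarrow> g y = h y"
  shows "tensor_lift g u = tensor_lift h u"
  unfolding tensor_lift_def by (rule frag_extend_eq) (use assms in auto)

lemma tensor_lift_ident: "tensor_lift (\<lambda>y. y) u = u"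
  using subset_UNIV[of "Poly_Mapping.keys u"]
  by (induction u rule: frag_induction) (auto simp: tensor_lift_diff)

lemma tensor_lift_keys:
  assumes "g \<in> B \<rightarrow> C" "Poly_Mapping.keys u \<subseteq> A \<times> B"
  shows "Poly_Mapping.keys (tensor_lift g u) \<subseteq> A \<times> C"
  using assms(2)
proof (induction u rule: frag_induction)
  case (one z)
  then show ?case using assms(1) by (cases z) (auto simp: Pi_iff)
next
  case (diff a b)
  then show ?case by (simp add: tensor_lift_diff keys_diff_subset)
qed simp

lemma linear_mapsD:
  assumes "f \<in> linear_maps R M N"
  shows "f \<in> carrier M \<rightarrow> carrier N"
    and "\<And>x. x \<in> carrier M \<Longrightarrow> f x \<in> carrier N"
    and "\<And>x y. x \<in> carrier M \<Longrightarrow> y \<in> carrier M \<Longrightarrow> f (x \<oplus>\<^bsub>M\<^esub> y) = f x \<oplus>\<^bsub>N\<^esub> f y"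
    and "\<And>a x. a \<in> carrier R \<Longrightarrow> x \<in> carrier M \<Longrightarrow> f (a \<odot>\<^bsub>M\<^esub> x) = a \<odot>\<^bsub>N\<^esub> f x"
  using assms by (auto simp: linear_maps_def)

lemma tensor_lift_null:
  assumes M: "module R M" and N: "module R N" and N': "module R N'"
    and g: "g \<in> linear_maps R N N'" and u: "u \<in> tensor_null R M N"
  shows "tensor_lift g u \<in> tensor_null R M N'"
  using M N u
proof (induction rule: tensor_null_induct)
  case zero
  show ?case by (simp add: tensor_null_zero)
next
  case (relation u)
  note g = linear_mapsD(2-)[OF g]
  from relation have "tensor_lift g u \<in> tensor_relations R M N'"
  proof (cases rule: tensor_relations_cases)
    case (add_left x x' y)
    then show ?thesis using g(1)[of y]
      unfolding tensor_relations_def by (simp add: tensor_lift_diff) blast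
  next
    case (add_right x y y')
    then show ?thesis using g(1)[of y] g(1)[of y'] g(2)[of y y']
      unfolding tensor_relations_def by (simp add: tensor_lift_diff) blast
  next
    case (smult a x y)
    then show ?thesis using g(1)[of y] g(3)[of a y]
      unfolding tensor_relations_def by (simp add: tensor_lift_diff) blast
  qed
  then show ?case by (rule tensor_null_incl)
next
  case (diff u v)
  then show ?case by (simp add: tensor_lift_diff tensor_null_diff[OF M N'])
qed

lemma tensor_class_eq_iff:
  assumes "module R M" "module R N"
    and "Poly_Mapping.keys u \<subseteq> carrier M \<times> carrier N"
    and "Poly_Mapping.keys v \<subseteq> carrier M \<times> carrier N"
  shows "tensor_class R M N u = tensor_class R M N v \<longleftrightarrow> u - v \<in> tensor_null R M N"
proof
  assume "tensor_class R M N u = tensor_class R M N v"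
  moreover have "u \<in> tensor_class R M N u"
    unfolding tensor_class_def r_coset_def using tensor_null_zero by force
  ultimately obtain k where "k \<in> tensor_null R M N" "u = k + v"
    by (auto simp: tensor_class_def r_coset_def)
  then show "u - v \<in> tensor_null R M N" by simp
next
  assume d: "u - v \<in> tensor_null R M N"
  have d': "v - u \<in> tensor_null R M N"
    using tensor_null_minus[OF assms(1,2) d] by simp
  have *: "tensor_class R M N p \<subseteq> tensor_class R M N q" if "p - q \<in> tensor_null R M N" for p q
  proof
    fix w assume "w \<in> tensor_class R M N p"
    then obtain k where k: "k \<in> tensor_null R M N" "w = k + p"
      by (auto simp: tensor_class_def r_coset_def)
    then have "k + (p - q) \<in> tensor_null R M N" "w = (k + (p - q)) + q"
      using tensor_null_add[OF k(1) that] by simp_all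
    then show "w \<in> tensor_class R M N q"
      unfolding tensor_class_def r_coset_def by (auto intro!: bexI[of _ "k + (p - q)"])
  qed
  show "tensor_class R M N u = tensor_class R M N v"
    using *[OF d] *[OF d'] by blast
qed

lemma tensor_group_carrier:
  "carrier (tensor_group R M N) =
     tensor_class R M N ` {u. Poly_Mapping.keys u \<subseteq> carrier M \<times> carrier N}"
  unfolding tensor_group_def carrier_FactGroup tensor_class_def
  by (simp add: free_Abelian_group_def)

lemma tensor_group_one: "\<one>\<^bsub>tensor_group R M N\<^esub> = tensor_class R M N 0"
  by (simp add: tensor_group_def tensor_class_def r_coset_def)

lemma tensor_group_comm_group:
  assumes "module R M" "module R N"
  shows "comm_group (tensor_group R M N)"
  unfolding tensor_group_def
  by (rule comm_group.abelian_FactGroup[OF abelian_free_Abelian_group tensor_null_subgroup[OF assms]])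

lemma tensor_group_mult:
  assumes "module R M" "module R N"
    and "Poly_Mapping.keys u \<subseteq> carrier M \<times> carrier N"
    and "Poly_Mapping.keys v \<subseteq> carrier M \<times> carrier N"
  shows "tensor_class R M N u \<otimes>\<^bsub>tensor_group R M N\<^esub> tensor_class R M N v = tensor_class R M N (u + v)"
proof -
  interpret F: comm_group "free_Abelian_group (carrier M \<times> carrier N)"
    by (rule abelian_free_Abelian_group)
  have "tensor_null R M N \<lhd> free_Abelian_group (carrier M \<times> carrier N)"
    using tensor_null_subgroup[OF assms(1,2)] F.normal_iff_subgroup by blast
  from normal.rcos_sum[OF this, of u v] show ?thesis
    using assms(3,4) by (simp add: tensor_group_def tensor_class_def)
qed

lemma tensor_map_class:
  assumes M: "module R M" and N: "module R N" and N': "module R N'"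
    and g: "g \<in> linear_maps R N N'" and u: "Poly_Mapping.keys u \<subseteq> carrier M \<times> carrier N"
  shows "tensor_map R M N' g (tensor_class R M N u) = tensor_class R M N' (tensor_lift g u)"
proof -
  have mem: "u \<in> tensor_class R M N u"
    unfolding tensor_class_def r_coset_def using tensor_null_zero by force
  have "tensor_class R M N' (tensor_lift g v) = tensor_class R M N' (tensor_lift g u)"
    if mem_v: "v \<in> tensor_class R M N u" for v
  proof -
    obtain k where k: "k \<in> tensor_null R M N" "v = k + u"
      using mem_v by (auto simp: tensor_class_def r_coset_def)
    have v: "Poly_Mapping.keys v \<subseteq> carrier M \<times> carrier N"
      using k keys_add_subset[OF tensor_null_keys[OF M N k(1)] u] by simp
    have "tensor_lift g v - tensor_lift g u = tensor_lift g k"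
      using k by (simp add: tensor_lift_add)
    then show ?thesis
      using tensor_class_eq_iff[OF M N' tensor_lift_keys[OF linear_mapsD(1)[OF g] v]
          tensor_lift_keys[OF linear_mapsD(1)[OF g] u]] tensor_lift_null[OF M N N' g k(1)]
      by simp
  qed
  then show ?thesis unfolding tensor_map_def using mem by blast
qed

lemma inj_on_tensor_map_iff:
  assumes M: "module R M" and N: "module R N" and N': "module R N'"
    and g: "g \<in> linear_maps R N N'"
  shows "inj_on (tensor_map R M N' g) (carrier (tensor_group R M N)) \<longleftrightarrow>
    (\<forall>u. Poly_Mapping.keys u \<subseteq> carrier M \<times> carrier N \<longrightarrow>
       tensor_lift g u \<in> tensor_null R M N' \<longrightarrow> u \<in> tensor_null R M N)" (is "?L \<longleftrightarrow> ?R")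
proof
  note keys = tensor_lift_keys[OF linear_mapsD(1)[OF g], of _ "carrier M"]
  show ?R if L: ?L
  proof (intro allI impI)
    fix u assume u: "Poly_Mapping.keys u \<subseteq> carrier M \<times> carrier N"
      and null: "tensor_lift g u \<in> tensor_null R M N'"
    have "tensor_map R M N' g (tensor_class R M N u) = tensor_map R M N' g (tensor_class R M N 0)"
      using tensor_map_class[OF assms u] tensor_map_class[OF assms, of 0]
        tensor_class_eq_iff[OF M N' keys[OF u], of 0] null by simp
    then have "tensor_class R M N u = tensor_class R M N 0"
      using inj_onD[OF L] u unfolding tensor_group_carrier
      by (metis (mono_tags, lifting) empty_subsetI image_eqI keys_zero mem_Collect_eq)
    then show "u \<in> tensor_null R M N"
      using tensor_class_eq_iff[OF M N u, of 0] by simp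
  qed
  show ?L if R: ?R
  proof (rule inj_onI)
    fix U V assume "U \<in> carrier (tensor_group R M N)" "V \<in> carrier (tensor_group R M N)"
      and eq: "tensor_map R M N' g U = tensor_map R M N' g V"
    then obtain u v where U: "U = tensor_class R M N u" and V: "V = tensor_class R M N v"
      and u: "Poly_Mapping.keys u \<subseteq> carrier M \<times> carrier N"
      and v: "Poly_Mapping.keys v \<subseteq> carrier M \<times> carrier N"
      unfolding tensor_group_carrier by blast
    have "tensor_lift g (u - v) \<in> tensor_null R M N'"
      using eq tensor_map_class[OF assms u] tensor_map_class[OF assms v]
        tensor_class_eq_iff[OF M N' keys[OF u] keys[OF v]] U V by (simp add: tensor_lift_diff)
    then show "U = V"
      using R keys_diff_subset[OF u v] tensor_class_eq_iff[OF M N u v] U V by blast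
  qed
qed


subsection \<open>Base change\<close>

lemma restrict_scalars_simps [simp]:
  "carrier (restrict_scalars \<phi> S) = carrier S"
  "ring.add (restrict_scalars \<phi> S) = ring.add S"
  "\<zero>\<^bsub>restrict_scalars \<phi> S\<^esub> = \<zero>\<^bsub>S\<^esub>"
  "a \<odot>\<^bsub>restrict_scalars \<phi> S\<^esub> s = \<phi> a \<otimes>\<^bsub>S\<^esub> s"
  by (simp_all add: restrict_scalars_def)

lemma restrict_scalars_module:
  assumes "cring R" "cring S" "\<phi> \<in> ring_hom R S"
  shows "module R (restrict_scalars \<phi> S)"
proof -
  interpret R: cring R by fact
  interpret S: cring S by fact
  interpret ring_hom_cring R S \<phi>
    using assms by (simp add: ring_hom_cring_def ring_hom_cring_axioms_def)
  have "abelian_group (restrict_scalars \<phi> S)"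
    by (rule abelian_groupI) (auto simp: S.a_ac intro: S.add.l_inv_ex[simplified])
  then show ?thesis
    by (intro moduleI) (simp_all add: assms(1) S.l_distr S.r_distr S.m_assoc)
qed

lemma mult_linear_map:
  assumes "cring R" "cring S" "\<phi> \<in> ring_hom R S" "s \<in> carrier S"
  shows "(\<lambda>t. s \<otimes>\<^bsub>S\<^esub> t) \<in> linear_maps R (restrict_scalars \<phi> S) (restrict_scalars \<phi> S)"
proof -
  interpret S: cring S by fact
  interpret ring_hom_cring R S \<phi>
    using assms by (simp add: ring_hom_cring_def ring_hom_cring_axioms_def)
  show ?thesis
    using assms(4) by (auto simp: linear_maps_def S.r_distr S.m_lcomm)
qed

lemma base_change_simps:
  "carrier (base_change R \<phi> S M) = carrier (tensor_group R M (restrict_scalars \<phi> S))"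
  "\<zero>\<^bsub>base_change R \<phi> S M\<^esub> = \<one>\<^bsub>tensor_group R M (restrict_scalars \<phi> S)\<^esub>"
  "ring.add (base_change R \<phi> S M) = monoid.mult (tensor_group R M (restrict_scalars \<phi> S))"
  "s \<odot>\<^bsub>base_change R \<phi> S M\<^esub> U = tensor_map R M (restrict_scalars \<phi> S) (\<lambda>t. s \<otimes>\<^bsub>S\<^esub> t) U"
  by (simp_all add: base_change_def Let_def)

lemma base_change_smult_pure:
  assumes "module R M" "cring S" "\<phi> \<in> ring_hom R S"
    and "x \<in> carrier M" "s \<in> carrier S" "t \<in> carrier S"
  shows "s \<odot>\<^bsub>base_change R \<phi> S M\<^esub> tensor_class R M (restrict_scalars \<phi> S) (frag_of (x, t)) =
    tensor_class R M (restrict_scalars \<phi> S) (frag_of (x, s \<otimes>\<^bsub>S\<^esub> t))"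
proof -
  have R: "cring R" using assms(1) by (simp add: module_def)
  note N = restrict_scalars_module[OF R assms(2,3)]
  show ?thesis
    using tensor_map_class[OF assms(1) N N mult_linear_map[OF R assms(2,3,5)], of "frag_of (x, t)"]
      assms(4,6) by (simp add: base_change_simps)
qed

lemma base_change_module:
  fixes M :: "('r, 'm, 'z) module_scheme" and S :: "('s, 'y) ring_scheme"
  assumes M: "module R M" and S: "cring S" and \<phi>: "\<phi> \<in> ring_hom R S"
  shows "module S (base_change R \<phi> S M)"
proof -
  have R: "cring R" using M by (simp add: module_def)
  interpret S: cring S by fact
  interpret M: module R M by fact
  let ?N = "restrict_scalars \<phi> S" and ?B = "base_change R \<phi> S M"
  let ?K = "{u :: ('m \<times> 's) \<Rightarrow>\<^sub>0 int. Poly_Mapping.keys u \<subseteq> carrier M \<times> carrier S}"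
  let ?cl = "tensor_class R M ?N"
  let ?l = "\<lambda>s. tensor_lift (\<lambda>t. s \<otimes>\<^bsub>S\<^esub> t)"
  note N = restrict_scalars_module[OF R S \<phi>]
  interpret N: module R ?N by (rule N)
  have lin: "(\<lambda>t. s \<otimes>\<^bsub>S\<^esub> t) \<in> linear_maps R ?N ?N" if "s \<in> carrier S" for s
    by (rule mult_linear_map[OF R S \<phi> that])
  have C: "carrier ?B = ?cl ` ?K"
    by (simp add: base_change_simps tensor_group_carrier)
  have l: "?l s u \<in> ?K" if "s \<in> carrier S" "u \<in> ?K" for s u
    using tensor_lift_keys[of "(\<lambda>t. s \<otimes>\<^bsub>S\<^esub> t)" "carrier S" "carrier S" u] that by auto
  have sm: "s \<odot>\<^bsub>?B\<^esub> ?cl u = ?cl (?l s u)" if "s \<in> carrier S" "u \<in> ?K" for s u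
    using tensor_map_class[OF M N N lin[OF that(1)], of u] that(2) by (simp add: base_change_simps)
  have ad: "?cl u \<oplus>\<^bsub>?B\<^esub> ?cl v = ?cl (u + v)" if "u \<in> ?K" "v \<in> ?K" for u v
    using tensor_group_mult[OF M N, of u v] that by (simp add: base_change_simps)
  have K: "u + v \<in> ?K" if "u \<in> ?K" "v \<in> ?K" for u v
    using keys_add_subset that by simp
  have eq: "?cl u = ?cl v" if "u - v \<in> tensor_null R M ?N" "u \<in> ?K" "v \<in> ?K" for u v
    using tensor_class_eq_iff[OF M N, of u v] that by simp
  interpret T: comm_group "tensor_group R M ?N"
    by (rule tensor_group_comm_group[OF M N])
  have B: "abelian_group ?B"
    by (rule abelian_groupI)
      (auto simp: base_change_simps T.m_ac intro: T.l_inv_ex)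
  show ?thesis
  proof (rule moduleI)
    show "s \<odot>\<^bsub>?B\<^esub> U \<in> carrier ?B" if "s \<in> carrier S" "U \<in> carrier ?B" for s U
      using that sm l unfolding C by auto
    show "(s \<oplus>\<^bsub>S\<^esub> t) \<odot>\<^bsub>?B\<^esub> U = s \<odot>\<^bsub>?B\<^esub> U \<oplus>\<^bsub>?B\<^esub> t \<odot>\<^bsub>?B\<^esub> U"
      if st: "s \<in> carrier S" "t \<in> carrier S" and "U \<in> carrier ?B" for s t U
    proof -
      from that obtain u where u: "u \<in> ?K" "U = ?cl u" unfolding C by blast
      have "?l (s \<oplus>\<^bsub>S\<^esub> t) u - (?l s u + ?l t u) \<in> tensor_null R M ?N"
        using u(1)[simplified]
      proof (induction u rule: frag_induction)
        case (one z)
        then obtain x y where z: "z = (x, y)" "x \<in> carrier M" "y \<in> carrier S" by auto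
        have "frag_of (x, s \<otimes>\<^bsub>S\<^esub> y \<oplus>\<^bsub>?N\<^esub> t \<otimes>\<^bsub>S\<^esub> y) - frag_of (x, s \<otimes>\<^bsub>S\<^esub> y) - frag_of (x, t \<otimes>\<^bsub>S\<^esub> y)
            \<in> tensor_relations R M ?N"
          unfolding tensor_relations_def using z st by auto
        then show ?case
          using tensor_null_incl z st by (simp add: S.l_distr diff_diff_add)
      next
        case (diff a b)
        then show ?case
          using tensor_null_diff[OF M N diff]
          by (simp add: tensor_lift_diff algebra_simps)
      qed (simp add: tensor_null_zero)
      then show ?thesis
        using u st by (simp add: sm ad l K eq del: mem_Collect_eq)
    qed
    show "s \<odot>\<^bsub>?B\<^esub> (U \<oplus>\<^bsub>?B\<^esub> V) = s \<odot>\<^bsub>?B\<^esub> U \<oplus>\<^bsub>?B\<^esub> s \<odot>\<^bsub>?B\<^esub> V"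
      if s: "s \<in> carrier S" and "U \<in> carrier ?B" "V \<in> carrier ?B" for s U V
    proof -
      from that obtain u v where "u \<in> ?K" "U = ?cl u" "v \<in> ?K" "V = ?cl v" unfolding C by blast
      then show ?thesis
        using s by (simp add: sm ad l K tensor_lift_add del: mem_Collect_eq)
    qed
    show "(s \<otimes>\<^bsub>S\<^esub> t) \<odot>\<^bsub>?B\<^esub> U = s \<odot>\<^bsub>?B\<^esub> (t \<odot>\<^bsub>?B\<^esub> U)"
      if st: "s \<in> carrier S" "t \<in> carrier S" and "U \<in> carrier ?B" for s t U
    proof -
      from that obtain u where u: "u \<in> ?K" "U = ?cl u" unfolding C by blast
      have "?l (s \<otimes>\<^bsub>S\<^esub> t) u = ?l s (?l t u)"
        unfolding tensor_lift_compose
        by (rule tensor_lift_cong) (use u st in \<open>auto simp: S.m_assoc\<close>)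
      then show ?thesis
        using u st by (simp add: sm l del: mem_Collect_eq)
    qed
    show "\<one>\<^bsub>S\<^esub> \<odot>\<^bsub>?B\<^esub> U = U" if "U \<in> carrier ?B" for U
    proof -
      from that obtain u where u: "u \<in> ?K" "U = ?cl u" unfolding C by blast
      have "?l \<one>\<^bsub>S\<^esub> u = tensor_lift (\<lambda>y. y) u"
        by (rule tensor_lift_cong) (use u in auto)
      then show ?thesis
        using u by (simp add: sm tensor_lift_ident del: mem_Collect_eq)
    qed
  qed (fact S B)+
qed


subsection \<open>Linear maps and linear combinations\<close>

lemma linear_maps_zero:
  assumes "module R M" "module R N" "f \<in> linear_maps R M N"
  shows "f \<zero>\<^bsub>M\<^esub> = \<zero>\<^bsub>N\<^esub>"
proof -
  interpret M: module R M by fact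
  interpret N: module R N by fact
  have "f (\<zero>\<^bsub>R\<^esub> \<odot>\<^bsub>M\<^esub> \<zero>\<^bsub>M\<^esub>) = \<zero>\<^bsub>R\<^esub> \<odot>\<^bsub>N\<^esub> f \<zero>\<^bsub>M\<^esub>"
    by (rule linear_mapsD(4)[OF assms(3)]) auto
  then show ?thesis using linear_mapsD(2)[OF assms(3), of "\<zero>\<^bsub>M\<^esub>"] by simp
qed

lemma linear_maps_finsum:
  assumes M: "module R M" and N: "module R N" and f: "f \<in> linear_maps R M N"
    and "finite A" "u \<in> A \<rightarrow> carrier M"
  shows "f (\<Oplus>\<^bsub>M\<^esub>i\<in>A. u i) = (\<Oplus>\<^bsub>N\<^esub>i\<in>A. f (u i))"
proof -
  interpret M: module R M by fact
  interpret N: module R N by fact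
  note D = linear_mapsD(2-)[OF f]
  show ?thesis
    using assms(4,5)
    by (induction A rule: finite_induct) (auto simp: linear_maps_zero[OF M N f] D Pi_iff)
qed

lemma linear_maps_compose:
  assumes "f \<in> linear_maps R M N" "g \<in> linear_maps R N P"
  shows "(\<lambda>x. g (f x)) \<in> linear_maps R M P"
  using assms by (auto simp: linear_maps_def Pi_iff)

lemma linear_maps_inv:
  assumes "module R M" "f \<in> linear_maps R M N" "inj_on f (carrier M)" "f ` carrier M = carrier N"
  shows "inv_into (carrier M) f \<in> linear_maps R N M"
proof -
  interpret M: module R M by fact
  note D = linear_mapsD(2-)[OF assms(2)]
  have [simp]: "inv_into (carrier M) f (f x) = x" if "x \<in> carrier M" for x
    using inv_into_f_f[OF assms(3) that] .
  then show ?thesis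
    unfolding linear_maps_def assms(4)[symmetric] by (auto simp flip: D(2,3))
qed

definition transport_module ::
    "('m \<Rightarrow> 'n) \<Rightarrow> ('r, 'm, 'z) module_scheme \<Rightarrow> ('r, 'n) module" where
  "transport_module c M = (let d = inv_into (carrier M) c in
     \<lparr>carrier = c ` carrier M, monoid.mult = undefined, monoid.one = undefined,
      ring.zero = c \<zero>\<^bsub>M\<^esub>, ring.add = (\<lambda>x y. c (d x \<oplus>\<^bsub>M\<^esub> d y)), smult = (\<lambda>a x. c (a \<odot>\<^bsub>M\<^esub> d x))\<rparr>)"

lemma transport_module:
  assumes M: "module R M" and c: "inj_on c (carrier M)"
  shows "module R (transport_module c M)"
    and "c \<in> linear_maps R M (transport_module c M)"
    and "c ` carrier M = carrier (transport_module c M)"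
proof -
  interpret M: module R M by fact
  let ?T = "transport_module c M"
  have [simp]: "inv_into (carrier M) c (c x) = x" if "x \<in> carrier M" for x
    using inv_into_f_f[OF c that] .
  have [simp]: "carrier ?T = c ` carrier M" "\<zero>\<^bsub>?T\<^esub> = c \<zero>\<^bsub>M\<^esub>"
    by (simp_all add: transport_module_def Let_def)
  have [simp]: "c x \<oplus>\<^bsub>?T\<^esub> c y = c (x \<oplus>\<^bsub>M\<^esub> y)" if "x \<in> carrier M" "y \<in> carrier M" for x y
    using that by (simp add: transport_module_def Let_def)
  have [simp]: "a \<odot>\<^bsub>?T\<^esub> c x = c (a \<odot>\<^bsub>M\<^esub> x)" if "x \<in> carrier M" for a x
    using that by (simp add: transport_module_def Let_def)
  have "abelian_group ?T"
  proof (rule abelian_groupI)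
    show "\<exists>y\<in>carrier ?T. y \<oplus>\<^bsub>?T\<^esub> x = \<zero>\<^bsub>?T\<^esub>" if "x \<in> carrier ?T" for x
    proof -
      from that obtain z where "z \<in> carrier M" "x = c z" by auto
      then show ?thesis by (auto intro!: bexI[of _ "\<ominus>\<^bsub>M\<^esub> z"] simp: M.M.l_neg)
    qed
  qed (auto simp: M.M.a_ac)
  then show "module R ?T"
    by (intro moduleI)
      (auto simp: M.smult_l_distr M.smult_r_distr M.smult_assoc1 intro: M.R.is_cring)
  show "c \<in> linear_maps R M ?T" "c ` carrier M = carrier ?T"
    by (auto simp: linear_maps_def)
qed


subsection \<open>Projective modules\<close>

definition free_module :: "('r, 'x) ring_scheme \<Rightarrow> 'i set \<Rightarrow> ('r, 'i \<Rightarrow> 'r) module" where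
  "free_module R I =
     \<lparr>carrier = {c \<in> UNIV \<rightarrow> carrier R. finite {i. c i \<noteq> \<zero>\<^bsub>R\<^esub>} \<and> {i. c i \<noteq> \<zero>\<^bsub>R\<^esub>} \<subseteq> I},
      monoid.mult = undefined, monoid.one = undefined, ring.zero = (\<lambda>_. \<zero>\<^bsub>R\<^esub>),
      ring.add = (\<lambda>c d i. c i \<oplus>\<^bsub>R\<^esub> d i), smult = (\<lambda>a c i. a \<otimes>\<^bsub>R\<^esub> c i)\<rparr>"

lemma free_module_module:
  assumes "cring R"
  shows "module R (free_module R I)"
proof -
  interpret R: cring R by fact
  let ?F = "free_module R I"
  have add: "c \<oplus>\<^bsub>?F\<^esub> d \<in> carrier ?F" if "c \<in> carrier ?F" "d \<in> carrier ?F" for c d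
  proof -
    have supp: "{i. c i \<oplus>\<^bsub>R\<^esub> d i \<noteq> \<zero>\<^bsub>R\<^esub>} \<subseteq> {i. c i \<noteq> \<zero>\<^bsub>R\<^esub>} \<union> {i. d i \<noteq> \<zero>\<^bsub>R\<^esub>}" by auto
    have cd: "c i \<in> carrier R" "d i \<in> carrier R" "finite {i. c i \<noteq> \<zero>\<^bsub>R\<^esub>}" "finite {i. d i \<noteq> \<zero>\<^bsub>R\<^esub>}"
      "{i. c i \<noteq> \<zero>\<^bsub>R\<^esub>} \<subseteq> I" "{i. d i \<noteq> \<zero>\<^bsub>R\<^esub>} \<subseteq> I" for i
      using that unfolding free_module_def by auto
    have "finite {i. c i \<oplus>\<^bsub>R\<^esub> d i \<noteq> \<zero>\<^bsub>R\<^esub>}" by (rule finite_subset[OF supp]) (simp add: cd)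
    moreover have "{i. c i \<oplus>\<^bsub>R\<^esub> d i \<noteq> \<zero>\<^bsub>R\<^esub>} \<subseteq> I" using supp cd(5,6) by blast
    ultimately show ?thesis unfolding free_module_def by (simp add: cd(1,2))
  qed
  have smult: "a \<odot>\<^bsub>?F\<^esub> c \<in> carrier ?F" if "a \<in> carrier R" "c \<in> carrier ?F" for a c
  proof -
    have supp: "{i. a \<otimes>\<^bsub>R\<^esub> c i \<noteq> \<zero>\<^bsub>R\<^esub>} \<subseteq> {i. c i \<noteq> \<zero>\<^bsub>R\<^esub>}" using that(1) by auto
    have c: "c i \<in> carrier R" "finite {i. c i \<noteq> \<zero>\<^bsub>R\<^esub>}" "{i. c i \<noteq> \<zero>\<^bsub>R\<^esub>} \<subseteq> I" for i
      using that unfolding free_module_def by auto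
    have "finite {i. a \<otimes>\<^bsub>R\<^esub> c i \<noteq> \<zero>\<^bsub>R\<^esub>}" by (rule finite_subset[OF supp]) (simp add: c)
    moreover have "{i. a \<otimes>\<^bsub>R\<^esub> c i \<noteq> \<zero>\<^bsub>R\<^esub>} \<subseteq> I" using supp c(3) by blast
    ultimately show ?thesis unfolding free_module_def by (simp add: c(1) that(1))
  qed
  have ab: "abelian_group ?F"
  proof (rule abelian_groupI)
    fix c assume c: "c \<in> carrier ?F"
    show "\<exists>d\<in>carrier ?F. d \<oplus>\<^bsub>?F\<^esub> c = \<zero>\<^bsub>?F\<^esub>"
    proof
      show "(\<ominus>\<^bsub>R\<^esub> \<one>\<^bsub>R\<^esub>) \<odot>\<^bsub>?F\<^esub> c \<in> carrier ?F" using c by (intro smult) auto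
      show "(\<ominus>\<^bsub>R\<^esub> \<one>\<^bsub>R\<^esub>) \<odot>\<^bsub>?F\<^esub> c \<oplus>\<^bsub>?F\<^esub> c = \<zero>\<^bsub>?F\<^esub>"
        using c by (auto simp: free_module_def fun_eq_iff R.l_minus R.l_neg Pi_iff)
    qed
  qed (use add in \<open>auto simp: free_module_def fun_eq_iff R.a_ac Pi_iff\<close>)
  show ?thesis
    by (rule moduleI[OF assms ab smult])
      (auto simp: free_module_def fun_eq_iff R.l_distr R.r_distr R.m_assoc Pi_iff)
qed

definition free_module_lift ::
    "('r, 'x) ring_scheme \<Rightarrow> ('r, 'n, 'w) module_scheme \<Rightarrow> ('i \<Rightarrow> 'n) \<Rightarrow> ('i \<Rightarrow> 'r) \<Rightarrow> 'n" where
  "free_module_lift R N e c = (\<Oplus>\<^bsub>N\<^esub>i \<in> {i. c i \<noteq> \<zero>\<^bsub>R\<^esub>}. c i \<odot>\<^bsub>N\<^esub> e i)"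

lemma free_module_lift_eq:
  assumes N: "module R N" and e: "e \<in> I \<rightarrow> carrier N"
    and c: "c \<in> UNIV \<rightarrow> carrier R" and A: "finite A" "{i. c i \<noteq> \<zero>\<^bsub>R\<^esub>} \<subseteq> A" "A \<subseteq> I"
  shows "free_module_lift R N e c = (\<Oplus>\<^bsub>N\<^esub>i \<in> A. c i \<odot>\<^bsub>N\<^esub> e i)"
proof -
  interpret N: module R N by fact
  show ?thesis
    unfolding free_module_lift_def
    by (rule N.M.add.finprod_mono_neutral_cong_left) (use e c A in \<open>auto simp: Pi_iff subset_iff\<close>)
qed

lemma free_module_lift_linear:
  assumes N: "module R N" and e: "e \<in> I \<rightarrow> carrier N"
  shows "free_module_lift R N e \<in> linear_maps R (free_module R I) N"
proof -
  interpret N: module R N by fact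
  let ?F = "free_module R I"
  interpret F: module R ?F by (rule free_module_module) (rule N.R.is_cring)
  have FD: "c \<in> UNIV \<rightarrow> carrier R" "finite {i. c i \<noteq> \<zero>\<^bsub>R\<^esub>}" "{i. c i \<noteq> \<zero>\<^bsub>R\<^esub>} \<subseteq> I"
    if "c \<in> carrier ?F" for c
    using that by (auto simp: free_module_def)
  show ?thesis
    unfolding linear_maps_def
  proof (intro CollectI conjI ballI Pi_I)
    fix c assume c: "c \<in> carrier ?F"
    show "free_module_lift R N e c \<in> carrier N"
      unfolding free_module_lift_def
      by (rule N.M.finsum_closed) (use FD[OF c] e in \<open>auto simp: Pi_iff\<close>)
    fix a assume a: "a \<in> carrier R"
    have "free_module_lift R N e (a \<odot>\<^bsub>?F\<^esub> c) = (\<Oplus>\<^bsub>N\<^esub>i \<in> {i. c i \<noteq> \<zero>\<^bsub>R\<^esub>}. (a \<otimes>\<^bsub>R\<^esub> c i) \<odot>\<^bsub>N\<^esub> e i)"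
      by (subst free_module_lift_eq[OF N e _ FD(2)[OF c] _ FD(3)[OF c]])
        (use FD(1)[OF c] a in \<open>auto simp: free_module_def Pi_iff\<close>)
    also have "\<dots> = (\<Oplus>\<^bsub>N\<^esub>i \<in> {i. c i \<noteq> \<zero>\<^bsub>R\<^esub>}. a \<odot>\<^bsub>N\<^esub> (c i \<odot>\<^bsub>N\<^esub> e i))"
      by (rule N.M.finsum_cong') (use FD[OF c] a e in \<open>auto simp: N.smult_assoc1 Pi_iff\<close>)
    also have "\<dots> = a \<odot>\<^bsub>N\<^esub> free_module_lift R N e c"
      unfolding free_module_lift_def
      by (rule N.finsum_smult_ldistr[symmetric]) (use FD[OF c] a e in \<open>auto simp: Pi_iff\<close>)
    finally show "free_module_lift R N e (a \<odot>\<^bsub>?F\<^esub> c) = a \<odot>\<^bsub>N\<^esub> free_module_lift R N e c" .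
  next
    fix c d assume c: "c \<in> carrier ?F" and d: "d \<in> carrier ?F"
    let ?A = "{i. c i \<noteq> \<zero>\<^bsub>R\<^esub>} \<union> {i. d i \<noteq> \<zero>\<^bsub>R\<^esub>}"
    have A: "finite ?A" "?A \<subseteq> I" using FD[OF c] FD[OF d] by auto
    have e': "e i \<in> carrier N" if "i \<in> ?A" for i using that A e by auto
    have cd: "c i \<in> carrier R" "d i \<in> carrier R" for i using FD(1)[OF c] FD(1)[OF d] by auto
    have "free_module_lift R N e (c \<oplus>\<^bsub>?F\<^esub> d) = (\<Oplus>\<^bsub>N\<^esub>i \<in> ?A. (c i \<oplus>\<^bsub>R\<^esub> d i) \<odot>\<^bsub>N\<^esub> e i)"
      by (subst free_module_lift_eq[OF N e _ A(1) _ A(2)])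
        (use cd in \<open>auto simp: free_module_def\<close>)
    also have "\<dots> = (\<Oplus>\<^bsub>N\<^esub>i \<in> ?A. c i \<odot>\<^bsub>N\<^esub> e i \<oplus>\<^bsub>N\<^esub> d i \<odot>\<^bsub>N\<^esub> e i)"
      by (rule N.M.finsum_cong') (use cd e' in \<open>auto simp: N.smult_l_distr\<close>)
    also have "\<dots> = (\<Oplus>\<^bsub>N\<^esub>i \<in> ?A. c i \<odot>\<^bsub>N\<^esub> e i) \<oplus>\<^bsub>N\<^esub> (\<Oplus>\<^bsub>N\<^esub>i \<in> ?A. d i \<odot>\<^bsub>N\<^esub> e i)"
      by (rule N.M.finsum_addf) (use cd e' in auto)
    also have "\<dots> = free_module_lift R N e c \<oplus>\<^bsub>N\<^esub> free_module_lift R N e d"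
      using free_module_lift_eq[OF N e FD(1)[OF c] A(1) _ A(2)]
        free_module_lift_eq[OF N e FD(1)[OF d] A(1) _ A(2)] by simp
    finally show "free_module_lift R N e (c \<oplus>\<^bsub>?F\<^esub> d) =
      free_module_lift R N e c \<oplus>\<^bsub>N\<^esub> free_module_lift R N e d" .
  qed
qed

lemma free_module_lift_single:
  assumes N: "module R N" and i: "i \<in> I" and e: "e i \<in> carrier N"
  shows "(\<lambda>j. if j = i then \<one>\<^bsub>R\<^esub> else \<zero>\<^bsub>R\<^esub>) \<in> carrier (free_module R I)"
    and "free_module_lift R N e (\<lambda>j. if j = i then \<one>\<^bsub>R\<^esub> else \<zero>\<^bsub>R\<^esub>) = e i"
proof -
  interpret N: module R N by fact
  have supp: "{j. (if j = i then \<one>\<^bsub>R\<^esub> else \<zero>\<^bsub>R\<^esub>) \<noteq> \<zero>\<^bsub>R\<^esub>} \<subseteq> {i}" by auto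
  then show "(\<lambda>j. if j = i then \<one>\<^bsub>R\<^esub> else \<zero>\<^bsub>R\<^esub>) \<in> carrier (free_module R I)"
    using i finite_subset[OF supp] unfolding free_module_def by auto
  show "free_module_lift R N e (\<lambda>j. if j = i then \<one>\<^bsub>R\<^esub> else \<zero>\<^bsub>R\<^esub>) = e i"
    by (subst free_module_lift_eq[OF N _ _ _ supp subset_refl]) (use e in auto)
qed

lemma free_module_lift_map:
  assumes N: "module R N" and P: "module R P" and g: "g \<in> linear_maps R N P"
    and e: "e \<in> I \<rightarrow> carrier N" and c: "c \<in> carrier (free_module R I)"
  shows "g (free_module_lift R N e c) = free_module_lift R P (\<lambda>i. g (e i)) c"
proof -
  interpret N: module R N by fact
  interpret P: module R P by fact
  have c: "c i \<in> carrier R" "finite {i. c i \<noteq> \<zero>\<^bsub>R\<^esub>}" "{i. c i \<noteq> \<zero>\<^bsub>R\<^esub>} \<subseteq> I" for i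
    using c by (auto simp: free_module_def)
  show ?thesis
    unfolding free_module_lift_def
    by (subst linear_maps_finsum[OF N P g c(2)], use c e in force, rule P.M.finsum_cong')
      (use c e linear_mapsD(2-)[OF g] in \<open>auto simp: Pi_iff subset_iff\<close>)
qed

lemma free_module_lift_cong:
  assumes P: "module R P" and c: "c \<in> carrier (free_module R I)"
    and e: "\<And>i. i \<in> I \<Longrightarrow> e i = e' i" "\<And>i. i \<in> I \<Longrightarrow> e' i \<in> carrier P"
  shows "free_module_lift R P e c = free_module_lift R P e' c"
proof -
  interpret P: module R P by fact
  show ?thesis
    unfolding free_module_lift_def
    by (rule P.M.finsum_cong') (use c e in \<open>auto simp: free_module_def Pi_iff subset_iff\<close>)
qed

lemma projective_module_split:
  assumes M: "module R M" and proj: "projective_module R M"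
  obtains s where "s \<in> linear_maps R M (free_module R (carrier M))"
    and "\<And>x. x \<in> carrier M \<Longrightarrow> free_module_lift R M (\<lambda>y. y) (s x) = x"
proof -
  interpret M: module R M by fact
  let ?F = "free_module R (carrier M)"
  note F = free_module_module[OF M.R.is_cring, of "carrier M"]
  let ?P = "transport_module (\<lambda>x. x) M"
  note P = transport_module[OF M inj_on_id2]
  have p: "free_module_lift R M (\<lambda>y. y) \<in> linear_maps R ?F M"
    by (rule free_module_lift_linear[OF M]) auto
  have p': "free_module_lift R M (\<lambda>y. y) \<in> linear_maps R ?F ?P"
    using linear_maps_compose[OF p P(2)] .
  have surj: "free_module_lift R M (\<lambda>y. y) ` carrier ?F = carrier ?P"
  proof
    show "free_module_lift R M (\<lambda>y. y) ` carrier ?F \<subseteq> carrier ?P"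
      using linear_mapsD(1)[OF p'] by auto
    show "carrier ?P \<subseteq> free_module_lift R M (\<lambda>y. y) ` carrier ?F"
    proof
      fix x assume "x \<in> carrier ?P"
      then have x: "x \<in> carrier M" using P(3) by auto
      show "x \<in> free_module_lift R M (\<lambda>y. y) ` carrier ?F"
        using imageI[OF free_module_lift_single(1)[OF M x], of "\<lambda>y. y" "free_module_lift R M (\<lambda>y. y)"]
          free_module_lift_single(2)[OF M x, of "\<lambda>y. y"] x by simp
    qed
  qed
  have "\<exists>s \<in> linear_maps R M ?F. \<forall>x \<in> carrier M. free_module_lift R M (\<lambda>y. y) (s x) = x"
    using proj F P(1,2) p' surj unfolding projective_module_def by blast
  then show thesis using that by blast
qed

theorem projective_module_lift:
  assumes M: "module R M" and proj: "projective_module R M"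
    and N: "module R N" and P: "module R P"
    and g: "g \<in> linear_maps R N P" and surj: "g ` carrier N = carrier P"
    and f: "f \<in> linear_maps R M P"
  shows "\<exists>h \<in> linear_maps R M N. \<forall>x \<in> carrier M. g (h x) = f x"
proof -
  obtain s where s: "s \<in> linear_maps R M (free_module R (carrier M))"
    and s': "\<And>x. x \<in> carrier M \<Longrightarrow> free_module_lift R M (\<lambda>y. y) (s x) = x"
    using projective_module_split[OF M proj] by metis
  define e where "e x = inv_into (carrier N) g (f x)" for x
  have e: "e x \<in> carrier N" "g (e x) = f x" if "x \<in> carrier M" for x
    using linear_mapsD(2)[OF f that] inv_into_into[of "f x" g "carrier N"]
      f_inv_into_f[of "f x" g "carrier N"] unfolding e_def surj by auto
  have eN: "e \<in> carrier M \<rightarrow> carrier N" using e by auto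
  show ?thesis
  proof (intro bexI ballI)
    show "(\<lambda>x. free_module_lift R N e (s x)) \<in> linear_maps R M N"
      by (rule linear_maps_compose[OF s free_module_lift_linear[OF N eN]])
    fix x assume x: "x \<in> carrier M"
    note sx = linear_mapsD(2)[OF s x]
    have "g (free_module_lift R N e (s x)) = free_module_lift R P (\<lambda>i. g (e i)) (s x)"
      by (rule free_module_lift_map[OF N P g eN sx])
    also have "\<dots> = free_module_lift R P f (s x)"
      by (rule free_module_lift_cong[OF P sx]) (use e linear_mapsD(2)[OF f] in auto)
    also have "\<dots> = f (free_module_lift R M (\<lambda>y. y) (s x))"
      by (rule free_module_lift_map[OF M P f _ sx, symmetric]) auto
    finally show "g (free_module_lift R N e (s x)) = f x" by (simp add: s' x)
  qed
qed


subsection \<open>Flat modules\<close>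

lemma submodule_inclusion:
  assumes "submodule H R N"
  shows "(\<lambda>x. x) \<in> linear_maps R (N\<lparr>carrier := H\<rparr>) N"
  using subgroup.subset[OF submodule.axioms(1)[OF assms]] by (auto simp: linear_maps_def)

lemma submodule_preimage:
  assumes N: "module R N" and N': "module R N'" and g: "g \<in> linear_maps R N N'"
    and K: "submodule K R N'"
  shows "submodule {x \<in> carrier N. g x \<in> K} R N"
proof -
  interpret N: module R N by fact
  interpret N': module R N' by fact
  note D = linear_mapsD(2-)[OF g] and E = N'.submoduleE[OF K]
  show ?thesis
  proof (rule N.submoduleI)
    show "\<zero>\<^bsub>N\<^esub> \<in> {x \<in> carrier N. g x \<in> K}"
      using subgroup.one_closed[OF submodule.axioms(1)[OF K]] linear_maps_zero[OF N N' g] by simp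
    show sm: "a \<odot>\<^bsub>N\<^esub> x \<in> {x \<in> carrier N. g x \<in> K}"
      if "a \<in> carrier R" "x \<in> {x \<in> carrier N. g x \<in> K}" for a x
      using that by (simp add: D E)
    show "\<ominus>\<^bsub>N\<^esub> x \<in> {x \<in> carrier N. g x \<in> K}" if "x \<in> {x \<in> carrier N. g x \<in> K}" for x
      using sm[of "\<ominus>\<^bsub>R\<^esub> \<one>\<^bsub>R\<^esub>" x] that N.smult_l_minus[of "\<one>\<^bsub>R\<^esub>" x] by simp
  qed (auto simp: D E)
qed

lemma submodule_finite_span:
  assumes N: "module R N" and B: "finite B" "B \<subseteq> carrier N"
  obtains H and c :: "'n \<Rightarrow> (nat \<Rightarrow> 'r) set"
  where "submodule H R (N :: ('r, 'n, 'w) module_scheme)" "B \<subseteq> H" "inj_on c H"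
    "\<And>K. submodule K R N \<Longrightarrow> B \<subseteq> K \<Longrightarrow> H \<subseteq> K"
proof -
  interpret N: module R N by fact
  obtain e and k :: nat where e: "B = e ` {..<k}"
    using finite_imp_nat_seg_image_inj_on[OF B(1)] by (auto simp: lessThan_def)
  have eN: "e \<in> {..<k} \<rightarrow> carrier N" using B(2) e by auto
  let ?F = "free_module R {..<k}" and ?l = "free_module_lift R N e"
  interpret F: module R ?F by (rule free_module_module) (rule N.R.is_cring)
  have l: "?l \<in> linear_maps R ?F N" by (rule free_module_lift_linear[OF N eN])
  note D = linear_mapsD(2-)[OF l]
  let ?H = "?l ` carrier ?F"
  have zero: "?l \<zero>\<^bsub>?F\<^esub> = \<zero>\<^bsub>N\<^esub>" by (rule linear_maps_zero[OF F.module_axioms N l])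
  have "submodule ?H R N"
  proof (rule N.submoduleI)
    show "\<zero>\<^bsub>N\<^esub> \<in> ?H" using zero by (metis F.M.zero_closed imageI)
    show sm: "a \<odot>\<^bsub>N\<^esub> x \<in> ?H" if "a \<in> carrier R" "x \<in> ?H" for a x
    proof -
      obtain v where v: "v \<in> carrier ?F" "x = ?l v" using \<open>x \<in> ?H\<close> by (rule imageE)
      show ?thesis
        using imageI[OF F.smult_closed[OF that(1) v(1)], of ?l] D(3)[OF that(1) v(1)] v(2) by simp
    qed
    show "x \<oplus>\<^bsub>N\<^esub> y \<in> ?H" if "x \<in> ?H" "y \<in> ?H" for x y
    proof -
      obtain v where v: "v \<in> carrier ?F" "x = ?l v" using \<open>x \<in> ?H\<close> by (rule imageE)
      obtain w where w: "w \<in> carrier ?F" "y = ?l w" using \<open>y \<in> ?H\<close> by (rule imageE)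
      show ?thesis
        using imageI[OF F.M.a_closed[OF v(1) w(1)], of ?l] D(2)[OF v(1) w(1)] v(2) w(2) by simp
    qed
    show H: "?H \<subseteq> carrier N" using D(1) by auto
    show "\<ominus>\<^bsub>N\<^esub> x \<in> ?H" if "x \<in> ?H" for x
    proof -
      have "x \<in> carrier N" using H that by (rule subsetD)
      then have "(\<ominus>\<^bsub>R\<^esub> \<one>\<^bsub>R\<^esub>) \<odot>\<^bsub>N\<^esub> x = \<ominus>\<^bsub>N\<^esub> x" using N.smult_l_minus[of "\<one>\<^bsub>R\<^esub>" x] by simp
      moreover have "(\<ominus>\<^bsub>R\<^esub> \<one>\<^bsub>R\<^esub>) \<odot>\<^bsub>N\<^esub> x \<in> ?H" by (rule sm[OF _ that]) simp
      ultimately show ?thesis by simp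
    qed
  qed
  moreover have "B \<subseteq> ?H"
  proof
    fix b assume "b \<in> B"
    then obtain i where i: "i \<in> {..<k}" "b = e i" using e by auto
    have ei: "e i \<in> carrier N" using eN i(1) by (rule funcset_mem)
    show "b \<in> ?H"
      using imageI[OF free_module_lift_single(1)[where e = e, OF N i(1) ei], of ?l]
        free_module_lift_single(2)[where e = e, OF N i(1) ei] i(2) by simp
  qed
  moreover have "inj_on (\<lambda>x. {c \<in> carrier ?F. ?l c = x}) ?H"
    by (rule inj_onI) blast
  moreover have "?H \<subseteq> K" if K: "submodule K R N" "B \<subseteq> K" for K
  proof
    fix x assume "x \<in> ?H"
    then obtain c where c: "c \<in> carrier ?F" "x = ?l c" by blast
    let ?K = "N\<lparr>carrier := K\<rparr>"
    note mod_K = submodule.submodule_is_module[OF K(1) N]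
    have eK: "e \<in> {..<k} \<rightarrow> carrier ?K" using K(2) e by auto
    have "free_module_lift R ?K e c = x"
      using free_module_lift_map[OF mod_K N submodule_inclusion[OF K(1)] eK c(1)] c(2) by simp
    then show "x \<in> K"
      using linear_mapsD(2)[OF free_module_lift_linear[OF mod_K eK] c(1)] by simp
  qed
  ultimately show thesis by (rule that)
qed

lemma tensor_null_finite:
  assumes M: "module R M" and N: "module R N" and u: "u \<in> tensor_null R M N"
  shows "\<exists>B. finite B \<and> B \<subseteq> carrier N \<and>
    (\<forall>H. submodule H R N \<longrightarrow> B \<subseteq> H \<longrightarrow> u \<in> tensor_null R M (N\<lparr>carrier := H\<rparr>))"
  using M N u
proof (induction rule: tensor_null_induct)
  case zero
  show ?case by (auto intro: exI[of _ "{}"] tensor_null_zero)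
next
  case (relation u)
  then show ?case
  proof (cases rule: tensor_relations_cases)
    case (add_left x x' y)
    then show ?thesis
      by (intro exI[of _ "{y}"] conjI allI impI tensor_null_incl)
        (force simp: tensor_relations_def)+
  next
    case (add_right x y y')
    then show ?thesis
      by (intro exI[of _ "{y, y'}"] conjI allI impI tensor_null_incl)
        (force simp: tensor_relations_def)+
  next
    case (smult a x y)
    then show ?thesis
      by (intro exI[of _ "{y}"] conjI allI impI tensor_null_incl)
        (force simp: tensor_relations_def)+
  qed
next
  case (diff u v)
  then obtain B C where "finite B" "B \<subseteq> carrier N" "finite C" "C \<subseteq> carrier N"
    and B: "\<And>H. submodule H R N \<Longrightarrow> B \<subseteq> H \<Longrightarrow> u \<in> tensor_null R M (N\<lparr>carrier := H\<rparr>)"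
    and C: "\<And>H. submodule H R N \<Longrightarrow> C \<subseteq> H \<Longrightarrow> v \<in> tensor_null R M (N\<lparr>carrier := H\<rparr>)"
    by blast
  then show ?case
    by (intro exI[of _ "B \<union> C"] conjI allI impI
        tensor_null_diff[OF M submodule.submodule_is_module[OF _ N]]) auto
qed

theorem flat_module_inj:
  fixes M :: "('r, 'm, 'z) module_scheme"
  assumes M: "module R M" and flat: "flat_module R M"
    and N: "module R N" and N': "module R N'"
    and g: "g \<in> linear_maps R N N'" and inj: "inj_on g (carrier N)"
  shows "inj_on (tensor_map R M N' g) (carrier (tensor_group R M N))"
  unfolding inj_on_tensor_map_iff[OF M N N' g]
proof (intro allI impI)
  fix u assume u: "Poly_Mapping.keys u \<subseteq> carrier M \<times> carrier N"
    and null: "tensor_lift g u \<in> tensor_null R M N'"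
  let ?B = "snd ` Poly_Mapping.keys u"
  have B: "finite ?B" "?B \<subseteq> carrier N"
    using u by auto
  obtain H and c :: "_ \<Rightarrow> (nat \<Rightarrow> 'r) set" where H: "submodule H R N" and BH: "?B \<subseteq> H"
    and c: "inj_on c H" and H_min: "\<And>K. submodule K R N \<Longrightarrow> ?B \<subseteq> K \<Longrightarrow> H \<subseteq> K"
    using submodule_finite_span[OF N B] by metis
  obtain C where C: "finite C" "C \<subseteq> carrier N'"
    and C_null: "\<And>K. submodule K R N' \<Longrightarrow> C \<subseteq> K \<Longrightarrow>
      tensor_lift g u \<in> tensor_null R M (N'\<lparr>carrier := K\<rparr>)"
    using tensor_null_finite[OF M N' null] by blast
  have B': "finite (C \<union> g ` ?B)" "C \<union> g ` ?B \<subseteq> carrier N'"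
    using B C linear_mapsD(2)[OF g] by auto
  obtain H' and c' :: "_ \<Rightarrow> (nat \<Rightarrow> 'r) set" where H': "submodule H' R N'"
    and BH': "C \<union> g ` ?B \<subseteq> H'" and c': "inj_on c' H'"
    using submodule_finite_span[OF N' B'] by metis
  have HN: "H \<subseteq> carrier N" using H by (simp add: module.submoduleE(1)[OF N])
  have gH: "g x \<in> H'" if "x \<in> H" for x
  proof -
    have "?B \<subseteq> {x \<in> carrier N. g x \<in> H'}" using BH' B(2) by blast
    then show ?thesis using H_min[OF submodule_preimage[OF N N' g H']] that by blast
  qed
  let ?H = "N\<lparr>carrier := H\<rparr>" and ?H' = "N'\<lparr>carrier := H'\<rparr>"
  note mH = submodule.submodule_is_module[OF H N]
    and mH' = submodule.submodule_is_module[OF H' N']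
  have g': "g \<in> linear_maps R ?H ?H'"
    using gH HN linear_mapsD(3-)[OF g] by (auto simp: linear_maps_def subset_iff)
  have uH: "Poly_Mapping.keys u \<subseteq> carrier M \<times> carrier ?H"
    using u BH by force
  let ?T = "transport_module c ?H" and ?T' = "transport_module c' ?H'"
  note T = transport_module[OF mH, of c] and T' = transport_module[OF mH', of c']
  have T: "module R ?T" "c \<in> linear_maps R ?H ?T" "c ` H = carrier ?T"
    using T c by simp_all
  have T': "module R ?T'" "c' \<in> linear_maps R ?H' ?T'"
    using T' c' by simp_all
  let ?d = "inv_into H c"
  have d: "?d \<in> linear_maps R ?T ?H"
    using linear_maps_inv[OF mH T(2)] c T(3) by simp
  have dc: "?d (c y) = y" if "y \<in> H" for y
    using inv_into_f_f[OF c that] .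
  let ?h = "\<lambda>z. c' (g (?d z))"
  have h: "?h \<in> linear_maps R ?T ?T'"
    by (rule linear_maps_compose[OF linear_maps_compose[OF d g'] T'(2)])
  have "inj_on ?h (carrier ?T)"
    unfolding T(3)[symmetric]
  proof (rule inj_onI)
    fix y z assume "y \<in> c ` H" "z \<in> c ` H" and eq: "?h y = ?h z"
    then obtain y' z' where y: "y = c y'" "y' \<in> H" and z: "z = c z'" "z' \<in> H" by blast
    have "g y' = g z'"
      using eq inj_onD[OF c'] gH y z by (simp add: dc)
    then show "y = z"
      using inj_onD[OF inj] y z HN by blast
  qed
  then have "inj_on (tensor_map R M ?T' ?h) (carrier (tensor_group R M ?T))"
    using flat T(1) T'(1) h unfolding flat_module_def by blast
  then have *: "v \<in> tensor_null R M ?T"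
    if "Poly_Mapping.keys v \<subseteq> carrier M \<times> carrier ?T" "tensor_lift ?h v \<in> tensor_null R M ?T'" for v
    using that unfolding inj_on_tensor_map_iff[OF M T(1) T'(1) h] by blast
  have uc: "y \<in> H" if "(x, y) \<in> Poly_Mapping.keys u" for x y
    using BH that by force
  have "tensor_lift ?h (tensor_lift c u) = tensor_lift c' (tensor_lift g u)"
    unfolding tensor_lift_compose by (rule tensor_lift_cong) (simp add: dc[OF uc])
  moreover have "tensor_lift c' (tensor_lift g u) \<in> tensor_null R M ?T'"
    using tensor_lift_null[OF M mH' T'(1) T'(2) C_null[OF H']] BH' by simp
  ultimately have "tensor_lift c u \<in> tensor_null R M ?T"
    using *[OF tensor_lift_keys[OF linear_mapsD(1)[OF T(2)] uH]] by simp
  from tensor_lift_null[OF M T(1) mH d this] have "tensor_lift (\<lambda>y. ?d (c y)) u \<in> tensor_null R M ?H"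
    by (simp add: tensor_lift_compose)
  moreover have "tensor_lift (\<lambda>y. ?d (c y)) u = tensor_lift (\<lambda>y. y) u"
    by (rule tensor_lift_cong) (simp add: dc[OF uc])
  ultimately have "u \<in> tensor_null R M ?H"
    by (simp add: tensor_lift_ident)
  from tensor_lift_null[OF M mH N submodule_inclusion[OF H] this] show "u \<in> tensor_null R M N"
    by (simp add: tensor_lift_ident)
qed

end

theory Submission
  imports Defs
begin

text \<open>
  Let \<open>F\<close> be the free module on a finite set of generators of \<open>M\<close>, let \<open>p\<close> be the projection of
  \<open>F\<close> onto \<open>M\<close> and let \<open>K\<close> be its kernel. The module \<open>M\<close> is projective iff some endomorphism
  of \<open>F\<close> with values in \<open>K\<close> is the identity on \<open>K\<close>, and this condition passes to \<open>S\<close>.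
  Conversely, flatness yields, for every finite subset of \<open>K\<close>, an endomorphism of \<open>F\<close> with values
  in \<open>K\<close> that fixes this subset, so it suffices that \<open>K\<close> is finitely generated. If the base
  change is projective, its relations are spanned by the images of a finite subset \<open>P\<close> of \<open>K\<close>, and an
  endomorphism \<open>\<theta>\<close> fixing \<open>P\<close> is the identity on \<open>K\<close> modulo the kernel of \<open>\<phi>\<close>. Then \<open>K\<close>
  is the image of \<open>\<theta>\<close>, by a Nakayama argument for polynomials in an endomorphism.
\<close>

section \<open>Linear maps and free modules\<close>

text \<open>The obstacle is that \<open>K\<close> is not known to be finitely generated. So
  Nakayama's lemma cannot be applied to the image of \<theta> inside \<open>K\<close>, although
  every element of \<open>K\<close> agrees with its image under \<theta> modulo the kernel of
  \<phi>. The finitely generated module at hand is \<open>F\<close>, and the argument is moved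
  there, for one element \<open>k\<close> of \<open>K\<close> at a time. Flatness supplies a second
  endomorphism \<theta>' that fixes \<open>P\<close>, \<open>k\<close> and the whole image of
  \<theta>. The difference D = \<theta> - \<theta>' maps \<open>F\<close> into \<open>K\<close>, and
  its square vanishes modulo the kernel of \<phi>, so 1 - D inverts 1 + D up to that kernel. Mere
  surjectivity of 1 + D would not suffice: \<open>k\<close> has to be the image of an element fixed
  by \<theta>', because only there 1 + D is known to be \<theta>. For this reason the Nakayama
  argument uses polynomials in 1 + D, which preserve the set of these fixed points.\<close>

lemma linear_maps_ident: "(\<lambda>x. x) \<in> linear_maps R M M"
  by (simp add: linear_maps_def)

lemma module_diff_add:
  assumes "module R N" "a \<in> carrier N" "b \<in> carrier N" "c \<in> carrier N" "d \<in> carrier N"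
  shows "(a \<oplus>\<^bsub>N\<^esub> b) \<ominus>\<^bsub>N\<^esub> (c \<oplus>\<^bsub>N\<^esub> d) = (a \<ominus>\<^bsub>N\<^esub> c) \<oplus>\<^bsub>N\<^esub> (b \<ominus>\<^bsub>N\<^esub> d)"
proof -
  interpret N: module R N by fact
  show ?thesis using assms(2-) by (simp add: N.M.minus_eq N.M.minus_add N.M.a_ac)
qed

lemma module_smult_diff:
  assumes "module R N" "r \<in> carrier R" "a \<in> carrier N" "b \<in> carrier N"
  shows "r \<odot>\<^bsub>N\<^esub> (a \<ominus>\<^bsub>N\<^esub> b) = r \<odot>\<^bsub>N\<^esub> a \<ominus>\<^bsub>N\<^esub> r \<odot>\<^bsub>N\<^esub> b"
proof -
  interpret N: module R N by fact
  show ?thesis using assms(2-) by (simp add: N.M.minus_eq N.smult_r_distr N.smult_r_minus)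
qed

lemma module_diff_smult:
  assumes "module R N" "a \<in> carrier R" "b \<in> carrier R" "x \<in> carrier N"
  shows "(a \<ominus>\<^bsub>R\<^esub> b) \<odot>\<^bsub>N\<^esub> x = a \<odot>\<^bsub>N\<^esub> x \<ominus>\<^bsub>N\<^esub> b \<odot>\<^bsub>N\<^esub> x"
proof -
  interpret N: module R N by fact
  show ?thesis
    using assms(2-) by (simp add: N.R.minus_eq N.M.minus_eq N.smult_l_distr N.smult_l_minus)
qed

lemma linear_maps_diff:
  assumes N: "module R N" and f: "f \<in> linear_maps R M N" and g: "g \<in> linear_maps R M N"
  shows "(\<lambda>x. f x \<ominus>\<^bsub>N\<^esub> g x) \<in> linear_maps R M N"
proof -
  interpret N: module R N by fact
  note D = linear_mapsD(2-)[OF f] linear_mapsD(2-)[OF g]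
  show ?thesis
    by (auto simp: linear_maps_def D module_diff_add[OF N] module_smult_diff[OF N])
qed

lemma linear_maps_add:
  assumes N: "module R N" and f: "f \<in> linear_maps R M N" and g: "g \<in> linear_maps R M N"
  shows "(\<lambda>x. f x \<oplus>\<^bsub>N\<^esub> g x) \<in> linear_maps R M N"
proof -
  interpret N: module R N by fact
  note D = linear_mapsD(2-)[OF f] linear_mapsD(2-)[OF g]
  show ?thesis
    by (auto simp: linear_maps_def D N.M.a_ac N.smult_r_distr)
qed

lemma linear_maps_map_diff:
  assumes M: "module R M" and N: "module R N" and f: "f \<in> linear_maps R M N"
    and x: "x \<in> carrier M" "y \<in> carrier M"
  shows "f (x \<ominus>\<^bsub>M\<^esub> y) = f x \<ominus>\<^bsub>N\<^esub> f y"
proof -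
  interpret M: module R M by fact
  interpret N: module R N by fact
  note D = linear_mapsD(2-)[OF f]
  have "f (\<ominus>\<^bsub>M\<^esub> y) \<oplus>\<^bsub>N\<^esub> f y = \<zero>\<^bsub>N\<^esub>"
    using x D(2)[of "\<ominus>\<^bsub>M\<^esub> y" y] by (simp add: M.M.l_neg linear_maps_zero[OF M N f])
  from N.M.minus_equality[OF this] have "f (\<ominus>\<^bsub>M\<^esub> y) = \<ominus>\<^bsub>N\<^esub> f y"
    using x by (simp add: D)
  then show ?thesis using x by (simp add: M.M.minus_eq N.M.minus_eq D)
qed

section \<open>Coordinates and basis vectors of free modules\<close>

lemma free_module_simps:
  "\<zero>\<^bsub>free_module R I\<^esub> = (\<lambda>_. \<zero>\<^bsub>R\<^esub>)"
  "c \<oplus>\<^bsub>free_module R I\<^esub> d = (\<lambda>i. c i \<oplus>\<^bsub>R\<^esub> d i)"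
  "a \<odot>\<^bsub>free_module R I\<^esub> c = (\<lambda>i. a \<otimes>\<^bsub>R\<^esub> c i)"
  by (simp_all add: free_module_def)

lemma free_module_memD:
  assumes "c \<in> carrier (free_module R I)"
  shows "c i \<in> carrier R" "i \<notin> I \<Longrightarrow> c i = \<zero>\<^bsub>R\<^esub>" "finite {i. c i \<noteq> \<zero>\<^bsub>R\<^esub>}"
  using assms by (auto simp: free_module_def)

lemma free_module_memI:
  assumes "finite I" "\<And>i. i \<in> I \<Longrightarrow> c i \<in> carrier R" "\<And>i. i \<notin> I \<Longrightarrow> c i = \<zero>\<^bsub>R\<^esub>" "cring R"
  shows "c \<in> carrier (free_module R I)"
proof -
  interpret cring R by fact
  have "{i. c i \<noteq> \<zero>\<^bsub>R\<^esub>} \<subseteq> I" using assms(3) by blast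
  moreover have "c i \<in> carrier R" for i using assms(2,3)[of i] by (cases "i \<in> I") auto
  ultimately show ?thesis using finite_subset[OF _ assms(1)] by (auto simp: free_module_def)
qed

lemma free_module_diff:
  assumes R: "cring R" and c: "c \<in> carrier (free_module R I)" and d: "d \<in> carrier (free_module R I)"
  shows "c \<ominus>\<^bsub>free_module R I\<^esub> d = (\<lambda>i. c i \<ominus>\<^bsub>R\<^esub> d i)"
proof -
  interpret R: cring R by fact
  interpret F: module R "free_module R I" by (rule free_module_module) fact
  have "\<ominus>\<^bsub>free_module R I\<^esub> d = (\<ominus>\<^bsub>R\<^esub> \<one>\<^bsub>R\<^esub>) \<odot>\<^bsub>free_module R I\<^esub> d" using d by (simp add: F.smult_l_minus)
  also have "\<dots> = (\<lambda>i. \<ominus>\<^bsub>R\<^esub> d i)"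
    by (simp add: free_module_simps fun_eq_iff R.l_minus free_module_memD[OF d])
  finally show ?thesis by (simp add: F.M.minus_eq R.minus_eq free_module_simps)
qed

definition free_basis :: "('r, 'x) ring_scheme \<Rightarrow> 'i \<Rightarrow> 'i \<Rightarrow> 'r" where
  "free_basis R i = (\<lambda>j. if j = i then \<one>\<^bsub>R\<^esub> else \<zero>\<^bsub>R\<^esub>)"

lemma free_basis_closed:
  assumes "cring R" "i \<in> I"
  shows "free_basis R i \<in> carrier (free_module R I)"
proof -
  interpret F: module R "free_module R I" by (rule free_module_module) fact
  show ?thesis
    using free_module_lift_single(1)[where e = "\<lambda>i. \<zero>\<^bsub>free_module R I\<^esub>", OF F.module_axioms assms(2)]
    by (simp add: free_basis_def)
qed

lemma free_module_lift_basis: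
  assumes "module R N" "i \<in> I" "e i \<in> carrier N"
  shows "free_module_lift R N e (free_basis R i) = e i"
  using free_module_lift_single(2)[where e = e, OF assms] unfolding free_basis_def .

text \<open>The ring becomes a module over itself as the restriction of scalars along the identity.
  Coordinate functionals are then linear maps, and everything known about
  \<open>free_module_lift\<close> and linear maps applies to them.\<close>

lemma ring_module:
  assumes "cring R"
  shows "module R (restrict_scalars (\<lambda>r. r) R)"
  by (rule restrict_scalars_module[OF assms assms]) (simp add: ring_hom_def)

lemma free_module_eval_linear:
  "(\<lambda>c. c i) \<in> linear_maps R (free_module R I) (restrict_scalars (\<lambda>r. r) R)"
  by (auto simp: linear_maps_def free_module_simps free_module_memD(1))

lemma finsum_restrict_scalars:
  assumes N: "module R (restrict_scalars \<phi> S)" and S: "cring S" and f: "f \<in> A \<rightarrow> carrier S"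
  shows "finsum (restrict_scalars \<phi> S) f A = finsum S f A"
proof (cases "finite A")
  case True
  interpret N: module R "restrict_scalars \<phi> S" by fact
  interpret S: cring S by fact
  from True f show ?thesis
  proof (induction A rule: finite_induct)
    case (insert a A)
    then have fA: "f \<in> A \<rightarrow> carrier S" "f a \<in> carrier S" by auto
    then show ?case
      using insert N.M.finsum_insert[of A a f] S.finsum_insert[of A a f] by simp
  qed simp
next
  \<comment> \<open>For infinite \<open>A\<close> both sums are zero by convention.\<close>
  case False
  then show ?thesis by (simp add: finsum_def finprod_def)
qed

text \<open>Coordinates are compared one at a time. Evaluation at \<open>j\<close> is linear, so it
  passes through the combination and leaves a sum with at most one nonzero term.\<close>

lemma free_module_expand:
  assumes R: "cring R" and c: "c \<in> carrier (free_module R I)"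
  shows "free_module_lift R (free_module R I) (free_basis R) c = c"
proof
  fix j
  interpret R: cring R by fact
  let ?F = "free_module R I" and ?N = "restrict_scalars (\<lambda>r. r) R"
  note F = free_module_module[OF R, of I] and N = ring_module[OF R]
  have b: "free_basis R \<in> I \<rightarrow> carrier ?F" by (simp add: free_basis_closed[OF R])
  have "free_module_lift R ?F (free_basis R) c j = free_module_lift R ?N (\<lambda>i. free_basis R i j) c"
    by (rule free_module_lift_map[OF F N free_module_eval_linear b c])
  also have "\<dots> = (\<Oplus>\<^bsub>R\<^esub>i\<in>{i. c i \<noteq> \<zero>\<^bsub>R\<^esub>}. if j = i then c i else \<zero>\<^bsub>R\<^esub>)"
    unfolding free_module_lift_def
    by (subst finsum_restrict_scalars[OF N R], use c in \<open>auto simp: free_basis_def free_module_memD(1)\<close>)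
      (rule R.finsum_cong', auto simp: free_basis_def free_module_memD[OF c])
  also have "\<dots> = c j"
  proof (cases "c j = \<zero>\<^bsub>R\<^esub>")
    case True
    have "(\<Oplus>\<^bsub>R\<^esub>i\<in>{i. c i \<noteq> \<zero>\<^bsub>R\<^esub>}. if j = i then c i else \<zero>\<^bsub>R\<^esub>) = \<zero>\<^bsub>R\<^esub>"
      by (rule R.add.finprod_one_eqI) (use True in auto)
    then show ?thesis using True by simp
  next
    case False
    then show ?thesis
      by (subst R.add.finprod_singleton) (auto simp: free_module_memD[OF c])
  qed
  finally show "free_module_lift R ?F (free_basis R) c j = c j" .
qed

lemma free_module_linear_eq:
  assumes R: "cring R" and N: "module R N" and f: "f \<in> linear_maps R (free_module R I) N"
    and c: "c \<in> carrier (free_module R I)"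
  shows "f c = free_module_lift R N (\<lambda>i. f (free_basis R i)) c"
proof -
  have b: "free_basis R \<in> I \<rightarrow> carrier (free_module R I)" by (simp add: free_basis_closed[OF R])
  show ?thesis
    using free_module_lift_map[OF free_module_module[OF R] N f b c] free_module_expand[OF R c] by simp
qed

lemma free_module_linear_ext:
  assumes R: "cring R" and N: "module R N"
    and f: "f \<in> linear_maps R (free_module R I) N" and g: "g \<in> linear_maps R (free_module R I) N"
    and eq: "\<And>i. i \<in> I \<Longrightarrow> f (free_basis R i) = g (free_basis R i)"
    and c: "c \<in> carrier (free_module R I)"
  shows "f c = g c"
  unfolding free_module_linear_eq[OF R N f c] free_module_linear_eq[OF R N g c]
  by (rule free_module_lift_cong[OF N c eq]) (auto simp: linear_mapsD(2)[OF g] free_basis_closed[OF R])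

section \<open>Projectivity and relations\<close>

text \<open>Such a \<theta> is a projection of the free module onto the kernel of the presentation,
  so its existence says that the presentation splits. The criterion speaks only of endomorphisms of
  a free module, and in this form the property can be compared over \<open>R\<close> and over
  \<open>S\<close>.\<close>

lemma projective_module_iff:
  fixes R :: "('r, 'x) ring_scheme" and Y :: "('r, 'm, 'z) module_scheme" and e :: "'i \<Rightarrow> 'm"
  assumes Y: "module R Y" and e: "e \<in> I \<rightarrow> carrier Y"
    and surj: "carrier Y \<subseteq> free_module_lift R Y e ` carrier (free_module R I)"
  shows "projective_module R Y \<longleftrightarrow>
    (\<exists>\<theta> \<in> linear_maps R (free_module R I) (free_module R I). \<forall>c \<in> carrier (free_module R I).
       free_module_lift R Y e (\<theta> c) = \<zero>\<^bsub>Y\<^esub> \<and>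
       (free_module_lift R Y e c = \<zero>\<^bsub>Y\<^esub> \<longrightarrow> \<theta> c = c))" (is "?L \<longleftrightarrow> ?R")
proof -
  interpret Y: module R Y by fact
  let ?F = "free_module R I"
  let ?q = "free_module_lift R Y e"
  note R = Y.R.is_cring
  note F = free_module_module[OF R, of I]
  interpret F: module R ?F by (rule F)
  have q: "?q \<in> linear_maps R ?F Y" by (rule free_module_lift_linear[OF Y e])
  note Dq = linear_mapsD(2-)[OF q] linear_maps_map_diff[OF F Y q]
  show ?thesis
  proof
    assume ?L
    have "?q ` carrier ?F = carrier Y" using surj Dq(1) by auto
    from projective_module_lift[OF Y \<open>?L\<close> F Y q this linear_maps_ident]
    obtain h where h: "h \<in> linear_maps R Y ?F" and qh: "\<And>x. x \<in> carrier Y \<Longrightarrow> ?q (h x) = x"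
      by blast
    note Dh = linear_mapsD(2-)[OF h]
    show ?R
    proof (intro bexI ballI conjI impI)
      show "(\<lambda>c. c \<ominus>\<^bsub>?F\<^esub> h (?q c)) \<in> linear_maps R ?F ?F"
        by (rule linear_maps_diff[OF F linear_maps_ident linear_maps_compose[OF q h]])
      fix c assume c: "c \<in> carrier ?F"
      show "?q (c \<ominus>\<^bsub>?F\<^esub> h (?q c)) = \<zero>\<^bsub>Y\<^esub>"
        using c by (simp add: Dq Dh qh Y.M.minus_eq Y.M.r_neg)
      assume "?q c = \<zero>\<^bsub>Y\<^esub>"
      then show "c \<ominus>\<^bsub>?F\<^esub> h (?q c) = c"
        using c by (simp add: linear_maps_zero[OF Y F h] F.M.minus_eq)
    qed
  next
    assume ?R
    then obtain \<theta> where \<theta>: "\<theta> \<in> linear_maps R ?F ?F"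
      and q\<theta>: "\<And>c. c \<in> carrier ?F \<Longrightarrow> ?q (\<theta> c) = \<zero>\<^bsub>Y\<^esub>"
      and fix_ker: "\<And>c. c \<in> carrier ?F \<Longrightarrow> ?q c = \<zero>\<^bsub>Y\<^esub> \<Longrightarrow> \<theta> c = c"
      by blast
    \<comment> \<open>The section \<open>l\<close> is chosen elementwise and need not be linear.
      Passing to \<open>s\<close> removes the ambiguity: two preimages of the same element differ by
      an element of the kernel, on which 1 - \<theta> vanishes. Hence \<open>s\<close> can be
      computed from any preimage (\<open>s_eq\<close>), and linearity follows.\<close>
    define l where "l x = inv_into (carrier ?F) ?q x" for x
    have l: "l x \<in> carrier ?F" "?q (l x) = x" if "x \<in> carrier Y" for x
    proof -
    have "x \<in> ?q ` carrier ?F" using surj that by blast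
    then show "l x \<in> carrier ?F" "?q (l x) = x"
      unfolding l_def by (rule inv_into_into, rule f_inv_into_f)
  qed
    define s where "s x = l x \<ominus>\<^bsub>?F\<^esub> \<theta> (l x)" for x
    note D\<theta> = linear_mapsD(2-)[OF \<theta>] linear_maps_map_diff[OF F F \<theta>]
    have s_eq: "c \<ominus>\<^bsub>?F\<^esub> \<theta> c = s (?q c)" if c: "c \<in> carrier ?F" for c
    proof -
      let ?d = "c \<ominus>\<^bsub>?F\<^esub> l (?q c)"
      have d: "?d \<in> carrier ?F" "?q ?d = \<zero>\<^bsub>Y\<^esub>"
        using c by (simp_all add: l Dq Y.M.r_neg Y.M.minus_eq)
      have "c \<ominus>\<^bsub>?F\<^esub> \<theta> c = (?d \<oplus>\<^bsub>?F\<^esub> l (?q c)) \<ominus>\<^bsub>?F\<^esub> \<theta> (?d \<oplus>\<^bsub>?F\<^esub> l (?q c))"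
        using c by (simp add: F.M.minus_eq F.M.a_assoc F.M.l_neg l Dq)
      also have "\<dots> = (?d \<ominus>\<^bsub>?F\<^esub> ?d) \<oplus>\<^bsub>?F\<^esub> s (?q c)"
        using c d by (simp add: D\<theta>(2) D\<theta>(1) fix_ker[OF d] l Dq(1) module_diff_add[OF F] s_def)
      also have "\<dots> = s (?q c)"
        using c d by (simp add: s_def l Dq D\<theta> F.M.minus_eq F.M.r_neg)
      finally show ?thesis .
    qed
    have s: "s \<in> linear_maps R Y ?F"
    proof -
      have s_closed: "s x \<in> carrier ?F" if "x \<in> carrier Y" for x
        using that by (simp add: s_def l D\<theta>)
      have "s (x \<oplus>\<^bsub>Y\<^esub> y) = s x \<oplus>\<^bsub>?F\<^esub> s y" if "x \<in> carrier Y" "y \<in> carrier Y" for x y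
        using s_eq[of "l x \<oplus>\<^bsub>?F\<^esub> l y"] s_eq[of "l x"] s_eq[of "l y"] that
        by (simp add: l Dq D\<theta> module_diff_add[OF F])
      moreover have "s (a \<odot>\<^bsub>Y\<^esub> x) = a \<odot>\<^bsub>?F\<^esub> s x" if "a \<in> carrier R" "x \<in> carrier Y" for a x
        using s_eq[of "a \<odot>\<^bsub>?F\<^esub> l x"] that
        by (simp add: l Dq D\<theta> module_smult_diff[OF F] s_def[of x])
      ultimately show ?thesis using s_closed by (auto simp: linear_maps_def)
    qed
    have qs: "?q (s x) = x" if "x \<in> carrier Y" for x
      using that by (simp add: s_def Dq D\<theta> l q\<theta> Y.M.minus_eq)
    show ?L
      unfolding projective_module_def
    proof (intro allI impI, elim conjE)
      fix N :: "('r, 'm \<Rightarrow> 'r) module" and P :: "('r, 'm) module" and g f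
      assume N: "module R N" and P: "module R P" and g: "g \<in> linear_maps R N P"
        and gsurj: "g ` carrier N = carrier P" and f: "f \<in> linear_maps R Y P"
      \<comment> \<open>Preimages under \<open>g\<close> are chosen only for the images of the
        generators. They extend linearly to the free module, and composition with the splitting
        \<open>s\<close> gives the lift on \<open>Y\<close>.\<close>
      define d where "d i = inv_into (carrier N) g (f (e i))" for i
      have fe: "f (e i) \<in> carrier P" if "i \<in> I" for i
        using linear_mapsD(2)[OF f] e that by auto
      have d: "d i \<in> carrier N" "g (d i) = f (e i)" if "i \<in> I" for i
        using fe[OF that] unfolding d_def gsurj[symmetric] by (rule inv_into_into, rule f_inv_into_f)
      have dI: "d \<in> I \<rightarrow> carrier N" using d by auto
      show "\<exists>h\<in>linear_maps R Y N. \<forall>x\<in>carrier Y. g (h x) = f x"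
      proof (intro bexI ballI)
        show "(\<lambda>x. free_module_lift R N d (s x)) \<in> linear_maps R Y N"
          by (rule linear_maps_compose[OF s free_module_lift_linear[OF N dI]])
        fix x assume x: "x \<in> carrier Y"
        note sx = linear_mapsD(2)[OF s x]
        have "g (free_module_lift R N d (s x)) = free_module_lift R P (\<lambda>i. g (d i)) (s x)"
          by (rule free_module_lift_map[OF N P g dI sx])
        also have "\<dots> = free_module_lift R P (\<lambda>i. f (e i)) (s x)"
          by (rule free_module_lift_cong[OF P sx]) (use d fe in auto)
        also have "\<dots> = f (?q (s x))"
          by (rule free_module_lift_map[OF Y P f e sx, symmetric])
        finally show "g (free_module_lift R N d (s x)) = f x" by (simp add: qs x)
      qed
    qed
  qed
qed

text \<open>
  Right exactness of the tensor product: a set \<open>Q\<close> as below contains the image of the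
  tensor product of the relations among \<open>A\<close> with \<open>N\<close>.
\<close>

lemma tensor_null_generators:
  fixes R :: "('r, 'x) ring_scheme" and M :: "('r, 'm, 'z) module_scheme"
    and N :: "('r, 'n, 'w) module_scheme" and Q :: "('m \<Rightarrow> 'n) set"
  assumes M: "module R M" and N: "module R N" and A: "finite A" "A \<subseteq> carrier M"
    and surj: "carrier M \<subseteq> free_module_lift R M (\<lambda>y. y) ` carrier (free_module R A)"
    and zero: "(\<lambda>_. \<zero>\<^bsub>N\<^esub>) \<in> Q"
    and diff: "\<And>f g. f \<in> Q \<Longrightarrow> g \<in> Q \<Longrightarrow> (\<lambda>a. f a \<ominus>\<^bsub>N\<^esub> g a) \<in> Q"
    and gen: "\<And>k y. k \<in> carrier (free_module R A) \<Longrightarrow> free_module_lift R M (\<lambda>y. y) k = \<zero>\<^bsub>M\<^esub> \<Longrightarrow>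
      y \<in> carrier N \<Longrightarrow> (\<lambda>a. k a \<odot>\<^bsub>N\<^esub> y) \<in> Q"
    and f: "f \<in> A \<rightarrow> carrier N"
    and null: "(\<Sum>a\<in>A. frag_of (a, f a)) \<in> tensor_null R M N"
  shows "(\<lambda>a. if a \<in> A then f a else \<zero>\<^bsub>N\<^esub>) \<in> Q"
proof -
  interpret M: module R M by fact
  interpret N: module R N by fact
  note R = M.R.is_cring
  let ?F = "free_module R A" and ?p = "free_module_lift R M (\<lambda>y. y)"
  note F = free_module_module[OF R, of A]
  interpret F: module R ?F by (rule F)
  have "?p \<in> linear_maps R ?F M" by (rule free_module_lift_linear[OF M]) (use A in auto)
  note Dp = linear_mapsD(2-)[OF this] linear_maps_map_diff[OF F M this]
  \<comment> \<open>A section of the projection that need not be linear, normalised to be the basis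
    vector on each generator. The normalisation makes the coordinates of the given tensor come out
    as the values of \<open>f\<close>.\<close>
  define c where "c x = (if x \<in> A then free_basis R x else inv_into (carrier ?F) ?p x)" for x
  have c: "c x \<in> carrier ?F" "?p (c x) = x" if "x \<in> carrier M" for x
  proof -
    have "x \<in> ?p ` carrier ?F" using surj that by blast
    then have "inv_into (carrier ?F) ?p x \<in> carrier ?F" "?p (inv_into (carrier ?F) ?p x) = x"
      by (rule inv_into_into, rule f_inv_into_f)
    then show "c x \<in> carrier ?F" "?p (c x) = x"
      using free_basis_closed[OF R, of x A] free_module_lift_basis[of R M x A "\<lambda>y. y", OF M _ that]
      by (simp_all add: c_def)
  qed
  note cR = free_module_memD(1)[OF c(1)]
  \<comment> \<open>Taken together, the maps \<open>h a\<close> send the formal tensor of x and y to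
    the family of the c x a times y. They exist on the free Abelian group only. The failure of
    \<open>c\<close> to be linear is measured by relations among the generators, so the defining
    relations of the tensor product are sent into \<open>Q\<close>.\<close>
  have "\<exists>h. h \<in> hom (free_Abelian_group (carrier M \<times> carrier N)) (add_monoid N) \<and>
      (\<forall>x\<in>carrier M. \<forall>y\<in>carrier N. h (frag_of (x, y)) = c x a \<odot>\<^bsub>N\<^esub> y)" for a
  proof -
    have "(\<lambda>(x, y). c x a \<odot>\<^bsub>N\<^esub> y) ` (carrier M \<times> carrier N) \<subseteq> carrier (add_monoid N)"
      using cR by auto
    from comm_group.free_Abelian_group_universal[OF N.M.a_comm_group this] show ?thesis
      by (metis (no_types, lifting) SigmaI case_prod_conv)
  qed
  then obtain h where hom: "\<And>a. h a \<in> hom (free_Abelian_group (carrier M \<times> carrier N)) (add_monoid N)"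
    and h: "\<And>a x y. x \<in> carrier M \<Longrightarrow> y \<in> carrier N \<Longrightarrow> h a (frag_of (x, y)) = c x a \<odot>\<^bsub>N\<^esub> y"
    by metis
  let ?K = "\<lambda>u. Poly_Mapping.keys u \<subseteq> carrier M \<times> carrier N"
  have h_closed: "h a u \<in> carrier N" if "?K u" for a u
    using hom_carrier[OF hom, of a] that by (auto simp: subset_iff)
  have h_add: "h a (u + v) = h a u \<oplus>\<^bsub>N\<^esub> h a v" if "?K u" "?K v" for a u v
    using hom_mult[OF hom, of u v a] that by simp
  have h_diff: "h a (u - v) = h a u \<ominus>\<^bsub>N\<^esub> h a v" if "?K u" "?K v" for a u v
  proof -
    note uv = keys_diff_subset[OF that]
    have "h a u = h a (u - v) \<oplus>\<^bsub>N\<^esub> h a v" using h_add[OF uv that(2), of a] by simp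
    then show ?thesis
      using that uv by (simp add: h_closed N.M.minus_eq N.M.a_assoc N.M.r_neg)
  qed
  have h_zero: "h a 0 = \<zero>\<^bsub>N\<^esub>" for a
    using h_diff[of 0 0 a] by (simp add: h_closed N.M.minus_eq N.M.r_neg)
  have gen': "(\<lambda>a. (k a \<ominus>\<^bsub>R\<^esub> l a) \<odot>\<^bsub>N\<^esub> y) \<in> Q"
    if "k \<in> carrier ?F" "l \<in> carrier ?F" "?p k = ?p l" "y \<in> carrier N" for k l y
  proof -
    have "?p (k \<ominus>\<^bsub>?F\<^esub> l) = \<zero>\<^bsub>M\<^esub>"
      using that by (simp add: Dp M.M.minus_eq M.M.r_neg)
    from gen[OF F.M.minus_closed[OF that(1,2)] this that(4)] show ?thesis
      unfolding free_module_diff[OF R that(1,2)] .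
  qed
  have "(\<lambda>a. h a u) \<in> Q" if "u \<in> tensor_null R M N" for u
    using M N that
  proof (induction rule: tensor_null_induct)
    case zero
    then show ?case by (simp add: h_zero \<open>(\<lambda>_. \<zero>\<^bsub>N\<^esub>) \<in> Q\<close>)
  next
    case (relation u)
    then show ?case
    proof (cases rule: tensor_relations_cases)
      case (add_left x x' y)
      have "h a u = (c (x \<oplus>\<^bsub>M\<^esub> x') a \<ominus>\<^bsub>R\<^esub> (c x \<oplus>\<^bsub>?F\<^esub> c x') a) \<odot>\<^bsub>N\<^esub> y" for a
        using add_left
        by (simp add: h h_diff keys_diff_subset free_module_simps module_diff_smult[OF N] cR
            N.smult_l_distr N.M.minus_eq N.M.minus_add N.M.a_assoc)
      then show ?thesis
        using gen'[of "c (x \<oplus>\<^bsub>M\<^esub> x')" "c x \<oplus>\<^bsub>?F\<^esub> c x'" y] add_left by (simp add: c Dp)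
    next
      case (add_right x y y')
      have "h a u = \<zero>\<^bsub>N\<^esub>" for a
        using add_right
        by (simp add: h h_diff keys_diff_subset cR N.smult_r_distr N.M.minus_eq N.M.a_ac N.M.r_neg
            N.M.r_neg1)
      then show ?thesis using zero by simp
    next
      case (smult r x y)
      have "h a u = (c (r \<odot>\<^bsub>M\<^esub> x) a \<ominus>\<^bsub>R\<^esub> (r \<odot>\<^bsub>?F\<^esub> c x) a) \<odot>\<^bsub>N\<^esub> y" for a
        using smult
        by (simp add: h h_diff free_module_simps module_diff_smult[OF N] cR
            N.smult_assoc1[symmetric] M.R.m_comm)
      then show ?thesis
        using gen'[of "c (r \<odot>\<^bsub>M\<^esub> x)" "r \<odot>\<^bsub>?F\<^esub> c x" y] smult by (simp add: c Dp)
    qed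
  next
    case (diff u v)
    then show ?case
      using \<open>\<And>f g. f \<in> Q \<Longrightarrow> g \<in> Q \<Longrightarrow> (\<lambda>a. f a \<ominus>\<^bsub>N\<^esub> g a) \<in> Q\<close>[OF diff(3,4)]
      by (simp add: h_diff tensor_null_keys[OF M N])
  qed
  from this[OF null] have "(\<lambda>b. h b (\<Sum>a\<in>A. frag_of (a, f a))) \<in> Q" .
  \<comment> \<open>Membership in the carrier is proved along with the value, because additivity of
    \<open>h\<close> is available only there.\<close>
  moreover have "?K (\<Sum>a\<in>C. frag_of (a, f a)) \<and>
      h b (\<Sum>a\<in>C. frag_of (a, f a)) = (if b \<in> C then f b else \<zero>\<^bsub>N\<^esub>)" if "C \<subseteq> A" for b C
    using finite_subset[OF that A(1)] that
  proof (induction C rule: finite_induct)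
    case empty
    show ?case by (simp add: h_zero)
  next
    case (insert a C)
    have a: "a \<in> A" "a \<in> carrier M" "f a \<in> carrier N" using insert(4) A f by auto
    have fr: "?K (frag_of (a, f a))" using a by simp
    have "c a b \<odot>\<^bsub>N\<^esub> f a = (if b = a then f a else \<zero>\<^bsub>N\<^esub>)"
      using a by (simp add: c_def free_basis_def)
    moreover have "b \<in> C \<Longrightarrow> f b \<in> carrier N" using insert(4) f by auto
    ultimately show ?case
      using insert a fr by (auto simp: h_add h keys_add_subset)
  qed
  ultimately show ?thesis by simp
qed

section \<open>Endomorphisms of finitely generated modules\<close>

text \<open>Zorn's lemma for the ideals that contain \<open>I\<close> and miss \<one>. The union of
  a nonempty chain of them is again an ideal of this kind.\<close>

lemma (in cring) exists_maximalideal: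
  assumes I: "ideal I R" and "\<one> \<notin> I"
  obtains J where "maximalideal J R" "I \<subseteq> J"
proof -
  define \<A> where "\<A> = {J. ideal J R \<and> I \<subseteq> J \<and> \<one> \<notin> J}"
  have "\<exists>J\<in>\<A>. \<forall>K\<in>\<A>. J \<subseteq> K \<longrightarrow> K = J"
  proof (rule subset_Zorn_nonempty)
    show "\<A> \<noteq> {}" using assms by (auto simp: \<A>_def)
    fix C assume C: "C \<noteq> {}" "subset.chain \<A> C"
    then have "subset.chain {J. ideal J R} C"
      by (auto simp: \<A>_def subset_chain_def)
    from chain_Union_is_ideal[OF this] C show "\<Union>C \<in> \<A>"
      by (auto simp: \<A>_def subset_chain_def)
  qed
  then obtain J where J: "J \<in> \<A>" and max: "\<And>K. K \<in> \<A> \<Longrightarrow> J \<subseteq> K \<Longrightarrow> K = J" by blast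
  have "maximalideal J R"
  proof (rule maximalidealI)
    show "carrier R \<noteq> J" "ideal J R" using J by (auto simp: \<A>_def)
    fix K assume K: "ideal K R" "J \<subseteq> K" "K \<subseteq> carrier R"
    show "K = J \<or> K = carrier R"
    proof (cases "\<one> \<in> K")
      case True
      then show ?thesis using ideal.one_imp_carrier[OF K(1)] by blast
    next
      case False
      then show ?thesis using max[of K] J K by (auto simp: \<A>_def)
    qed
  qed
  then show thesis using that J by (auto simp: \<A>_def)
qed

text \<open>A non-unit \<open>r\<close> would lie in some maximal ideal. This ideal also contains 1
  - r, hence 1.\<close>

lemma jacobson_radical_one_minus_unit:
  assumes R: "cring R" and r: "r \<in> carrier R" and J: "\<one>\<^bsub>R\<^esub> \<ominus>\<^bsub>R\<^esub> r \<in> jacobson_radical R"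
  shows "r \<in> Units R"
proof (rule ccontr)
  interpret R: cring R by fact
  assume nu: "r \<notin> Units R"
  have "\<one>\<^bsub>R\<^esub> \<notin> PIdl\<^bsub>R\<^esub> r"
  proof
    assume "\<one>\<^bsub>R\<^esub> \<in> PIdl\<^bsub>R\<^esub> r"
    then obtain s where "s \<in> carrier R" "\<one>\<^bsub>R\<^esub> = s \<otimes>\<^bsub>R\<^esub> r" by (auto simp: cgenideal_def)
    then show False using nu r by (auto simp: Units_def R.m_comm)
  qed
  with R.exists_maximalideal[OF R.cgenideal_ideal[OF r]]
  obtain I where I: "maximalideal I R" "PIdl\<^bsub>R\<^esub> r \<subseteq> I" by metis
  then interpret I: maximalideal I R by simp
  have rI: "r \<in> I" using I(2) R.cgenideal_self[OF r] by blast
  have "\<one>\<^bsub>R\<^esub> \<ominus>\<^bsub>R\<^esub> r \<in> I" using J I(1) by (auto simp: jacobson_radical_def)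
  then have "(\<one>\<^bsub>R\<^esub> \<ominus>\<^bsub>R\<^esub> r) \<oplus>\<^bsub>R\<^esub> r \<in> I" using rI by (rule I.a_closed)
  then have "\<one>\<^bsub>R\<^esub> \<in> I" using r by (simp add: R.minus_eq R.a_assoc R.l_neg)
  then show False using I.one_imp_carrier I.I_notcarr by blast
qed

lemma linear_maps_smult:
  assumes "module R N" "r \<in> carrier R"
  shows "(\<lambda>x. r \<odot>\<^bsub>N\<^esub> x) \<in> linear_maps R N N"
proof -
  interpret N: module R N by fact
  show ?thesis
    using assms(2) by (auto simp: linear_maps_def N.smult_r_distr N.smult_assoc1[symmetric] N.R.m_comm)
qed

text \<open>
  A form of the determinant trick. In the set \<open>P\<close> of the proof, a pair \<open>(f, c)\<close> stands for a
  polynomial in \<open>B\<close> and its constant term; eliminating the generators one by one in Nakayama's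
  manner gives a polynomial in \<open>B\<close> that vanishes and whose constant term is invertible.
\<close>

lemma submodule_subset_image_endomorphism:
  fixes R :: "('r, 'x) ring_scheme" and Y :: "('r, 'm, 'z) module_scheme" and e :: "'i \<Rightarrow> 'm"
  assumes Y: "module R Y" and J: "ideal J R" "J \<subseteq> jacobson_radical R"
    and I: "finite I" and e: "e \<in> I \<rightarrow> carrier Y"
    and surj: "carrier Y \<subseteq> free_module_lift R Y e ` carrier (free_module R I)"
    and B: "B \<in> linear_maps R Y Y"
    and gen: "\<And>i. i \<in> I \<Longrightarrow>
      \<exists>y\<in>carrier Y. \<exists>c\<in>I \<rightarrow> J. e i = B y \<oplus>\<^bsub>Y\<^esub> (\<Oplus>\<^bsub>Y\<^esub>j\<in>I. c j \<odot>\<^bsub>Y\<^esub> e j)"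
    and W: "submodule W R Y" "B ` W \<subseteq> W"
  shows "W \<subseteq> B ` W"
proof
  fix v assume v: "v \<in> W"
  interpret Y: module R Y by fact
  interpret J: ideal J R by fact
  note R = Y.R.is_cring
  note DB = linear_mapsD(2-)[OF B]
  note WE = Y.submoduleE[OF W(1)]
  have WY: "w \<in> carrier Y" if "w \<in> W" for w using WE(1) that by blast
  have W0: "\<zero>\<^bsub>Y\<^esub> \<in> W" using subgroup.one_closed[OF submodule.axioms(1)[OF W(1)]] by simp
  have WB: "B w \<in> W" if "w \<in> W" for w using W(2) that by blast
  have B0: "B \<zero>\<^bsub>Y\<^esub> = \<zero>\<^bsub>Y\<^esub>" by (rule linear_maps_zero[OF Y Y B])
  \<comment> \<open>No formal polynomials are needed. Polynomials in \<open>B\<close> commute with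
    every endomorphism that commutes with \<open>B\<close>; this property is closed under the
    operations used and makes any two members of \<open>P\<close> commute. The last condition is
    what remains of the constant term \<open>c\<close>: on \<open>W\<close>, the rest of the
    polynomial is \<open>B\<close> applied to an element of \<open>W\<close>.\<close>
  define P where "P = {(f, c). f \<in> linear_maps R Y Y \<and> c \<in> carrier R \<and>
    (\<forall>g\<in>linear_maps R Y Y. (\<forall>x\<in>carrier Y. g (B x) = B (g x)) \<longrightarrow> (\<forall>x\<in>carrier Y. f (g x) = g (f x))) \<and>
    (\<forall>w\<in>W. \<exists>w'\<in>W. f w = c \<odot>\<^bsub>Y\<^esub> w \<oplus>\<^bsub>Y\<^esub> B w')}"
  have P_lin: "f \<in> linear_maps R Y Y" "c \<in> carrier R" if "(f, c) \<in> P" for f c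
    using that by (auto simp: P_def)
  have P_closed: "f x \<in> carrier Y" if "(f, c) \<in> P" "x \<in> carrier Y" for f c x
    using linear_mapsD(2)[OF P_lin(1)[OF that(1)] that(2)] .
  have P_comm_lin: "f (g x) = g (f x)"
    if "(f, c) \<in> P" "g \<in> linear_maps R Y Y" "\<And>x. x \<in> carrier Y \<Longrightarrow> g (B x) = B (g x)"
      "x \<in> carrier Y" for f c g x
    using that unfolding P_def by blast
  have P_B: "f (B x) = B (f x)" if "(f, c) \<in> P" "x \<in> carrier Y" for f c x
    using P_comm_lin[OF that(1) B _ that(2)] by simp
  have P_comm: "f (g x) = g (f x)" if "(f, c) \<in> P" "(g, d) \<in> P" "x \<in> carrier Y" for f c g d x
    using P_comm_lin[OF that(1) P_lin(1)[OF that(2)] P_B[OF that(2)] that(3)] .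
  have P_const: "(\<lambda>x. r \<odot>\<^bsub>Y\<^esub> x, r) \<in> P" if r: "r \<in> carrier R" for r
  proof -
    have "\<exists>w'\<in>W. r \<odot>\<^bsub>Y\<^esub> w = r \<odot>\<^bsub>Y\<^esub> w \<oplus>\<^bsub>Y\<^esub> B w'" if "w \<in> W" for w
      using W0 r WY[OF that] by (intro bexI[of _ "\<zero>\<^bsub>Y\<^esub>"]) (auto simp: B0)
    then show ?thesis
      using linear_maps_smult[OF Y r] r by (auto simp: P_def linear_mapsD(4))
  qed
  have P_B_mem: "(B, \<zero>\<^bsub>R\<^esub>) \<in> P"
  proof -
    have "\<exists>w'\<in>W. B w = \<zero>\<^bsub>R\<^esub> \<odot>\<^bsub>Y\<^esub> w \<oplus>\<^bsub>Y\<^esub> B w'" if "w \<in> W" for w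
      using that WY[OF that] DB(1) by (intro bexI[of _ w]) auto
    then show ?thesis using B by (auto simp: P_def)
  qed
  have P_comp: "(\<lambda>x. f (g x), c \<otimes>\<^bsub>R\<^esub> d) \<in> P" if f: "(f, c) \<in> P" and g: "(g, d) \<in> P" for f c g d
  proof -
    note cd = P_lin(2)[OF f] P_lin(2)[OF g]
    have "\<exists>w'\<in>W. f (g w) = (c \<otimes>\<^bsub>R\<^esub> d) \<odot>\<^bsub>Y\<^esub> w \<oplus>\<^bsub>Y\<^esub> B w'" if w: "w \<in> W" for w
    proof -
      obtain w1 where w1: "w1 \<in> W" "g w = d \<odot>\<^bsub>Y\<^esub> w \<oplus>\<^bsub>Y\<^esub> B w1"
        using g w unfolding P_def by blast
      then have gw: "g w \<in> W" using w cd WE by (simp add: WB)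
      obtain w2 where w2: "w2 \<in> W" "f (g w) = c \<odot>\<^bsub>Y\<^esub> g w \<oplus>\<^bsub>Y\<^esub> B w2"
        using f gw unfolding P_def by blast
      have "f (g w) = (c \<otimes>\<^bsub>R\<^esub> d) \<odot>\<^bsub>Y\<^esub> w \<oplus>\<^bsub>Y\<^esub> B (c \<odot>\<^bsub>Y\<^esub> w1 \<oplus>\<^bsub>Y\<^esub> w2)"
        using w w1 w2 cd by (simp add: WY DB Y.smult_r_distr Y.smult_assoc1 Y.M.a_assoc)
      moreover have "c \<odot>\<^bsub>Y\<^esub> w1 \<oplus>\<^bsub>Y\<^esub> w2 \<in> W" using w1 w2 cd WE by simp
      ultimately show ?thesis by blast
    qed
    moreover have "f (g (h x)) = h (f (g x))"
      if "h \<in> linear_maps R Y Y" "\<And>x. x \<in> carrier Y \<Longrightarrow> h (B x) = B (h x)" "x \<in> carrier Y" for h x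
      using P_comm_lin[OF f that(1,2) P_closed[OF g that(3)]] P_comm_lin[OF g that] by simp
    ultimately show ?thesis
      using linear_maps_compose[OF P_lin(1)[OF g] P_lin(1)[OF f]] cd unfolding P_def by auto
  qed
  have P_add: "(\<lambda>x. f x \<oplus>\<^bsub>Y\<^esub> g x, c \<oplus>\<^bsub>R\<^esub> d) \<in> P" if f: "(f, c) \<in> P" and g: "(g, d) \<in> P" for f c g d
  proof -
    note cd = P_lin(2)[OF f] P_lin(2)[OF g]
    have "\<exists>w'\<in>W. f w \<oplus>\<^bsub>Y\<^esub> g w = (c \<oplus>\<^bsub>R\<^esub> d) \<odot>\<^bsub>Y\<^esub> w \<oplus>\<^bsub>Y\<^esub> B w'" if w: "w \<in> W" for w
    proof -
      obtain w1 where w1: "w1 \<in> W" "g w = d \<odot>\<^bsub>Y\<^esub> w \<oplus>\<^bsub>Y\<^esub> B w1"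
        using g w unfolding P_def by blast
      obtain w2 where w2: "w2 \<in> W" "f w = c \<odot>\<^bsub>Y\<^esub> w \<oplus>\<^bsub>Y\<^esub> B w2"
        using f w unfolding P_def by blast
      have "f w \<oplus>\<^bsub>Y\<^esub> g w = (c \<oplus>\<^bsub>R\<^esub> d) \<odot>\<^bsub>Y\<^esub> w \<oplus>\<^bsub>Y\<^esub> B (w2 \<oplus>\<^bsub>Y\<^esub> w1)"
        using w w1 w2 cd by (simp add: WY DB Y.smult_l_distr Y.M.a_ac)
      moreover have "w2 \<oplus>\<^bsub>Y\<^esub> w1 \<in> W" using w1 w2 WE by simp
      ultimately show ?thesis by blast
    qed
    moreover have "f (h x) \<oplus>\<^bsub>Y\<^esub> g (h x) = h (f x \<oplus>\<^bsub>Y\<^esub> g x)"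
      if "h \<in> linear_maps R Y Y" "\<And>x. x \<in> carrier Y \<Longrightarrow> h (B x) = B (h x)" "x \<in> carrier Y" for h x
      using P_comm_lin[OF f that] P_comm_lin[OF g that] that(3)
      by (simp add: linear_mapsD(3)[OF that(1)] P_closed[OF f] P_closed[OF g])
    ultimately show ?thesis
      using linear_maps_add[OF Y P_lin(1)[OF f] P_lin(1)[OF g]] cd unfolding P_def by auto
  qed
  \<comment> \<open>Constant terms in \<open>J\<close> belong to the coefficients of the linear
    system below. Constant terms congruent to 1 modulo \<open>J\<close> belong to its pivots, and
    they are units since \<open>J\<close> lies in the Jacobson radical.\<close>
  define PJ where "PJ = {f. \<exists>c\<in>J. (f, c) \<in> P}"
  define P1 where "P1 = {f. \<exists>c. \<one>\<^bsub>R\<^esub> \<ominus>\<^bsub>R\<^esub> c \<in> J \<and> (f, c) \<in> P}"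
  have PJ_closed: "q x \<in> carrier Y" if "q \<in> PJ" "x \<in> carrier Y" for q x
    using that P_closed by (auto simp: PJ_def)
  have PJ_comp: "(\<lambda>x. f (q x)) \<in> PJ" if "(f, c) \<in> P" "q \<in> PJ" for f c q
  proof -
    obtain d where d: "d \<in> J" "(q, d) \<in> P" using \<open>q \<in> PJ\<close> by (auto simp: PJ_def)
    show ?thesis
      using P_comp[OF that(1) d(2)] J.I_l_closed[OF d(1) P_lin(2)[OF that(1)]] by (auto simp: PJ_def)
  qed
  have PJ_add: "(\<lambda>x. p x \<oplus>\<^bsub>Y\<^esub> q x) \<in> PJ" if "p \<in> PJ" "q \<in> PJ" for p q
    using that P_add J.a_closed by (fastforce simp: PJ_def)
  have P1_diff: "(\<lambda>x. p x \<oplus>\<^bsub>Y\<^esub> (\<ominus>\<^bsub>R\<^esub> \<one>\<^bsub>R\<^esub>) \<odot>\<^bsub>Y\<^esub> q x) \<in> P1" if "p \<in> P1" "q \<in> PJ" for p q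
  proof -
    obtain c d where c: "\<one>\<^bsub>R\<^esub> \<ominus>\<^bsub>R\<^esub> c \<in> J" "(p, c) \<in> P" and d: "d \<in> J" "(q, d) \<in> P"
      using \<open>p \<in> P1\<close> \<open>q \<in> PJ\<close> by (auto simp: PJ_def P1_def)
    note cd = P_lin(2)[OF c(2)] P_lin(2)[OF d(2)]
    have "(\<lambda>x. p x \<oplus>\<^bsub>Y\<^esub> (\<ominus>\<^bsub>R\<^esub> \<one>\<^bsub>R\<^esub>) \<odot>\<^bsub>Y\<^esub> q x, c \<oplus>\<^bsub>R\<^esub> (\<ominus>\<^bsub>R\<^esub> \<one>\<^bsub>R\<^esub>) \<otimes>\<^bsub>R\<^esub> d) \<in> P"
      by (intro P_add c P_comp[OF P_const d(2)]) simp
    moreover have "\<one>\<^bsub>R\<^esub> \<ominus>\<^bsub>R\<^esub> (c \<oplus>\<^bsub>R\<^esub> (\<ominus>\<^bsub>R\<^esub> \<one>\<^bsub>R\<^esub>) \<otimes>\<^bsub>R\<^esub> d) = (\<one>\<^bsub>R\<^esub> \<ominus>\<^bsub>R\<^esub> c) \<oplus>\<^bsub>R\<^esub> d"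
      using cd by (simp add: Y.R.minus_eq Y.R.l_minus Y.R.minus_add Y.R.a_assoc)
    ultimately show ?thesis
      unfolding P1_def using J.a_closed[OF c(1) d(1)] by (intro CollectI exI conjI) simp_all
  qed
  have P1_comp: "(\<lambda>x. p (q x)) \<in> P1" if "p \<in> P1" "q \<in> P1" for p q
  proof -
    obtain c d where c: "\<one>\<^bsub>R\<^esub> \<ominus>\<^bsub>R\<^esub> c \<in> J" "(p, c) \<in> P" and d: "\<one>\<^bsub>R\<^esub> \<ominus>\<^bsub>R\<^esub> d \<in> J" "(q, d) \<in> P"
      using \<open>p \<in> P1\<close> \<open>q \<in> P1\<close> by (auto simp: P1_def)
    note cd = P_lin(2)[OF c(2)] P_lin(2)[OF d(2)]
    have "\<one>\<^bsub>R\<^esub> \<ominus>\<^bsub>R\<^esub> c \<otimes>\<^bsub>R\<^esub> d = (\<one>\<^bsub>R\<^esub> \<ominus>\<^bsub>R\<^esub> c) \<oplus>\<^bsub>R\<^esub> c \<otimes>\<^bsub>R\<^esub> (\<one>\<^bsub>R\<^esub> \<ominus>\<^bsub>R\<^esub> d)"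
      using cd by (simp add: Y.R.minus_eq Y.R.r_distr Y.R.r_minus Y.R.a_assoc Y.R.r_neg1)
    then show ?thesis
      unfolding P1_def using P_comp[OF c(2) d(2)] J.a_closed[OF c(1) J.I_l_closed[OF d(1) cd(1)]]
      by (intro CollectI exI conjI) simp_all
  qed
  \<comment> \<open>Combinations of the generators in \<open>A\<close> whose coefficients are
    operators in \<open>PJ\<close>. The elimination shrinks \<open>A\<close> to the empty set, for
    which \<open>T A\<close> contains only zero.\<close>
  define T where "T A = {y. \<exists>q\<in>A \<rightarrow> PJ. y = (\<Oplus>\<^bsub>Y\<^esub>a\<in>A. q a (e a))}" for A
  have TI: "(\<Oplus>\<^bsub>Y\<^esub>a\<in>A. q a (e a)) \<in> T A" if "q \<in> A \<rightarrow> PJ" for q A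
    unfolding T_def by (rule CollectI, rule bexI[OF refl that])
  have TE: "\<exists>q. q \<in> A \<rightarrow> PJ \<and> y = (\<Oplus>\<^bsub>Y\<^esub>a\<in>A. q a (e a))" if "y \<in> T A" for y A
    using that unfolding T_def by blast
  have qe: "(\<lambda>a. q a (e a)) \<in> A \<rightarrow> carrier Y" if "q \<in> A \<rightarrow> PJ" "A \<subseteq> I" for q A
  proof
    fix a assume a: "a \<in> A"
    then have "a \<in> I" using that(2) by (rule rev_subsetD)
    show "q a (e a) \<in> carrier Y"
      by (rule PJ_closed[OF funcset_mem[OF that(1) a] funcset_mem[OF e \<open>a \<in> I\<close>]])
  qed
  have T_add: "y \<oplus>\<^bsub>Y\<^esub> z \<in> T A" if A: "A \<subseteq> I" and "y \<in> T A" "z \<in> T A" for A y z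
  proof -
    obtain p q where p: "p \<in> A \<rightarrow> PJ" "y = (\<Oplus>\<^bsub>Y\<^esub>a\<in>A. p a (e a))"
      and q: "q \<in> A \<rightarrow> PJ" "z = (\<Oplus>\<^bsub>Y\<^esub>a\<in>A. q a (e a))" using TE[OF \<open>y \<in> T A\<close>] TE[OF \<open>z \<in> T A\<close>] by metis
    have "y \<oplus>\<^bsub>Y\<^esub> z = (\<Oplus>\<^bsub>Y\<^esub>a\<in>A. p a (e a) \<oplus>\<^bsub>Y\<^esub> q a (e a))"
      using Y.M.finsum_addf[OF qe[OF p(1) A] qe[OF q(1) A]] p(2) q(2) by simp
    moreover have "(\<lambda>a x. p a x \<oplus>\<^bsub>Y\<^esub> q a x) \<in> A \<rightarrow> PJ"
      using p(1) q(1) by (auto intro!: PJ_add)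
    ultimately show ?thesis using TI[of "\<lambda>a x. p a x \<oplus>\<^bsub>Y\<^esub> q a x" A] by simp
  qed
  have T_op: "f y \<in> T A" if A: "A \<subseteq> I" and f: "(f, c) \<in> P" and "y \<in> T A" for A f c y
  proof -
    obtain p where p: "p \<in> A \<rightarrow> PJ" "y = (\<Oplus>\<^bsub>Y\<^esub>a\<in>A. p a (e a))" using TE[OF \<open>y \<in> T A\<close>] by metis
    have "f y = (\<Oplus>\<^bsub>Y\<^esub>a\<in>A. f (p a (e a)))"
      unfolding p(2)
      by (rule linear_maps_finsum[OF Y Y P_lin(1)[OF f] finite_subset[OF A I] qe[OF p(1) A]])
    moreover have "(\<lambda>a x. f (p a x)) \<in> A \<rightarrow> PJ" using p(1) by (auto intro!: PJ_comp[OF f])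
    ultimately show ?thesis using TI[of "\<lambda>a x. f (p a x)" A] by simp
  qed
  have T_insert: "\<exists>q\<in>PJ. \<exists>t\<in>T A. y = q (e a) \<oplus>\<^bsub>Y\<^esub> t"
    if A: "insert a A \<subseteq> I" "a \<notin> A" and y: "y \<in> T (insert a A)" for A a y
  proof -
    obtain p where p: "p \<in> insert a A \<rightarrow> PJ" "y = (\<Oplus>\<^bsub>Y\<^esub>a\<in>insert a A. p a (e a))"
      using TE[OF y] by metis
    have "y = p a (e a) \<oplus>\<^bsub>Y\<^esub> (\<Oplus>\<^bsub>Y\<^esub>a\<in>A. p a (e a))"
      unfolding p(2) using qe[OF p(1) A(1)] finite_subset[OF A(1) I] A(2)
      by (subst Y.M.finsum_insert) auto
    moreover have "p a \<in> PJ" "(\<Oplus>\<^bsub>Y\<^esub>a\<in>A. p a (e a)) \<in> T A"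
      using p(1) by (auto intro: TI)
    ultimately show ?thesis by blast
  qed
  have elim: "\<exists>p\<in>P1. \<forall>i\<in>I. p (e i) = \<zero>\<^bsub>Y\<^esub>"
    if "finite A" "A \<subseteq> I" "\<exists>p\<in>P1. \<forall>i\<in>I. p (e i) \<in> T A" for A
    using that
  proof (induction A rule: finite_induct)
    case empty
    then show ?case by (simp add: T_def)
  next
    case (insert a A)
    have aI: "a \<in> I" and A: "A \<subseteq> I" using insert by auto
    obtain p where p: "p \<in> P1" and pT: "\<And>i. i \<in> I \<Longrightarrow> p (e i) \<in> T (insert a A)"
      using insert.prems by blast
    define q where "q i = (SOME q. q \<in> PJ \<and> (\<exists>t\<in>T A. p (e i) = q (e a) \<oplus>\<^bsub>Y\<^esub> t))" for i
    define t where "t i = (SOME t. t \<in> T A \<and> p (e i) = q i (e a) \<oplus>\<^bsub>Y\<^esub> t)" for i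
    have q': "q i \<in> PJ \<and> (\<exists>t\<in>T A. p (e i) = q i (e a) \<oplus>\<^bsub>Y\<^esub> t)" if i: "i \<in> I" for i
      unfolding q_def
      by (rule someI_ex[OF T_insert[OF insert.prems(1) insert.hyps(2) pT[OF i], unfolded Bex_def[of PJ]]])
    have t': "t i \<in> T A \<and> p (e i) = q i (e a) \<oplus>\<^bsub>Y\<^esub> t i" if i: "i \<in> I" for i
      unfolding t_def by (rule someI_ex[OF conjunct2[OF q'[OF i], unfolded Bex_def]])
    note q = conjunct1[OF q'] and t = conjunct1[OF t'] and pq = conjunct2[OF t']
    \<comment> \<open>The coefficient of the generator \<open>e a\<close> is subtracted from the
      equation for \<open>e a\<close> itself, so \<open>p'\<close> sends \<open>e a\<close> to
      \<open>t a\<close>, which involves only the remaining generators. Applying \<open>p'\<close>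
      to the other equations turns the term \<open>q i (e a)\<close> into \<open>q i (t a)\<close>,
      because \<open>p'\<close> and \<open>q i\<close> commute.\<close>
    define p' where "p' = (\<lambda>x. p x \<oplus>\<^bsub>Y\<^esub> (\<ominus>\<^bsub>R\<^esub> \<one>\<^bsub>R\<^esub>) \<odot>\<^bsub>Y\<^esub> q a x)"
    have p': "p' \<in> P1" unfolding p'_def by (rule P1_diff[OF p q[OF aI]])
    then obtain c' where c': "(p', c') \<in> P" by (auto simp: P1_def)
    have ei: "e i \<in> carrier Y" if "i \<in> I" for i using e that by auto
    have tY: "t i \<in> carrier Y" if i: "i \<in> I" for i
    proof -
      obtain p where "p \<in> A \<rightarrow> PJ" "t i = (\<Oplus>\<^bsub>Y\<^esub>a\<in>A. p a (e a))" using TE[OF t[OF i]] by metis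
      then show ?thesis using Y.M.finsum_closed[OF qe[OF _ A]] by simp
    qed
    have qY: "q i x \<in> carrier Y" if "i \<in> I" "x \<in> carrier Y" for i x
      using PJ_closed[OF q[OF that(1)] that(2)] .
    have p'a: "p' (e a) = t a"
    proof -
      have "p' (e a) = (t a \<oplus>\<^bsub>Y\<^esub> q a (e a)) \<oplus>\<^bsub>Y\<^esub> \<ominus>\<^bsub>Y\<^esub> q a (e a)"
        unfolding p'_def pq[OF aI]
        using aI by (simp add: qY ei tY Y.smult_l_minus Y.M.a_comm[of "q a (e a)"])
      then show ?thesis using aI by (simp add: qY ei tY Y.M.a_assoc Y.M.r_neg)
    qed
    have p'p: "p' (p (e i)) \<in> T A" if i: "i \<in> I" for i
    proof -
      obtain d where d: "(q i, d) \<in> P" using q[OF i] by (auto simp: PJ_def)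
      have "p' (p (e i)) = q i (t a) \<oplus>\<^bsub>Y\<^esub> p' (t i)"
        using pq[OF i] linear_mapsD(3)[OF P_lin(1)[OF c'], of "q i (e a)" "t i"]
          P_comm[OF c' d ei[OF aI]] by (simp add: qY ei tY i aI p'a)
      then show ?thesis
        using T_add[OF A T_op[OF A d t[OF aI]] T_op[OF A c' t[OF i]]] by simp
    qed
    have "\<exists>p\<in>P1. \<forall>i\<in>I. p (e i) \<in> T A"
      by (rule bexI[OF _ P1_comp[OF p' p]]) (simp add: p'p)
    then show ?case by (rule insert.IH[OF A])
  qed
  \<comment> \<open>Expanding \<open>y\<close> in the generators turns the assumption
    \<open>gen\<close> into a linear system for the \<open>e j\<close> with coefficients B d j + c
    j. Their constant terms are the \<open>c j\<close>, which lie in \<open>J\<close>, so the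
    elimination starts with the identity as pivot.\<close>
  have start: "e i \<in> T I" if i: "i \<in> I" for i
  proof -
    obtain y c where y: "y \<in> carrier Y" and c: "c \<in> I \<rightarrow> J"
      and eq: "e i = B y \<oplus>\<^bsub>Y\<^esub> (\<Oplus>\<^bsub>Y\<^esub>j\<in>I. c j \<odot>\<^bsub>Y\<^esub> e j)" using gen[OF i] by blast
    obtain d where d: "d \<in> carrier (free_module R I)" "y = free_module_lift R Y e d"
      using surj y by blast
    have dR: "d j \<in> carrier R" for j by (rule free_module_memD(1)[OF d(1)])
    have cR: "c j \<in> carrier R" if "j \<in> I" for j using c that J.a_subset by auto
    have eY: "e j \<in> carrier Y" if "j \<in> I" for j using e that by auto
    have "y = (\<Oplus>\<^bsub>Y\<^esub>j\<in>I. d j \<odot>\<^bsub>Y\<^esub> e j)"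
      unfolding d(2) using free_module_memD(2)[OF d(1)]
      by (subst free_module_lift_eq[OF Y e _ I]) (auto simp: dR)
    then have "B y = (\<Oplus>\<^bsub>Y\<^esub>j\<in>I. B (d j \<odot>\<^bsub>Y\<^esub> e j))"
      by (simp add: linear_maps_finsum[OF Y Y B I] dR eY Pi_iff)
    then have "e i = (\<Oplus>\<^bsub>Y\<^esub>j\<in>I. B (d j \<odot>\<^bsub>Y\<^esub> e j) \<oplus>\<^bsub>Y\<^esub> c j \<odot>\<^bsub>Y\<^esub> e j)"
      unfolding eq by (subst Y.M.finsum_addf) (auto simp: dR cR eY DB)
    moreover have "(\<lambda>j x. B (d j \<odot>\<^bsub>Y\<^esub> x) \<oplus>\<^bsub>Y\<^esub> c j \<odot>\<^bsub>Y\<^esub> x) \<in> I \<rightarrow> PJ"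
    proof
      fix j assume j: "j \<in> I"
      have "(\<lambda>x. B (d j \<odot>\<^bsub>Y\<^esub> x) \<oplus>\<^bsub>Y\<^esub> c j \<odot>\<^bsub>Y\<^esub> x, \<zero>\<^bsub>R\<^esub> \<otimes>\<^bsub>R\<^esub> d j \<oplus>\<^bsub>R\<^esub> c j) \<in> P"
        by (intro P_add P_comp[OF P_B_mem P_const] P_const dR cR j)
      then show "(\<lambda>x. B (d j \<odot>\<^bsub>Y\<^esub> x) \<oplus>\<^bsub>Y\<^esub> c j \<odot>\<^bsub>Y\<^esub> x) \<in> PJ"
        using c j dR cR unfolding PJ_def by auto
    qed
    ultimately show ?thesis
      using TI[of "\<lambda>j x. B (d j \<odot>\<^bsub>Y\<^esub> x) \<oplus>\<^bsub>Y\<^esub> c j \<odot>\<^bsub>Y\<^esub> x" I] by simp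
  qed
  have "(\<lambda>x. \<one>\<^bsub>R\<^esub> \<odot>\<^bsub>Y\<^esub> x) \<in> P1"
    unfolding P1_def
    by (intro CollectI exI conjI, rule_tac [2] P_const) (simp_all add: Y.R.minus_eq Y.R.r_neg)
  moreover have "\<one>\<^bsub>R\<^esub> \<odot>\<^bsub>Y\<^esub> e i \<in> T I" if "i \<in> I" for i
    using start[OF that] funcset_mem[OF e that] by simp
  ultimately obtain p where p: "p \<in> P1" "\<And>i. i \<in> I \<Longrightarrow> p (e i) = \<zero>\<^bsub>Y\<^esub>"
    using elim[OF I] by blast
  then obtain c where c: "\<one>\<^bsub>R\<^esub> \<ominus>\<^bsub>R\<^esub> c \<in> J" "(p, c) \<in> P" by (auto simp: P1_def)
  have cU: "c \<in> Units R"
    using jacobson_radical_one_minus_unit[OF R P_lin(2)[OF c(2)]] c(1) J(2) by blast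
  obtain d where d: "d \<in> carrier (free_module R I)" "v = free_module_lift R Y e d"
    using surj WY[OF v] by blast
  have "p v = free_module_lift R Y (\<lambda>i. p (e i)) d"
    unfolding d(2) by (rule free_module_lift_map[OF Y Y P_lin(1)[OF c(2)] e d(1)])
  also have "\<dots> = free_module_lift R Y (\<lambda>i. \<zero>\<^bsub>Y\<^esub>) d"
    by (rule free_module_lift_cong[OF Y d(1)]) (auto simp: p)
  also have "\<dots> = \<zero>\<^bsub>Y\<^esub>"
    using free_module_memD(1)[OF d(1)] unfolding free_module_lift_def by simp
  finally have "p v = \<zero>\<^bsub>Y\<^esub>" .
  \<comment> \<open>At \<open>v\<close> the vanishing operator reads c v + B w = 0 with a unit
    \<open>c\<close>. Dividing by \<open>c\<close> exhibits \<open>v\<close> as the value of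
    \<open>B\<close> at a multiple of \<open>w\<close>, which stays in \<open>W\<close>.\<close>
  moreover obtain w where w: "w \<in> W" "p v = c \<odot>\<^bsub>Y\<^esub> v \<oplus>\<^bsub>Y\<^esub> B w"
    using c(2) v unfolding P_def by blast
  ultimately have "c \<odot>\<^bsub>Y\<^esub> v = \<ominus>\<^bsub>Y\<^esub> B w"
    using Y.M.minus_equality[of "c \<odot>\<^bsub>Y\<^esub> v" "B w"] v WY DB(1) P_lin(2)[OF c(2)] by simp
  also have "\<dots> = (\<ominus>\<^bsub>R\<^esub> \<one>\<^bsub>R\<^esub>) \<odot>\<^bsub>Y\<^esub> B w"
    using w WY DB(1) by (simp add: Y.smult_l_minus)
  finally have cv: "c \<odot>\<^bsub>Y\<^esub> v = (\<ominus>\<^bsub>R\<^esub> \<one>\<^bsub>R\<^esub>) \<odot>\<^bsub>Y\<^esub> B w" .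
  let ?r = "inv\<^bsub>R\<^esub> c"
  have r: "?r \<in> carrier R" "?r \<otimes>\<^bsub>R\<^esub> c = \<one>\<^bsub>R\<^esub>" using cU by auto
  have "v = ?r \<odot>\<^bsub>Y\<^esub> (c \<odot>\<^bsub>Y\<^esub> v)"
    using r v WY P_lin(2)[OF c(2)] by (simp add: Y.smult_assoc1[symmetric])
  also have "\<dots> = B (?r \<odot>\<^bsub>Y\<^esub> ((\<ominus>\<^bsub>R\<^esub> \<one>\<^bsub>R\<^esub>) \<odot>\<^bsub>Y\<^esub> w))"
    unfolding cv using r w WY by (simp add: DB)
  finally have "v = B (?r \<odot>\<^bsub>Y\<^esub> ((\<ominus>\<^bsub>R\<^esub> \<one>\<^bsub>R\<^esub>) \<odot>\<^bsub>Y\<^esub> w))" .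
  moreover have "?r \<odot>\<^bsub>Y\<^esub> ((\<ominus>\<^bsub>R\<^esub> \<one>\<^bsub>R\<^esub>) \<odot>\<^bsub>Y\<^esub> w) \<in> W"
    using r w WE(4) by simp
  ultimately show "v \<in> B ` W" by (rule image_eqI)
qed

section \<open>Flatness and relations\<close>

lemma submodule_image:
  assumes M: "module R M" and N: "module R N" and f: "f \<in> linear_maps R M N"
  shows "submodule (f ` carrier M) R N"
proof -
  interpret M: module R M by fact
  interpret N: module R N by fact
  note D = linear_mapsD(2-)[OF f]
  show ?thesis
  proof (rule N.submoduleI)
    show "f ` carrier M \<subseteq> carrier N" using D(1) by blast
    show "\<zero>\<^bsub>N\<^esub> \<in> f ` carrier M"
      using linear_maps_zero[OF M N f] by (metis M.M.zero_closed imageI)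
    show "x \<oplus>\<^bsub>N\<^esub> y \<in> f ` carrier M" if "x \<in> f ` carrier M" "y \<in> f ` carrier M" for x y
    proof -
      obtain u v where "u \<in> carrier M" "x = f u" "v \<in> carrier M" "y = f v" using \<open>x \<in> _\<close> \<open>y \<in> _\<close> by blast
      then show ?thesis using imageI[OF M.M.a_closed[of u v], of f] D(2)[of u v] by simp
    qed
    show sm: "r \<odot>\<^bsub>N\<^esub> x \<in> f ` carrier M" if "r \<in> carrier R" "x \<in> f ` carrier M" for r x
    proof -
      obtain u where "u \<in> carrier M" "x = f u" using \<open>x \<in> _\<close> by blast
      then show ?thesis using imageI[OF M.smult_closed[of r u], of f] D(3)[of r u] that(1) by simp
    qed
    show "\<ominus>\<^bsub>N\<^esub> x \<in> f ` carrier M" if "x \<in> f ` carrier M" for x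
    proof -
      have "x \<in> carrier N" using that D(1) by blast
      then show ?thesis using sm[OF _ that, of "\<ominus>\<^bsub>R\<^esub> \<one>\<^bsub>R\<^esub>"] by (simp add: N.smult_l_minus)
    qed
  qed
qed

lemma linear_maps_const_zero:
  assumes "module R N"
  shows "(\<lambda>_. \<zero>\<^bsub>N\<^esub>) \<in> linear_maps R M N"
proof -
  interpret N: module R N by fact
  show ?thesis by (simp add: linear_maps_def)
qed

lemma restrict_scalars_diff: "x \<ominus>\<^bsub>restrict_scalars \<phi> S\<^esub> y = x \<ominus>\<^bsub>S\<^esub> y"
  by (simp add: a_minus_def a_inv_def m_inv_def)

section \<open>Moving scalars across the tensor product\<close>

lemma tensor_null_collect:
  assumes M: "module R M" and N: "module R N" and C: "finite C" "C \<subseteq> carrier M"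
    and c: "c \<in> C \<rightarrow> carrier R" and y: "y \<in> carrier N"
  shows "(\<Sum>a\<in>C. frag_of (a, c a \<odot>\<^bsub>N\<^esub> y)) - frag_of (\<Oplus>\<^bsub>M\<^esub>a\<in>C. c a \<odot>\<^bsub>M\<^esub> a, y) \<in> tensor_null R M N"
  using C c
proof (induction C rule: finite_induct)
  case empty
  interpret M: module R M by fact
  \<comment> \<open>The additivity relation for zero plus zero collapses to minus the tensor of zero
    and \<open>y\<close>.\<close>
  have "frag_of (\<zero>\<^bsub>M\<^esub> \<oplus>\<^bsub>M\<^esub> \<zero>\<^bsub>M\<^esub>, y) - frag_of (\<zero>\<^bsub>M\<^esub>, y) - frag_of (\<zero>\<^bsub>M\<^esub>, y) \<in> tensor_null R M N"
    using y by (intro tensor_null_incl) (unfold tensor_relations_def, blast intro: M.M.zero_closed)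
  then show ?case by simp
next
  case (insert a C)
  interpret M: module R M by fact
  let ?s = "\<Oplus>\<^bsub>M\<^esub>a\<in>C. c a \<odot>\<^bsub>M\<^esub> a"
  have a: "a \<in> carrier M" "c a \<in> carrier R" and C: "C \<subseteq> carrier M" "c \<in> C \<rightarrow> carrier R"
    using insert.prems by auto
  have cC: "(\<lambda>a. c a \<odot>\<^bsub>M\<^esub> a) \<in> C \<rightarrow> carrier M" using C by (auto simp: Pi_iff subset_iff)
  have s: "?s \<in> carrier M" using cC by (rule M.M.finsum_closed)
  have sum: "(\<Oplus>\<^bsub>M\<^esub>a\<in>insert a C. c a \<odot>\<^bsub>M\<^esub> a) = c a \<odot>\<^bsub>M\<^esub> a \<oplus>\<^bsub>M\<^esub> ?s"
    using insert.hyps cC a by (simp add: M.M.finsum_insert)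
  have 1: "frag_of (c a \<odot>\<^bsub>M\<^esub> a \<oplus>\<^bsub>M\<^esub> ?s, y) - frag_of (c a \<odot>\<^bsub>M\<^esub> a, y) - frag_of (?s, y) \<in> tensor_null R M N"
    using a s y M.smult_closed[OF a(2,1)] by (intro tensor_null_incl) (unfold tensor_relations_def, blast)
  have 2: "frag_of (c a \<odot>\<^bsub>M\<^esub> a, y) - frag_of (a, c a \<odot>\<^bsub>N\<^esub> y) \<in> tensor_null R M N"
    using a y by (intro tensor_null_incl) (unfold tensor_relations_def, blast)
  have "(\<Sum>a\<in>C. frag_of (a, c a \<odot>\<^bsub>N\<^esub> y)) - frag_of (?s, y)
      - (frag_of (c a \<odot>\<^bsub>M\<^esub> a \<oplus>\<^bsub>M\<^esub> ?s, y) - frag_of (c a \<odot>\<^bsub>M\<^esub> a, y) - frag_of (?s, y))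
      - (frag_of (c a \<odot>\<^bsub>M\<^esub> a, y) - frag_of (a, c a \<odot>\<^bsub>N\<^esub> y)) \<in> tensor_null R M N"
    by (intro tensor_null_diff[OF M N] insert.IH[OF C] 1 2)
  then show ?case
    using insert.hyps by (simp add: sum algebra_simps)
qed

lemma tensor_null_lift:
  assumes M: "module R M" and N: "module R N" and A: "finite A" "A \<subseteq> carrier M"
    and c: "c \<in> carrier (free_module R A)" and y: "y \<in> carrier N"
  shows "(\<Sum>a\<in>A. frag_of (a, c a \<odot>\<^bsub>N\<^esub> y)) - frag_of (free_module_lift R M (\<lambda>a. a) c, y)
    \<in> tensor_null R M N"
proof -
  have "free_module_lift R M (\<lambda>a. a) c = (\<Oplus>\<^bsub>M\<^esub>a\<in>A. c a \<odot>\<^bsub>M\<^esub> a)"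
    by (rule free_module_lift_eq[OF M, where I = A])
      (use A c free_module_memD(2)[OF c] in \<open>auto simp: free_module_memD(1)\<close>)
  then show ?thesis
    using tensor_null_collect[OF M N A _ y, of c] free_module_memD(1)[OF c] by simp
qed

lemma tensor_null_zero_left:
  assumes "module R M" "module R N" "y \<in> carrier N"
  shows "frag_of (\<zero>\<^bsub>M\<^esub>, y) \<in> tensor_null R M N"
proof -
  interpret M: module R M by fact
  have "- frag_of (\<zero>\<^bsub>M\<^esub>, y) \<in> tensor_null R M N"
    using tensor_null_collect[OF assms(1,2) _ _ _ assms(3), of "{}"] by simp
  from tensor_null_minus[OF assms(1,2) this] show ?thesis by simp
qed

text \<open>This is the equational criterion for flatness, stated through endomorphisms. Flatness
  writes the relation \<open>k\<close> as a combination of relations with coefficients in the ideal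
  generated by the coordinates of \<open>k\<close>. Each coefficient is the value at
  \<open>k\<close> of a linear form, so the whole combination is the value at \<open>k\<close> of an
  endomorphism.\<close>

lemma flat_module_fix:
  fixes R :: "('r, 'x) ring_scheme" and M :: "('r, 'm, 'z) module_scheme"
  assumes M: "module R M" and flat: "flat_module R M" and A: "finite A" "A \<subseteq> carrier M"
    and surj: "carrier M \<subseteq> free_module_lift R M (\<lambda>a. a) ` carrier (free_module R A)"
    and k: "k \<in> carrier (free_module R A)" "free_module_lift R M (\<lambda>a. a) k = \<zero>\<^bsub>M\<^esub>"
  shows "\<exists>\<theta>\<in>linear_maps R (free_module R A) (free_module R A).
    (\<forall>x\<in>carrier (free_module R A). free_module_lift R M (\<lambda>a. a) (\<theta> x) = \<zero>\<^bsub>M\<^esub>) \<and> \<theta> k = k"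
proof -
  interpret M: module R M by fact
  note R = M.R.is_cring
  let ?F = "free_module R A" and ?p = "free_module_lift R M (\<lambda>a. a)"
  note F = free_module_module[OF R, of A]
  interpret F: module R ?F by (rule F)
  have p: "?p \<in> linear_maps R ?F M" by (rule free_module_lift_linear[OF M]) (use A in auto)
  note Dp = linear_mapsD(2-)[OF p] linear_maps_map_diff[OF F M p]
  let ?N' = "restrict_scalars (\<lambda>r. r) R"
  note N' = ring_module[OF R]
  interpret N': module R ?N' by (rule N')
  note kR = free_module_memD(1)[OF k(1)]
  have dot: "free_module_lift R ?N' c d = (\<Oplus>\<^bsub>?N'\<^esub>a\<in>A. d a \<otimes>\<^bsub>R\<^esub> c a)"
    if "c \<in> carrier ?F" "d \<in> carrier ?F" for c d
  proof -
    have "free_module_lift R ?N' c d = (\<Oplus>\<^bsub>?N'\<^esub>a\<in>A. d a \<odot>\<^bsub>?N'\<^esub> c a)"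
    proof (rule free_module_lift_eq[OF N' _ _ A(1) _ subset_refl])
      show "c \<in> A \<rightarrow> carrier ?N'" "d \<in> UNIV \<rightarrow> carrier R"
        using free_module_memD(1)[OF that(1)] free_module_memD(1)[OF that(2)] by simp_all
      show "{i. d i \<noteq> \<zero>\<^bsub>R\<^esub>} \<subseteq> A" using free_module_memD(2)[OF that(2)] by blast
    qed
    then show ?thesis by simp
  qed
  let ?g = "free_module_lift R ?N' k"
  have g: "?g \<in> linear_maps R ?F ?N'"
    by (rule free_module_lift_linear[OF N']) (use kR in auto)
  \<comment> \<open>The map \<open>?g\<close> is the pairing with \<open>k\<close>, so
    \<open>H\<close> is the ideal generated by the coordinates of \<open>k\<close>.\<close>
  define H where "H = ?g ` carrier ?F"
  have H: "submodule H R ?N'" unfolding H_def by (rule submodule_image[OF F N' g])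
  let ?N = "?N'\<lparr>carrier := H\<rparr>"
  note N = submodule.submodule_is_module[OF H N']
  note incl = submodule_inclusion[OF H]
  have HR: "H \<subseteq> carrier R" using N'.submoduleE(1)[OF H] by simp
  have kH: "k a \<in> H" if "a \<in> A" for a
    using imageI[OF free_basis_closed[OF R that], of ?g]
      free_module_lift_basis[where e = k, OF N' that] kR unfolding H_def by simp
  have null': "(\<Sum>a\<in>A. frag_of (a, k a)) \<in> tensor_null R M ?N'"
  proof -
    have "(\<Sum>a\<in>A. frag_of (a, k a)) - frag_of (?p k, \<one>\<^bsub>R\<^esub>) \<in> tensor_null R M ?N'"
      using tensor_null_lift[OF M N' A k(1), of "\<one>\<^bsub>R\<^esub>"] kR by simp
    from tensor_null_add[OF this tensor_null_zero_left[OF M N', of "\<one>\<^bsub>R\<^esub>"]] show ?thesis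
      by (simp add: k(2))
  qed
  \<comment> \<open>Flatness enters here: tensoring keeps the inclusion of \<open>H\<close> into the
    ring injective, so the tensor that vanishes over the ring vanishes already over
    \<open>H\<close>.\<close>
  have null: "(\<Sum>a\<in>A. frag_of (a, k a)) \<in> tensor_null R M ?N"
  proof -
    have "Poly_Mapping.keys (\<Sum>a\<in>C. frag_of (a, k a)) \<subseteq> carrier M \<times> carrier ?N" if "C \<subseteq> A" for C
      using finite_subset[OF that A(1)] that
    proof (induction C rule: finite_induct)
      case (insert a C)
      then have "(a, k a) \<in> carrier M \<times> carrier ?N" using A(2) kH[of a] by auto
      then show ?case
        unfolding sum.insert[OF insert.hyps]
        using insert by (intro keys_add_subset) simp_all
    qed simp
    moreover have "inj_on (tensor_map R M ?N' (\<lambda>x. x)) (carrier (tensor_group R M ?N))"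
      by (rule flat_module_inj[OF M flat N N' incl]) simp
    ultimately show ?thesis
      using null' unfolding inj_on_tensor_map_iff[OF M N N' incl] tensor_lift_ident by blast
  qed
  \<comment> \<open>The condition that all entries lie in \<open>H\<close> is what lets differences
    formed in the module \<open>H\<close> be identified with differences formed in the ring.\<close>
  define Q where "Q = {n. (\<forall>a. n a \<in> H) \<and>
    (\<exists>\<theta>\<in>linear_maps R ?F ?F. (\<forall>x\<in>carrier ?F. ?p (\<theta> x) = \<zero>\<^bsub>M\<^esub>) \<and> \<theta> k = n)}"
  have "(\<lambda>a. if a \<in> A then k a else \<zero>\<^bsub>?N\<^esub>) \<in> Q"
  proof (rule tensor_null_generators[OF M N A surj])
    have zeroH: "\<zero>\<^bsub>R\<^esub> \<in> H" using subgroup.one_closed[OF submodule.axioms(1)[OF H]] by simp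
    have "(\<lambda>x. \<zero>\<^bsub>?F\<^esub>) \<in> linear_maps R ?F ?F"
      by (rule linear_maps_const_zero[OF F])
    then show "(\<lambda>_. \<zero>\<^bsub>?N\<^esub>) \<in> Q"
      using zeroH linear_maps_zero[OF F M p] unfolding Q_def
      by (intro CollectI conjI bexI[of _ "\<lambda>x. \<zero>\<^bsub>?F\<^esub>"]) (simp_all add: free_module_simps)
    fix f g assume f: "f \<in> Q" and g: "g \<in> Q"
    obtain \<theta> where \<theta>: "\<theta> \<in> linear_maps R ?F ?F" "\<And>x. x \<in> carrier ?F \<Longrightarrow> ?p (\<theta> x) = \<zero>\<^bsub>M\<^esub>" "\<theta> k = f"
      and fH: "\<And>a. f a \<in> H" using f unfolding Q_def by blast
    obtain \<psi> where \<psi>: "\<psi> \<in> linear_maps R ?F ?F" "\<And>x. x \<in> carrier ?F \<Longrightarrow> ?p (\<psi> x) = \<zero>\<^bsub>M\<^esub>" "\<psi> k = g"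
      and gH: "\<And>a. g a \<in> H" using g unfolding Q_def by blast
    have eq: "(\<lambda>a. f a \<ominus>\<^bsub>?N\<^esub> g a) = \<theta> k \<ominus>\<^bsub>?F\<^esub> \<psi> k"
      using linear_maps_map_diff[OF N N' incl] fH gH linear_mapsD(2)[OF \<theta>(1) k(1)]
        linear_mapsD(2)[OF \<psi>(1) k(1)] \<theta>(3) \<psi>(3)
      by (simp add: free_module_diff[OF R] restrict_scalars_diff)
    have "f a \<ominus>\<^bsub>?N\<^esub> g a \<in> H" for a
      using abelian_group.minus_closed[OF module.axioms(2)[OF N], of "f a" "g a"] fH gH by simp
    moreover have "?p (\<theta> x \<ominus>\<^bsub>?F\<^esub> \<psi> x) = \<zero>\<^bsub>M\<^esub>" if "x \<in> carrier ?F" for x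
      using that linear_mapsD(2)[OF \<theta>(1)] linear_mapsD(2)[OF \<psi>(1)]
      by (simp add: Dp \<theta>(2) \<psi>(2) M.M.minus_eq)
    ultimately show "(\<lambda>a. f a \<ominus>\<^bsub>?N\<^esub> g a) \<in> Q"
      using linear_maps_diff[OF F \<theta>(1) \<psi>(1)] eq unfolding Q_def
      by (intro CollectI conjI allI bexI[of _ "\<lambda>x. \<theta> x \<ominus>\<^bsub>?F\<^esub> \<psi> x"]) simp_all
  next
    fix l y assume l: "l \<in> carrier ?F" "?p l = \<zero>\<^bsub>M\<^esub>" and y: "y \<in> carrier ?N"
    have yH: "y \<in> H" using y by simp
    \<comment> \<open>As an element of \<open>H\<close>, the scalar \<open>y\<close> is the pairing
      of \<open>c\<close> with \<open>k\<close>. Pairing with \<open>c\<close>, followed by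
      multiplication of \<open>l\<close>, is therefore an endomorphism that takes \<open>k\<close>
      to the multiple of \<open>l\<close> by \<open>y\<close>; its values are multiples of the
      relation \<open>l\<close>.\<close>
    then obtain c where c: "c \<in> carrier ?F" "y = ?g c" unfolding H_def by blast
    let ?c = "free_module_lift R ?N' c"
    have cl: "?c \<in> linear_maps R ?F ?N'"
      by (rule free_module_lift_linear[OF N']) (use free_module_memD(1)[OF c(1)] in auto)
    have "(\<lambda>r. r \<odot>\<^bsub>?F\<^esub> l) \<in> linear_maps R ?N' ?F"
      using l(1) by (auto simp: linear_maps_def F.smult_l_distr F.smult_assoc1)
    from linear_maps_compose[OF cl this] have \<theta>: "(\<lambda>x. ?c x \<odot>\<^bsub>?F\<^esub> l) \<in> linear_maps R ?F ?F" .
    have "?c k = y"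
      unfolding c(2) dot[OF c(1) k(1)] dot[OF k(1) c(1)]
      by (rule N'.M.finsum_cong') (auto simp: kR free_module_memD(1)[OF c(1)] M.R.m_comm)
    then have "?c k \<odot>\<^bsub>?F\<^esub> l = (\<lambda>a. l a \<odot>\<^bsub>?N\<^esub> y)"
      using yH HR free_module_memD(1)[OF l(1)] by (auto simp: free_module_simps M.R.m_comm)
    moreover have "?p (?c x \<odot>\<^bsub>?F\<^esub> l) = \<zero>\<^bsub>M\<^esub>" if "x \<in> carrier ?F" for x
      using linear_mapsD(2)[OF cl that] l by (simp add: Dp)
    moreover have "l a \<odot>\<^bsub>?N\<^esub> y \<in> H" for a
      using module.smult_closed[OF N free_module_memD(1)[OF l(1)] y, of a] by simp
    ultimately show "(\<lambda>a. l a \<odot>\<^bsub>?N\<^esub> y) \<in> Q"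
      using \<theta> unfolding Q_def
      by (intro CollectI conjI allI bexI[of _ "\<lambda>x. ?c x \<odot>\<^bsub>?F\<^esub> l"]) simp_all
  next
    show "k \<in> A \<rightarrow> carrier ?N" using kH by simp
    show "(\<Sum>a\<in>A. frag_of (a, k a)) \<in> tensor_null R M ?N" by (rule null)
  qed
  moreover have "(\<lambda>a. if a \<in> A then k a else \<zero>\<^bsub>?N\<^esub>) = k"
    using free_module_memD(2)[OF k(1)] by auto
  ultimately show ?thesis unfolding Q_def by auto
qed

text \<open>If \<theta> fixes \<open>P\<close> and \<psi> fixes k - \<theta> k, the new endomorphism
  is chosen so that 1 minus it equals (1 - \<psi>)(1 - \<theta>). This product annihilates
  \<open>P\<close> through the right factor and \<open>k\<close> through the left one.\<close>

lemma flat_module_fix_finite: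
  fixes R :: "('r, 'x) ring_scheme" and M :: "('r, 'm, 'z) module_scheme"
  assumes M: "module R M" and flat: "flat_module R M" and A: "finite A" "A \<subseteq> carrier M"
    and surj: "carrier M \<subseteq> free_module_lift R M (\<lambda>a. a) ` carrier (free_module R A)"
    and P: "finite P" "P \<subseteq> {k \<in> carrier (free_module R A). free_module_lift R M (\<lambda>a. a) k = \<zero>\<^bsub>M\<^esub>}"
  shows "\<exists>\<theta>\<in>linear_maps R (free_module R A) (free_module R A).
    (\<forall>x\<in>carrier (free_module R A). free_module_lift R M (\<lambda>a. a) (\<theta> x) = \<zero>\<^bsub>M\<^esub>) \<and> (\<forall>k\<in>P. \<theta> k = k)"
proof -
  interpret M: module R M by fact
  note R = M.R.is_cring
  let ?F = "free_module R A" and ?p = "free_module_lift R M (\<lambda>a. a)"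
  note F = free_module_module[OF R, of A]
  interpret F: module R ?F by (rule F)
  have p: "?p \<in> linear_maps R ?F M" by (rule free_module_lift_linear[OF M]) (use A in auto)
  note Dp = linear_mapsD(2-)[OF p] linear_maps_map_diff[OF F M p]
  show ?thesis
    using P
  proof (induction P rule: finite_induct)
    case empty
    have "(\<lambda>x. x \<ominus>\<^bsub>?F\<^esub> x) \<in> linear_maps R ?F ?F"
      by (rule linear_maps_diff[OF F linear_maps_ident linear_maps_ident])
    then show ?case
      by (intro bexI[of _ "\<lambda>x. x \<ominus>\<^bsub>?F\<^esub> x"]) (auto simp: Dp M.M.minus_eq M.M.r_neg)
  next
    case (insert k P)
    then obtain \<theta> where \<theta>: "\<theta> \<in> linear_maps R ?F ?F"
      and p\<theta>: "\<And>x. x \<in> carrier ?F \<Longrightarrow> ?p (\<theta> x) = \<zero>\<^bsub>M\<^esub>" and \<theta>P: "\<And>k. k \<in> P \<Longrightarrow> \<theta> k = k" by auto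
    note D\<theta> = linear_mapsD(2)[OF \<theta>]
    have k: "k \<in> carrier ?F" "?p k = \<zero>\<^bsub>M\<^esub>" using insert by auto
    have "?p (k \<ominus>\<^bsub>?F\<^esub> \<theta> k) = \<zero>\<^bsub>M\<^esub>" using k by (simp add: Dp D\<theta> p\<theta> M.M.minus_eq)
    from flat_module_fix[OF M flat A surj _ this] obtain \<psi> where \<psi>: "\<psi> \<in> linear_maps R ?F ?F"
      and p\<psi>: "\<And>x. x \<in> carrier ?F \<Longrightarrow> ?p (\<psi> x) = \<zero>\<^bsub>M\<^esub>" and \<psi>k: "\<psi> (k \<ominus>\<^bsub>?F\<^esub> \<theta> k) = k \<ominus>\<^bsub>?F\<^esub> \<theta> k"
      using k D\<theta> by auto
    note D\<psi> = linear_mapsD(2)[OF \<psi>]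
    let ?\<theta> = "\<lambda>x. \<theta> x \<oplus>\<^bsub>?F\<^esub> \<psi> (x \<ominus>\<^bsub>?F\<^esub> \<theta> x)"
    have "?\<theta> \<in> linear_maps R ?F ?F"
      by (rule linear_maps_add[OF F \<theta> linear_maps_compose[OF linear_maps_diff[OF F linear_maps_ident \<theta>] \<psi>]])
    moreover have "?p (?\<theta> x) = \<zero>\<^bsub>M\<^esub>" if "x \<in> carrier ?F" for x
      using that by (simp add: Dp D\<theta> D\<psi> p\<theta> p\<psi>)
    moreover have "?\<theta> k = k"
      unfolding \<psi>k using k D\<theta>[OF k(1)] by (simp add: F.M.minus_eq F.M.a_ac F.M.r_neg1 F.M.r_neg2 F.M.r_neg)
    moreover have "?\<theta> l = l" if "l \<in> P" for l
    proof -
      have "l \<in> carrier ?F" using that insert.prems by auto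
      then show ?thesis
        using \<theta>P[OF that] by (simp add: F.M.minus_eq F.M.r_neg linear_maps_zero[OF F F \<psi>])
    qed
    ultimately show ?case by (intro bexI[of _ ?\<theta>]) auto
  qed
qed

section \<open>Relations after base change\<close>

lemma free_module_lift_apply:
  assumes R: "cring R" and A: "finite A" and g: "g \<in> A \<rightarrow> carrier (free_module R I)"
    and c: "c \<in> carrier (free_module R A)"
  shows "free_module_lift R (free_module R I) g c j = (\<Oplus>\<^bsub>R\<^esub>a\<in>A. c a \<otimes>\<^bsub>R\<^esub> g a j)"
proof -
  interpret R: cring R by fact
  let ?N = "restrict_scalars (\<lambda>r. r) R"
  note F = free_module_module[OF R, of I] and N = ring_module[OF R]
  have gj: "g a j \<in> carrier R" if "a \<in> A" for a
    using free_module_memD(1)[OF funcset_mem[OF g that]] .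
  have "free_module_lift R (free_module R I) g c j = free_module_lift R ?N (\<lambda>a. g a j) c"
    by (rule free_module_lift_map[OF F N free_module_eval_linear g c])
  also have "\<dots> = (\<Oplus>\<^bsub>?N\<^esub>a\<in>A. c a \<odot>\<^bsub>?N\<^esub> g a j)"
  proof (rule free_module_lift_eq[OF N _ _ A _ subset_refl])
    show "(\<lambda>a. g a j) \<in> A \<rightarrow> carrier ?N" "c \<in> UNIV \<rightarrow> carrier R"
      using gj free_module_memD(1)[OF c] by simp_all
    show "{i. c i \<noteq> \<zero>\<^bsub>R\<^esub>} \<subseteq> A" using free_module_memD(2)[OF c] by blast
  qed
  also have "\<dots> = (\<Oplus>\<^bsub>R\<^esub>a\<in>A. c a \<otimes>\<^bsub>R\<^esub> g a j)"
    using gj free_module_memD(1)[OF c] by (subst finsum_restrict_scalars[OF N R]) auto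
  finally show ?thesis .
qed

text \<open>The map \<open>q\<close> below presents the base change by the same index set
  \<open>A\<close> by which \<open>p\<close> presents \<open>M\<close>. So
  \<open>projective_module_iff\<close> applies on both sides, and endomorphisms of \<open>F\<close>
  can be carried over to \<open>FS\<close> entry by entry.\<close>

locale finite_base_change = M: module R M + S: cring S
  for R :: "('r, 'x) ring_scheme" and M :: "('r, 'm, 'z) module_scheme"
    and S :: "('s, 'y) ring_scheme" +
  fixes \<phi> :: "'r \<Rightarrow> 's" and A :: "'m set"
  assumes hom: "\<phi> \<in> ring_hom R S"
    and A: "finite A" "A \<subseteq> carrier M"
    and surj: "carrier M \<subseteq> free_module_lift R M (\<lambda>a. a) ` carrier (free_module R A)"
begin

abbreviation "F \<equiv> free_module R A"
abbreviation "FS \<equiv> free_module S A"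
abbreviation "p \<equiv> free_module_lift R M (\<lambda>a. a)"
abbreviation "N \<equiv> restrict_scalars \<phi> S"
abbreviation "cl \<equiv> tensor_class R M N"
abbreviation "q \<equiv> free_module_lift S (base_change R \<phi> S M) (\<lambda>a. cl (frag_of (a, \<one>\<^bsub>S\<^esub>)))"

text \<open>This is the base change of the endomorphism \<theta>: its matrix in the standard basis,
  with \<phi> applied to the entries.\<close>

definition mapS :: "(('m \<Rightarrow> 'r) \<Rightarrow> 'm \<Rightarrow> 'r) \<Rightarrow> ('m \<Rightarrow> 's) \<Rightarrow> 'm \<Rightarrow> 's" where
  "mapS \<theta> = free_module_lift S FS (\<lambda>a i. \<phi> (\<theta> (free_basis R a) i))"

lemma R_cring: "cring R" by (rule M.R.is_cring)
lemma M_module: "module R M" by (rule M.module_axioms)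
lemma S_cring: "cring S" by (rule S.is_cring)
lemma F_module: "module R F" by (rule free_module_module[OF R_cring])
lemma FS_module: "module S FS" by (rule free_module_module[OF S_cring])
lemma N_module: "module R N" by (rule restrict_scalars_module[OF R_cring S_cring hom])
lemma base_module: "module S (base_change R \<phi> S M)" by (rule base_change_module[OF M_module S_cring hom])

sublocale F: module R F by (rule F_module)
sublocale FS: module S FS by (rule FS_module)
sublocale N: module R N by (rule N_module)
sublocale BC: module S "base_change R \<phi> S M" by (rule base_module)
sublocale \<phi>: ring_hom_cring R S \<phi>
  using R_cring S_cring hom by (simp add: ring_hom_cring_def ring_hom_cring_axioms_def)

lemma p_linear: "p \<in> linear_maps R F M"
  by (rule free_module_lift_linear[OF M_module]) (use A in auto)

lemma gen_closed: "cl (frag_of (a, \<one>\<^bsub>S\<^esub>)) \<in> carrier (base_change R \<phi> S M)" if "a \<in> A"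
  using that A by (auto simp: base_change_simps tensor_group_carrier)

lemma q_linear: "q \<in> linear_maps S FS (base_change R \<phi> S M)"
  by (rule free_module_lift_linear[OF base_module]) (simp add: gen_closed)

lemma keys_sum:
  assumes "t \<in> A \<rightarrow> carrier S"
  shows "Poly_Mapping.keys (\<Sum>a\<in>A. frag_of (a, t a)) \<subseteq> carrier M \<times> carrier S"
proof -
  have "Poly_Mapping.keys (\<Sum>a\<in>C. frag_of (a, t a)) \<subseteq> carrier M \<times> carrier S" if "C \<subseteq> A" for C
    using finite_subset[OF that A(1)] that
  proof (induction C rule: finite_induct)
    case (insert a C)
    then have "(a, t a) \<in> carrier M \<times> carrier S" using A(2) assms by auto
    then show ?case
      unfolding sum.insert[OF insert.hyps] using insert by (intro keys_add_subset) simp_all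
  qed simp
  then show ?thesis by simp
qed

text \<open>An explicit representative of the coset turns questions about the kernel of
  \<open>q\<close> into membership in \<open>tensor_null\<close>.\<close>

lemma q_eq:
  assumes t: "t \<in> carrier FS"
  shows "q t = cl (\<Sum>a\<in>A. frag_of (a, t a))"
proof -
  let ?B = "base_change R \<phi> S M"
  note tS = free_module_memD(1)[OF t]
  have "q t = (\<Oplus>\<^bsub>?B\<^esub>a\<in>A. t a \<odot>\<^bsub>?B\<^esub> cl (frag_of (a, \<one>\<^bsub>S\<^esub>)))"
  proof (rule free_module_lift_eq[OF base_module _ _ A(1) _ subset_refl])
    show "(\<lambda>a. cl (frag_of (a, \<one>\<^bsub>S\<^esub>))) \<in> A \<rightarrow> carrier ?B" "t \<in> UNIV \<rightarrow> carrier S"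
      using tS by (simp_all add: gen_closed)
    show "{i. t i \<noteq> \<zero>\<^bsub>S\<^esub>} \<subseteq> A" using free_module_memD(2)[OF t] by blast
  qed
  moreover have "(\<Oplus>\<^bsub>?B\<^esub>a\<in>C. t a \<odot>\<^bsub>?B\<^esub> cl (frag_of (a, \<one>\<^bsub>S\<^esub>))) = cl (\<Sum>a\<in>C. frag_of (a, t a)) \<and>
      Poly_Mapping.keys (\<Sum>a\<in>C. frag_of (a, t a)) \<subseteq> carrier M \<times> carrier S" if "C \<subseteq> A" for C
    using finite_subset[OF that A(1)] that
  proof (induction C rule: finite_induct)
    case empty
    show ?case by (simp add: base_change_simps tensor_group_one)
  next
    case (insert a C)
    then have a: "a \<in> A" "a \<in> carrier M" using A(2) by auto
    have K: "Poly_Mapping.keys (frag_of (a, t a)) \<subseteq> carrier M \<times> carrier N"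
      using a tS by simp
    have sm: "t a \<odot>\<^bsub>?B\<^esub> cl (frag_of (a, \<one>\<^bsub>S\<^esub>)) = cl (frag_of (a, t a))"
      using base_change_smult_pure[OF M_module S_cring hom a(2) tS, of "\<one>\<^bsub>S\<^esub>" a] tS by simp
    have fin: "(\<Oplus>\<^bsub>?B\<^esub>a\<in>insert a C. t a \<odot>\<^bsub>?B\<^esub> cl (frag_of (a, \<one>\<^bsub>S\<^esub>))) =
        t a \<odot>\<^bsub>?B\<^esub> cl (frag_of (a, \<one>\<^bsub>S\<^esub>)) \<oplus>\<^bsub>?B\<^esub> (\<Oplus>\<^bsub>?B\<^esub>a\<in>C. t a \<odot>\<^bsub>?B\<^esub> cl (frag_of (a, \<one>\<^bsub>S\<^esub>)))"
    proof (rule BC.M.finsum_insert[OF insert.hyps])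
      show "(\<lambda>a. t a \<odot>\<^bsub>?B\<^esub> cl (frag_of (a, \<one>\<^bsub>S\<^esub>))) \<in> C \<rightarrow> carrier ?B"
        using insert.prems by (intro Pi_I BC.smult_closed tS gen_closed) auto
      show "t a \<odot>\<^bsub>?B\<^esub> cl (frag_of (a, \<one>\<^bsub>S\<^esub>)) \<in> carrier ?B"
        by (intro BC.smult_closed tS gen_closed a)
    qed
    have IH: "(\<Oplus>\<^bsub>?B\<^esub>a\<in>C. t a \<odot>\<^bsub>?B\<^esub> cl (frag_of (a, \<one>\<^bsub>S\<^esub>))) = cl (\<Sum>a\<in>C. frag_of (a, t a))"
      "Poly_Mapping.keys (\<Sum>a\<in>C. frag_of (a, t a)) \<subseteq> carrier M \<times> carrier N"
      using insert by simp_all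
    show ?case
      unfolding fin sm IH(1) sum.insert[OF insert.hyps]
      using tensor_group_mult[OF M_module N_module K IH(2)] keys_add_subset[OF K IH(2)]
      by (simp add: base_change_simps)
  qed
  ultimately show ?thesis by simp
qed

lemma q_eq_class_iff:
  assumes t: "t \<in> carrier FS" and u: "Poly_Mapping.keys u \<subseteq> carrier M \<times> carrier S"
  shows "q t = cl u \<longleftrightarrow> (\<Sum>a\<in>A. frag_of (a, t a)) - u \<in> tensor_null R M N"
  unfolding q_eq[OF t]
  by (rule tensor_class_eq_iff[OF M_module N_module]) (use u keys_sum free_module_memD(1)[OF t] in auto)

lemma q_zero_iff:
  assumes t: "t \<in> carrier FS"
  shows "q t = \<zero>\<^bsub>base_change R \<phi> S M\<^esub> \<longleftrightarrow> (\<Sum>a\<in>A. frag_of (a, t a)) \<in> tensor_null R M N"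
  using q_eq_class_iff[OF t, of 0] by (simp add: base_change_simps tensor_group_one)

text \<open>The scalars c a move across the tensor sign and act on \<open>s\<close> through \<phi>.
  Since every element of \<open>M\<close> has the form \<open>p c\<close>, all pure tensors are
  values of \<open>q\<close>, which is the core of its surjectivity.\<close>

lemma q_pure:
  assumes c: "c \<in> carrier F" and s: "s \<in> carrier S"
  shows "(\<lambda>a. \<phi> (c a) \<otimes>\<^bsub>S\<^esub> s) \<in> carrier FS"
    and "q (\<lambda>a. \<phi> (c a) \<otimes>\<^bsub>S\<^esub> s) = cl (frag_of (p c, s))"
proof -
  note cR = free_module_memD(1)[OF c]
  show t: "(\<lambda>a. \<phi> (c a) \<otimes>\<^bsub>S\<^esub> s) \<in> carrier FS"
    by (rule free_module_memI[OF A(1) _ _ S_cring]) (use cR s free_module_memD(2)[OF c] in simp_all)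
  show "q (\<lambda>a. \<phi> (c a) \<otimes>\<^bsub>S\<^esub> s) = cl (frag_of (p c, s))"
    unfolding q_eq_class_iff[OF t, of "frag_of (p c, s)"]
    using tensor_null_lift[OF M_module N_module A c, of s] s linear_mapsD(2)[OF p_linear c]
    by (subst q_eq_class_iff[OF t]) simp_all
qed

lemma q_surj: "carrier (base_change R \<phi> S M) \<subseteq> q ` carrier FS"
proof
  let ?B = "base_change R \<phi> S M"
  fix U assume "U \<in> carrier ?B"
  then obtain u where U: "U = cl u" and "Poly_Mapping.keys u \<subseteq> carrier M \<times> carrier S"
    by (auto simp: base_change_simps tensor_group_carrier)
  from this(2) have "cl u \<in> q ` carrier FS \<and> Poly_Mapping.keys u \<subseteq> carrier M \<times> carrier S"
  proof (induction u rule: frag_induction)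
    case zero
    have "q \<zero>\<^bsub>FS\<^esub> = \<zero>\<^bsub>?B\<^esub>" by (rule linear_maps_zero[OF FS_module base_module q_linear])
    then have "cl 0 = q \<zero>\<^bsub>FS\<^esub>" by (simp add: base_change_simps tensor_group_one)
    then show ?case by simp
  next
    case (one z)
    then obtain x s where z: "z = (x, s)" "x \<in> carrier M" "s \<in> carrier S" by auto
    then obtain c where c: "c \<in> carrier F" "x = p c" using surj by blast
    then show ?case
      using imageI[OF q_pure(1)[OF c(1) z(3)], of q] q_pure(2)[OF c(1) z(3)] z by simp
  next
    case (diff u v)
    then have u: "Poly_Mapping.keys u \<subseteq> carrier M \<times> carrier N"
      and v: "Poly_Mapping.keys v \<subseteq> carrier M \<times> carrier N" by simp_all
    obtain t t' where t: "t \<in> carrier FS" "cl u = q t" and t': "t' \<in> carrier FS" "cl v = q t'"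
      using diff by blast
    note uv = keys_diff_subset[OF u v]
    have cuv: "cl (u - v) \<in> carrier ?B"
      using uv by (simp add: base_change_simps tensor_group_carrier)
    have qt: "q t \<in> carrier ?B" "q t' \<in> carrier ?B"
      using t t' linear_mapsD(2)[OF q_linear] by simp_all
    have sum: "q t = cl (u - v) \<oplus>\<^bsub>?B\<^esub> q t'"
      using tensor_group_mult[OF M_module N_module uv v] by (simp add: base_change_simps t(2)[symmetric] t'(2)[symmetric])
    then have "q t \<ominus>\<^bsub>?B\<^esub> q t' = cl (u - v)"
      unfolding sum using cuv qt by (simp add: BC.M.minus_eq BC.M.a_assoc BC.M.r_neg)
    then have "cl (u - v) = q (t \<ominus>\<^bsub>FS\<^esub> t')"
      using linear_maps_map_diff[OF FS_module base_module q_linear t(1) t'(1)] by simp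
    then show ?case using FS.M.minus_closed[OF t(1) t'(1)] uv by simp
  qed
  then show "U \<in> q ` carrier FS" by (simp add: U)
qed

lemma scalar_ext:
  assumes c: "c \<in> carrier F"
  shows "(\<lambda>a. \<phi> (c a)) \<in> carrier FS"
  using q_pure(1)[OF c S.one_closed] free_module_memD(1)[OF c] by simp

lemma q_scalar_ext:
  assumes c: "c \<in> carrier F" "p c = \<zero>\<^bsub>M\<^esub>"
  shows "q (\<lambda>a. \<phi> (c a)) = \<zero>\<^bsub>base_change R \<phi> S M\<^esub>"
proof -
  have "q (\<lambda>a. \<phi> (c a)) = cl (frag_of (\<zero>\<^bsub>M\<^esub>, \<one>\<^bsub>S\<^esub>))"
    using q_pure(2)[OF c(1) S.one_closed] free_module_memD(1)[OF c(1)] c(2) by simp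
  also have "\<dots> = cl 0"
    using tensor_null_zero_left[OF M_module N_module, of "\<one>\<^bsub>S\<^esub>"] by (subst tensor_class_eq_iff[OF M_module N_module]) simp_all
  finally show ?thesis by (simp add: base_change_simps tensor_group_one)
qed

section \<open>Base change of endomorphisms\<close>

lemma mapS_linear:
  assumes "\<theta> \<in> linear_maps R F F"
  shows "mapS \<theta> \<in> linear_maps S FS FS"
  unfolding mapS_def
  by (rule free_module_lift_linear[OF FS_module])
    (simp add: scalar_ext linear_mapsD(2)[OF assms] free_basis_closed[OF R_cring])

text \<open>Applying \<phi> to all coordinates leads from an \<open>R\<close>-module to an
  \<open>S\<close>-module, so it is outside the scope of \<open>linear_maps\<close>. Both sides are
  therefore expanded in coordinates, and \<phi> is moved through the finite sum.\<close>

lemma mapS_scalar_ext: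
  assumes \<theta>: "\<theta> \<in> linear_maps R F F" and c: "c \<in> carrier F"
  shows "mapS \<theta> (\<lambda>a. \<phi> (c a)) = (\<lambda>a. \<phi> (\<theta> c a))"
proof
  fix i
  note cR = free_module_memD(1)[OF c]
  have b: "\<theta> (free_basis R a) \<in> carrier F" if "a \<in> A" for a
    using linear_mapsD(2)[OF \<theta>] free_basis_closed[OF R_cring that] by blast
  note bR = free_module_memD(1)[OF b]
  have "mapS \<theta> (\<lambda>a. \<phi> (c a)) i = (\<Oplus>\<^bsub>S\<^esub>a\<in>A. \<phi> (c a) \<otimes>\<^bsub>S\<^esub> \<phi> (\<theta> (free_basis R a) i))"
    unfolding mapS_def
    by (rule free_module_lift_apply[OF S_cring A(1) _ scalar_ext[OF c]]) (simp add: scalar_ext b)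
  also have "\<dots> = (\<Oplus>\<^bsub>S\<^esub>a\<in>A. \<phi> (c a \<otimes>\<^bsub>R\<^esub> \<theta> (free_basis R a) i))"
    by (rule S.finsum_cong') (simp_all add: cR bR)
  also have "\<dots> = \<phi> (\<Oplus>\<^bsub>R\<^esub>a\<in>A. c a \<otimes>\<^bsub>R\<^esub> \<theta> (free_basis R a) i)"
    by (subst \<phi>.hom_finsum) (simp_all add: cR bR comp_def)
  also have "(\<Oplus>\<^bsub>R\<^esub>a\<in>A. c a \<otimes>\<^bsub>R\<^esub> \<theta> (free_basis R a) i) = \<theta> c i"
    unfolding free_module_linear_eq[OF R_cring F_module \<theta> c]
    by (rule free_module_lift_apply[OF R_cring A(1) _ c, symmetric]) (simp add: b)
  finally show "mapS \<theta> (\<lambda>a. \<phi> (c a)) i = \<phi> (\<theta> c i)" .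
qed

lemma mapS_basis:
  assumes "\<theta> \<in> linear_maps R F F" "a \<in> A"
  shows "mapS \<theta> (free_basis S a) = (\<lambda>i. \<phi> (\<theta> (free_basis R a) i))"
  unfolding mapS_def
  by (rule free_module_lift_basis[OF FS_module assms(2)])
    (simp add: scalar_ext linear_mapsD(2)[OF assms(1)] free_basis_closed[OF R_cring] assms(2))

text \<open>Right exactness in the form of an induction rule: \<open>tensor_null_generators\<close>
  is applied to the set of vectors that satisfy \<open>P\<close>.\<close>

lemma ker_q_induct:
  assumes t: "t \<in> carrier FS" "q t = \<zero>\<^bsub>base_change R \<phi> S M\<^esub>"
    and zero: "P \<zero>\<^bsub>FS\<^esub>"
    and diff: "\<And>f g. f \<in> carrier FS \<Longrightarrow> g \<in> carrier FS \<Longrightarrow> P f \<Longrightarrow> P g \<Longrightarrow> P (f \<ominus>\<^bsub>FS\<^esub> g)"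
    and gen: "\<And>k s. k \<in> carrier F \<Longrightarrow> p k = \<zero>\<^bsub>M\<^esub> \<Longrightarrow> s \<in> carrier S \<Longrightarrow>
      P (s \<odot>\<^bsub>FS\<^esub> (\<lambda>a. \<phi> (k a)))"
  shows "P t"
proof -
  have "(\<lambda>a. if a \<in> A then t a else \<zero>\<^bsub>N\<^esub>) \<in> {t \<in> carrier FS. P t}"
  proof (rule tensor_null_generators[OF M_module N_module A surj])
    show "(\<lambda>_. \<zero>\<^bsub>N\<^esub>) \<in> {t \<in> carrier FS. P t}"
      using zero FS.M.zero_closed by (simp add: free_module_simps)
    show "(\<lambda>a. f a \<ominus>\<^bsub>N\<^esub> g a) \<in> {t \<in> carrier FS. P t}"
      if f: "f \<in> {t \<in> carrier FS. P t}" and g: "g \<in> {t \<in> carrier FS. P t}" for f g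
    proof -
      have fg: "f \<in> carrier FS" "g \<in> carrier FS" "P f" "P g" using f g by simp_all
      show ?thesis
        using diff[OF fg] FS.M.minus_closed[OF fg(1,2)]
        by (simp add: free_module_diff[OF S_cring fg(1,2)] restrict_scalars_diff)
    qed
    show "(\<lambda>a. k a \<odot>\<^bsub>N\<^esub> s) \<in> {t \<in> carrier FS. P t}"
      if k: "k \<in> carrier F" "p k = \<zero>\<^bsub>M\<^esub>" and s: "s \<in> carrier N" for k s
    proof -
      have "(\<lambda>a. k a \<odot>\<^bsub>N\<^esub> s) = s \<odot>\<^bsub>FS\<^esub> (\<lambda>a. \<phi> (k a))"
        using s free_module_memD(1)[OF k(1)] by (simp add: free_module_simps S.m_comm)
      then show ?thesis
        using gen[OF k, of s] FS.smult_closed[OF _ scalar_ext[OF k(1)], of s] s by simp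
    qed
    show "t \<in> A \<rightarrow> carrier N" using free_module_memD(1)[OF t(1)] by simp
    show "(\<Sum>a\<in>A. frag_of (a, t a)) \<in> tensor_null R M N" using t q_zero_iff by blast
  qed
  moreover have "(\<lambda>a. if a \<in> A then t a else \<zero>\<^bsub>N\<^esub>) = t"
    using free_module_memD(2)[OF t(1)] by auto
  ultimately show ?thesis by simp
qed

section \<open>Transfer of projectivity between the two rings\<close>

lemma projective_R_iff:
  "projective_module R M \<longleftrightarrow> (\<exists>\<theta>\<in>linear_maps R F F. \<forall>c\<in>carrier F. p (\<theta> c) = \<zero>\<^bsub>M\<^esub> \<and>
    (p c = \<zero>\<^bsub>M\<^esub> \<longrightarrow> \<theta> c = c))"
  by (rule projective_module_iff[OF M_module _ surj]) (use A in auto)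

lemma projective_S_iff:
  "projective_module S (base_change R \<phi> S M) \<longleftrightarrow>
    (\<exists>\<pi>\<in>linear_maps S FS FS. \<forall>t\<in>carrier FS. q (\<pi> t) = \<zero>\<^bsub>base_change R \<phi> S M\<^esub> \<and>
      (q t = \<zero>\<^bsub>base_change R \<phi> S M\<^esub> \<longrightarrow> \<pi> t = t))"
  by (rule projective_module_iff[OF base_module _ q_surj]) (simp add: gen_closed)

text \<open>The base change of a projection onto the kernel of \<open>p\<close> is a projection onto
  the kernel of \<open>q\<close>. That its values lie in the kernel is checked on basis vectors;
  that it is the identity there is checked on the generators coming from the kernel of
  \<open>p\<close>.\<close>

lemma projective_base_change:
  assumes "projective_module R M"
  shows "projective_module S (base_change R \<phi> S M)"
proof -
  obtain \<theta> where \<theta>: "\<theta> \<in> linear_maps R F F" and p\<theta>: "\<And>c. c \<in> carrier F \<Longrightarrow> p (\<theta> c) = \<zero>\<^bsub>M\<^esub>"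
    and fix_ker: "\<And>c. c \<in> carrier F \<Longrightarrow> p c = \<zero>\<^bsub>M\<^esub> \<Longrightarrow> \<theta> c = c"
    using assms unfolding projective_R_iff by blast
  note \<theta>S = mapS_linear[OF \<theta>]
  have "q (mapS \<theta> t) = \<zero>\<^bsub>base_change R \<phi> S M\<^esub>" if t: "t \<in> carrier FS" for t
  proof (rule free_module_linear_ext[OF S_cring base_module linear_maps_compose[OF \<theta>S q_linear]
        linear_maps_const_zero[OF base_module] _ t])
    show "q (mapS \<theta> (free_basis S a)) = \<zero>\<^bsub>base_change R \<phi> S M\<^esub>" if "a \<in> A" for a
      unfolding mapS_basis[OF \<theta> that]
      using q_scalar_ext linear_mapsD(2)[OF \<theta>] p\<theta> free_basis_closed[OF R_cring that] by blast
  qed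
  moreover have "mapS \<theta> t = t" if "t \<in> carrier FS" "q t = \<zero>\<^bsub>base_change R \<phi> S M\<^esub>" for t
    using that
  proof (rule ker_q_induct)
    show "mapS \<theta> \<zero>\<^bsub>FS\<^esub> = \<zero>\<^bsub>FS\<^esub>" by (rule linear_maps_zero[OF FS_module FS_module \<theta>S])
    show "mapS \<theta> (f \<ominus>\<^bsub>FS\<^esub> g) = f \<ominus>\<^bsub>FS\<^esub> g"
      if "f \<in> carrier FS" "g \<in> carrier FS" "mapS \<theta> f = f" "mapS \<theta> g = g" for f g
      using linear_maps_map_diff[OF FS_module FS_module \<theta>S that(1,2)] that(3,4) by simp
    show "mapS \<theta> (s \<odot>\<^bsub>FS\<^esub> (\<lambda>a. \<phi> (k a))) = s \<odot>\<^bsub>FS\<^esub> (\<lambda>a. \<phi> (k a))"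
      if "k \<in> carrier F" "p k = \<zero>\<^bsub>M\<^esub>" "s \<in> carrier S" for k s
      unfolding linear_mapsD(4)[OF \<theta>S that(3) scalar_ext[OF that(1)]]
        mapS_scalar_ext[OF \<theta> that(1)] fix_ker[OF that(1,2)] ..
  qed
  ultimately show ?thesis unfolding projective_S_iff using \<theta>S by blast
qed

text \<open>
  The kernel of \<open>q\<close> is finitely generated, as a projection of \<open>FS\<close> onto it exists, and it is
  spanned by the images of the elements of the kernel of \<open>p\<close>; take for \<open>P\<close> those elements that
  occur in a finite generating set.
\<close>

lemma finite_fixing_set:
  assumes "projective_module S (base_change R \<phi> S M)"
  obtains P where "finite P" "P \<subseteq> {k \<in> carrier F. p k = \<zero>\<^bsub>M\<^esub>}"
    and "\<And>\<theta> k a. \<theta> \<in> linear_maps R F F \<Longrightarrow> (\<And>k. k \<in> P \<Longrightarrow> \<theta> k = k) \<Longrightarrow>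
      k \<in> carrier F \<Longrightarrow> p k = \<zero>\<^bsub>M\<^esub> \<Longrightarrow> \<phi> (\<theta> k a) = \<phi> (k a)"
proof -
  let ?K = "{k \<in> carrier F. p k = \<zero>\<^bsub>M\<^esub>}"
  \<comment> \<open>Instead of an expression of \<open>t\<close> through elements of
    \<open>P\<close>, only its effect on endomorphisms is recorded. This form passes to differences
    when the finite sets are united.\<close>
  define fixes_at where "fixes_at P t \<longleftrightarrow>
    (\<forall>\<theta>\<in>linear_maps R F F. (\<forall>k\<in>P. \<theta> k = k) \<longrightarrow> mapS \<theta> t = t)" for P t
  have fixes_atD: "mapS \<theta> t = t"
    if "fixes_at P t" "\<theta> \<in> linear_maps R F F" "\<And>k. k \<in> P \<Longrightarrow> \<theta> k = k" for P t \<theta>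
    using that unfolding fixes_at_def by blast
  obtain \<pi> where \<pi>: "\<pi> \<in> linear_maps S FS FS"
    and q\<pi>: "\<And>t. t \<in> carrier FS \<Longrightarrow> q (\<pi> t) = \<zero>\<^bsub>base_change R \<phi> S M\<^esub>"
    and fix_ker: "\<And>t. t \<in> carrier FS \<Longrightarrow> q t = \<zero>\<^bsub>base_change R \<phi> S M\<^esub> \<Longrightarrow> \<pi> t = t"
    using assms unfolding projective_S_iff by blast
  have ex: "\<exists>P. finite P \<and> P \<subseteq> ?K \<and> fixes_at P t" if "t \<in> carrier FS" "q t = \<zero>\<^bsub>base_change R \<phi> S M\<^esub>" for t
    using that
  proof (rule ker_q_induct)
    show "\<exists>P. finite P \<and> P \<subseteq> ?K \<and> fixes_at P \<zero>\<^bsub>FS\<^esub>"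
      using linear_maps_zero[OF FS_module FS_module mapS_linear] by (intro exI[of _ "{}"]) (simp add: fixes_at_def)
    show "\<exists>P. finite P \<and> P \<subseteq> ?K \<and> fixes_at P (f \<ominus>\<^bsub>FS\<^esub> g)"
      if fg: "f \<in> carrier FS" "g \<in> carrier FS"
        and f: "\<exists>P. finite P \<and> P \<subseteq> ?K \<and> fixes_at P f"
        and g: "\<exists>P. finite P \<and> P \<subseteq> ?K \<and> fixes_at P g" for f g
    proof -
      obtain P P' where P: "finite P" "P \<subseteq> ?K" "fixes_at P f"
        and P': "finite P'" "P' \<subseteq> ?K" "fixes_at P' g"
        using f g by blast
      have "fixes_at (P \<union> P') (f \<ominus>\<^bsub>FS\<^esub> g)"
        unfolding fixes_at_def
      proof (intro ballI impI)
        fix \<theta> assume \<theta>: "\<theta> \<in> linear_maps R F F" and "\<forall>k\<in>P \<union> P'. \<theta> k = k"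
        then have "mapS \<theta> f = f" "mapS \<theta> g = g"
          using fixes_atD[OF P(3) \<theta>] fixes_atD[OF P'(3) \<theta>] by simp_all
        then show "mapS \<theta> (f \<ominus>\<^bsub>FS\<^esub> g) = f \<ominus>\<^bsub>FS\<^esub> g"
          using linear_maps_map_diff[OF FS_module FS_module mapS_linear[OF \<theta>] fg] by simp
      qed
      then show ?thesis using P P' by (intro exI[of _ "P \<union> P'"]) simp
    qed
    show "\<exists>P. finite P \<and> P \<subseteq> ?K \<and> fixes_at P (s \<odot>\<^bsub>FS\<^esub> (\<lambda>a. \<phi> (k a)))"
      if k: "k \<in> carrier F" "p k = \<zero>\<^bsub>M\<^esub>" and s: "s \<in> carrier S" for k s
    proof -
      have "mapS \<theta> (s \<odot>\<^bsub>FS\<^esub> (\<lambda>a. \<phi> (k a))) = s \<odot>\<^bsub>FS\<^esub> (\<lambda>a. \<phi> (k a))"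
        if "\<theta> \<in> linear_maps R F F" "\<theta> k = k" for \<theta>
        unfolding linear_mapsD(4)[OF mapS_linear[OF that(1)] s scalar_ext[OF k(1)]]
          mapS_scalar_ext[OF that(1) k(1)] that(2) ..
      then show ?thesis using k by (intro exI[of _ "{k}"]) (simp add: fixes_at_def)
    qed
  qed
  have "\<exists>P. finite P \<and> P \<subseteq> ?K \<and> fixes_at P (\<pi> (free_basis S a))" if "a \<in> A" for a
    by (rule ex[OF linear_mapsD(2)[OF \<pi> free_basis_closed[OF S_cring that]] q\<pi>[OF free_basis_closed[OF S_cring that]]])
  then have "\<forall>a\<in>A. \<exists>P. finite P \<and> P \<subseteq> ?K \<and> fixes_at P (\<pi> (free_basis S a))" by (rule ballI)
  from bchoice[OF this] obtain P where P: "\<And>a. a \<in> A \<Longrightarrow> finite (P a)"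
    "\<And>a. a \<in> A \<Longrightarrow> P a \<subseteq> ?K" "\<And>a. a \<in> A \<Longrightarrow> fixes_at (P a) (\<pi> (free_basis S a))" by blast
  show thesis
  proof (rule that)
    show "finite (\<Union>a\<in>A. P a)" using P(1) A(1) by simp
    show "(\<Union>a\<in>A. P a) \<subseteq> ?K" using P(2) by (rule UN_least)
    fix \<theta> k a assume \<theta>: "\<theta> \<in> linear_maps R F F"
      and fix_P: "\<And>k. k \<in> (\<Union>a\<in>A. P a) \<Longrightarrow> \<theta> k = k"
      and k: "k \<in> carrier F" "p k = \<zero>\<^bsub>M\<^esub>"
    have basis: "mapS \<theta> (\<pi> (free_basis S a)) = \<pi> (free_basis S a)" if "a \<in> A" for a
      by (rule fixes_atD[OF P(3)[OF that] \<theta> fix_P[OF UN_I[OF that]]])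
    \<comment> \<open>It suffices to compare on basis vectors, and this is where finitely many
      elements are enough. The image of \<open>k\<close> under \<phi> lies in the kernel of
      \<open>q\<close>, so \<pi> fixes it, and the equation passes from \<pi> to that image.\<close>
    have "mapS \<theta> (\<pi> t) = \<pi> t" if "t \<in> carrier FS" for t
      by (rule free_module_linear_ext[OF S_cring FS_module linear_maps_compose[OF \<pi> mapS_linear[OF \<theta>]] \<pi> basis that])
    from this[OF scalar_ext[OF k(1)]] have "mapS \<theta> (\<lambda>a. \<phi> (k a)) = (\<lambda>a. \<phi> (k a))"
      unfolding fix_ker[OF scalar_ext[OF k(1)] q_scalar_ext[OF k]] .
    then show "\<phi> (\<theta> k a) = \<phi> (k a)"
      unfolding mapS_scalar_ext[OF \<theta> k(1)] by (rule fun_cong)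
  qed
qed

end

text \<open>
  Write \<open>K\<close> for the kernel of \<open>p\<close>. On the set \<open>W\<close> of fixed points of \<open>\<theta>'\<close> the map
  \<open>B = 1 + \<theta> - \<theta>'\<close> agrees with \<open>\<theta>\<close>, and it is invertible modulo the Jacobson radical because
  \<open>\<theta> - \<theta>'\<close> has values in \<open>K\<close> and maps \<open>K\<close> into vectors with entries in the kernel of \<open>\<phi>\<close>.
\<close>

lemma (in finite_base_change) kernel_subset_image:
  assumes flat: "flat_module R M" and ker: "a_kernel R S \<phi> \<subseteq> jacobson_radical R"
    and P: "finite P" "P \<subseteq> {k \<in> carrier F. p k = \<zero>\<^bsub>M\<^esub>}"
    and P_fix: "\<And>\<theta> k a. \<theta> \<in> linear_maps R F F \<Longrightarrow> (\<And>k. k \<in> P \<Longrightarrow> \<theta> k = k) \<Longrightarrow>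
      k \<in> carrier F \<Longrightarrow> p k = \<zero>\<^bsub>M\<^esub> \<Longrightarrow> \<phi> (\<theta> k a) = \<phi> (k a)"
    and \<theta>: "\<theta> \<in> linear_maps R F F" and p\<theta>: "\<And>x. x \<in> carrier F \<Longrightarrow> p (\<theta> x) = \<zero>\<^bsub>M\<^esub>"
    and \<theta>P: "\<And>k. k \<in> P \<Longrightarrow> \<theta> k = k"
    and k: "k \<in> carrier F" "p k = \<zero>\<^bsub>M\<^esub>"
  shows "k \<in> \<theta> ` carrier F"
proof -
  note D\<theta> = linear_mapsD(2)[OF \<theta>]
  \<comment> \<open>The three parts serve different ends: \<open>k\<close> becomes a fixed point of
    \<theta>', the set \<open>P\<close> makes \<open>P_fix\<close> applicable to \<theta>' as well,
    and the images of the basis vectors give \<theta>' \<theta> = \<theta>, by which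
    \<open>?B\<close> preserves \<open>?W\<close>.\<close>
  let ?P = "insert k (P \<union> (\<lambda>a. \<theta> (free_basis R a)) ` A)"
  have "\<theta> (free_basis R a) \<in> carrier F \<and> p (\<theta> (free_basis R a)) = \<zero>\<^bsub>M\<^esub>" if "a \<in> A" for a
    using D\<theta>[OF free_basis_closed[OF R_cring that]] p\<theta>[OF free_basis_closed[OF R_cring that]] by (rule conjI)
  then have "finite ?P" "?P \<subseteq> {k \<in> carrier F. p k = \<zero>\<^bsub>M\<^esub>}"
    using P A(1) k by auto
  from flat_module_fix_finite[OF M_module flat A surj this] obtain \<theta>'
    where \<theta>': "\<theta>' \<in> linear_maps R F F" and p\<theta>': "\<And>x. x \<in> carrier F \<Longrightarrow> p (\<theta>' x) = \<zero>\<^bsub>M\<^esub>"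
      and \<theta>'_fix: "\<And>l. l \<in> ?P \<Longrightarrow> \<theta>' l = l" by blast
  note D\<theta>' = linear_mapsD(2)[OF \<theta>']
  have \<theta>'\<theta>: "\<theta>' (\<theta> x) = \<theta> x" if "x \<in> carrier F" for x
    by (rule free_module_linear_ext[OF R_cring F_module linear_maps_compose[OF \<theta> \<theta>'] \<theta> _ that])
      (simp add: \<theta>'_fix)
  let ?D = "\<lambda>x. \<theta> x \<ominus>\<^bsub>F\<^esub> \<theta>' x"
  let ?B = "\<lambda>x. x \<oplus>\<^bsub>F\<^esub> ?D x"
  have D: "?D \<in> linear_maps R F F" by (rule linear_maps_diff[OF F_module \<theta> \<theta>'])
  have B: "?B \<in> linear_maps R F F" by (rule linear_maps_add[OF F_module linear_maps_ident D])
  note DD = linear_mapsD(2)[OF D]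
  let ?W = "{w \<in> carrier F. \<theta>' w = w}"
  have BW: "?B w = \<theta> w" if "w \<in> ?W" for w
  proof -
    have w: "w \<in> carrier F" "\<theta>' w = w" and "\<theta> w \<in> carrier F" using that D\<theta> by simp_all
    then show ?thesis
      unfolding w(2) by (simp add: F.M.minus_eq F.M.a_lcomm[of w] F.M.r_neg)
  qed
  have ker_ideal: "ideal (a_kernel R S \<phi>) R" 
    by (rule ring_hom_ring.kernel_is_ideal[OF ring_hom_ringI2[OF M.R.ring_axioms S.ring_axioms hom]])
  have D2: "?D (?D x) a \<in> a_kernel R S \<phi>" if x: "x \<in> carrier F" for x a
  proof -
    define y where "y = ?D x"
    have y: "y \<in> carrier F" unfolding y_def by (rule DD[OF x])
    have "p y = p (\<theta> x) \<ominus>\<^bsub>M\<^esub> p (\<theta>' x)"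
      unfolding y_def by (rule linear_maps_map_diff[OF F_module M_module p_linear D\<theta>[OF x] D\<theta>'[OF x]])
    then have py: "p y = \<zero>\<^bsub>M\<^esub>" by (simp add: p\<theta>[OF x] p\<theta>'[OF x] M.M.minus_eq)
    \<comment> \<open>Both endomorphisms fix \<open>P\<close>, so each of them is the identity on
      the kernel of \<open>p\<close> modulo the kernel of \<phi>, and their difference vanishes
      there modulo that kernel.\<close>
    have \<phi>\<theta>: "\<phi> (\<theta> y a) = \<phi> (y a)" by (rule P_fix[OF \<theta> _ y py]) (rule \<theta>P)
    have \<phi>\<theta>': "\<phi> (\<theta>' y a) = \<phi> (y a)" by (rule P_fix[OF \<theta>' _ y py]) (simp add: \<theta>'_fix)
    have closed: "\<theta> y a \<in> carrier R" "\<theta>' y a \<in> carrier R" "y a \<in> carrier R"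
      using free_module_memD(1)[OF D\<theta>[OF y]] free_module_memD(1)[OF D\<theta>'[OF y]]
        free_module_memD(1)[OF y] .
    have "\<phi> (\<theta> y a \<ominus>\<^bsub>R\<^esub> \<theta>' y a) = \<zero>\<^bsub>S\<^esub>"
      unfolding M.R.minus_eq using closed by (simp add: \<phi>\<theta> \<phi>\<theta>' S.r_neg)
    then have "\<theta> y a \<ominus>\<^bsub>R\<^esub> \<theta>' y a \<in> a_kernel R S \<phi>"
      unfolding a_kernel_def' by (intro CollectI conjI M.R.minus_closed closed)
    moreover have "?D y a = \<theta> y a \<ominus>\<^bsub>R\<^esub> \<theta>' y a"
      by (rule fun_cong[OF free_module_diff[OF R_cring D\<theta>[OF y] D\<theta>'[OF y]]])
    ultimately show ?thesis unfolding y_def by (rule ssubst[rotated])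
  qed
  have "?W \<subseteq> ?B ` ?W"
  proof (rule submodule_subset_image_endomorphism[OF F_module ker_ideal ker A(1) _ _ B])
    show "free_basis R \<in> A \<rightarrow> carrier F" by (simp add: free_basis_closed[OF R_cring])
    show "carrier F \<subseteq> free_module_lift R F (free_basis R) ` carrier F"
    proof
      fix x assume "x \<in> carrier F"
      then show "x \<in> free_module_lift R F (free_basis R) ` carrier F"
        using imageI[of x "carrier F" "free_module_lift R F (free_basis R)"]
        by (simp add: free_module_expand[OF R_cring])
    qed
    show "submodule ?W R F"
    proof (rule F.submoduleI)
      show "\<zero>\<^bsub>F\<^esub> \<in> ?W" by (simp add: linear_maps_zero[OF F_module F_module \<theta>'])
      show "\<ominus>\<^bsub>F\<^esub> x \<in> ?W" if "x \<in> ?W" for x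
        using linear_mapsD(4)[OF \<theta>', of "\<ominus>\<^bsub>R\<^esub> \<one>\<^bsub>R\<^esub>" x] that by (simp add: F.smult_l_minus)
    qed (auto simp: linear_mapsD(3,4)[OF \<theta>'])
    show "?B ` ?W \<subseteq> ?W"
    proof
      fix y assume "y \<in> ?B ` ?W"
      then obtain w where w: "w \<in> ?W" "y = ?B w" by blast
      then have "y = \<theta> w" using BW by simp
      then show "y \<in> ?W" using w(1) D\<theta> \<theta>'\<theta> by simp
    qed
    fix a assume "a \<in> A"
    then have b: "free_basis R a \<in> carrier F" by (rule free_basis_closed[OF R_cring])
    let ?b = "free_basis R a"
    \<comment> \<open>From (1 + D)(1 - D) = 1 - D D, the basis vector is the value of
      \<open>?B\<close> at \<open>?b\<close> minus \<open>?D ?b\<close>, plus the correction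
      \<open>?c\<close>. The coordinates of \<open>?c\<close> are the coefficients demanded from the
      kernel of \<phi>.\<close>
    let ?c = "?D (?D ?b)"
    have c: "?c \<in> carrier F" using DD b by blast
    have "(\<Oplus>\<^bsub>F\<^esub>i\<in>A. ?c i \<odot>\<^bsub>F\<^esub> free_basis R i) = free_module_lift R F (free_basis R) ?c"
    proof (rule free_module_lift_eq[OF F_module _ _ A(1) _ subset_refl, symmetric])
      show "free_basis R \<in> A \<rightarrow> carrier F" by (simp add: free_basis_closed[OF R_cring])
      show "?c \<in> UNIV \<rightarrow> carrier R" using free_module_memD(1)[OF c] by simp
      show "{i. ?c i \<noteq> \<zero>\<^bsub>R\<^esub>} \<subseteq> A" using free_module_memD(2)[OF c] by blast
    qed
    then have sum: "(\<Oplus>\<^bsub>F\<^esub>i\<in>A. ?c i \<odot>\<^bsub>F\<^esub> free_basis R i) = ?c"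
      using free_module_expand[OF R_cring c] by simp
    have Db: "?D ?b \<in> carrier F" by (rule DD[OF b])
    have "?D (?b \<ominus>\<^bsub>F\<^esub> ?D ?b) = ?D ?b \<ominus>\<^bsub>F\<^esub> ?c"
      by (rule linear_maps_map_diff[OF F_module F_module D b Db])
    then have "?B (?b \<ominus>\<^bsub>F\<^esub> ?D ?b) \<oplus>\<^bsub>F\<^esub> ?c = (?b \<ominus>\<^bsub>F\<^esub> ?D ?b) \<oplus>\<^bsub>F\<^esub> (?D ?b \<ominus>\<^bsub>F\<^esub> ?c) \<oplus>\<^bsub>F\<^esub> ?c"
      by simp
    also have "\<dots> = ?b"
    proof -
      have "(u \<ominus>\<^bsub>F\<^esub> v) \<oplus>\<^bsub>F\<^esub> (v \<ominus>\<^bsub>F\<^esub> w) \<oplus>\<^bsub>F\<^esub> w = u"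
        if "u \<in> carrier F" "v \<in> carrier F" "w \<in> carrier F" for u v w
        using that by (simp add: F.M.minus_eq F.M.a_assoc F.M.l_neg F.M.r_neg1 F.M.r_neg2)
      from this[OF b Db c] show ?thesis .
    qed
    finally have "?b = ?B (?b \<ominus>\<^bsub>F\<^esub> ?D ?b) \<oplus>\<^bsub>F\<^esub> (\<Oplus>\<^bsub>F\<^esub>i\<in>A. ?c i \<odot>\<^bsub>F\<^esub> free_basis R i)"
      unfolding sum by (rule sym)
    moreover have "?c \<in> A \<rightarrow> a_kernel R S \<phi>" using D2[OF b] by (rule Pi_I)
    moreover have "?b \<ominus>\<^bsub>F\<^esub> ?D ?b \<in> carrier F" by (rule F.M.minus_closed[OF b Db])
    ultimately show "\<exists>y\<in>carrier F. \<exists>c\<in>A \<rightarrow> a_kernel R S \<phi>.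
        ?b = ?B y \<oplus>\<^bsub>F\<^esub> (\<Oplus>\<^bsub>F\<^esub>j\<in>A. c j \<odot>\<^bsub>F\<^esub> free_basis R j)"
      by (intro bexI)
  qed
  moreover have "k \<in> ?W" using k(1) \<theta>'_fix by simp
  ultimately obtain w where w: "w \<in> ?W" "k = ?B w" by blast
  then have "k = \<theta> w" "w \<in> carrier F" using BW by simp_all
  then show ?thesis by (rule image_eqI)
qed

lemma (in finite_base_change) projective_if_base_change:
  assumes flat: "flat_module R M" and ker: "a_kernel R S \<phi> \<subseteq> jacobson_radical R"
    and proj: "projective_module S (base_change R \<phi> S M)"
  shows "projective_module R M"
proof (rule finite_fixing_set[OF proj])
  fix P assume P: "finite P" "P \<subseteq> {k \<in> carrier F. p k = \<zero>\<^bsub>M\<^esub>}"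
      and P_fix: "\<And>\<theta> k a. \<theta> \<in> linear_maps R F F \<Longrightarrow> (\<And>k. k \<in> P \<Longrightarrow> \<theta> k = k) \<Longrightarrow>
        k \<in> carrier F \<Longrightarrow> p k = \<zero>\<^bsub>M\<^esub> \<Longrightarrow> \<phi> (\<theta> k a) = \<phi> (k a)"
  from flat_module_fix_finite[OF M_module flat A surj P] obtain \<theta>
    where \<theta>: "\<theta> \<in> linear_maps R F F" and p\<theta>: "\<And>x. x \<in> carrier F \<Longrightarrow> p (\<theta> x) = \<zero>\<^bsub>M\<^esub>"
      and \<theta>P: "\<And>k. k \<in> P \<Longrightarrow> \<theta> k = k" by blast
  \<comment> \<open>By \<open>kernel_subset_image\<close> the kernel of \<open>p\<close> is the
    image of \<theta>, so these finitely many vectors generate it, and an endomorphism that fixes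
    them is the identity on the kernel.\<close>
  let ?P = "(\<lambda>a. \<theta> (free_basis R a)) ` A"
  have "\<theta> (free_basis R a) \<in> carrier F \<and> p (\<theta> (free_basis R a)) = \<zero>\<^bsub>M\<^esub>" if "a \<in> A" for a
    using linear_mapsD(2)[OF \<theta> free_basis_closed[OF R_cring that]] p\<theta>[OF free_basis_closed[OF R_cring that]]
    by (rule conjI)
  then have "finite ?P" "?P \<subseteq> {k \<in> carrier F. p k = \<zero>\<^bsub>M\<^esub>}"
    using A(1) by auto
  from flat_module_fix_finite[OF M_module flat A surj this] obtain \<pi>
    where \<pi>: "\<pi> \<in> linear_maps R F F" and p\<pi>: "\<And>x. x \<in> carrier F \<Longrightarrow> p (\<pi> x) = \<zero>\<^bsub>M\<^esub>"
      and \<pi>_fix: "\<And>l. l \<in> ?P \<Longrightarrow> \<pi> l = l" by blast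
  have "\<pi> (\<theta> x) = \<theta> x" if "x \<in> carrier F" for x
    by (rule free_module_linear_ext[OF R_cring F_module linear_maps_compose[OF \<theta> \<pi>] \<theta> _ that])
      (simp add: \<pi>_fix)
  moreover have "k \<in> \<theta> ` carrier F" if "k \<in> carrier F" "p k = \<zero>\<^bsub>M\<^esub>" for k
    by (rule kernel_subset_image[OF flat ker P _ \<theta> _ _ that]; fact)
  ultimately have "\<pi> k = k" if "k \<in> carrier F" "p k = \<zero>\<^bsub>M\<^esub>" for k
    using that by blast
  then show ?thesis unfolding projective_R_iff using \<pi> p\<pi> by blast
qed

text \<open>Coefficient families given on \<open>A\<close> are extended by zero, since elements of
  the free module are functions on the whole type.\<close>

lemma finitely_generated_moduleE:
  fixes R :: "('r, 'x) ring_scheme" and M :: "('r, 'm, 'z) module_scheme"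
  assumes M: "module R M" and fg: "finitely_generated_module R M"
  obtains A where "finite A" "A \<subseteq> carrier M"
    "carrier M \<subseteq> free_module_lift R M (\<lambda>a. a) ` carrier (free_module R A)"
proof -
  interpret M: module R M by fact
  obtain A where A: "finite A" "A \<subseteq> carrier M"
    and gen: "\<And>x. x \<in> carrier M \<Longrightarrow> \<exists>c\<in>A \<rightarrow> carrier R. x = (\<Oplus>\<^bsub>M\<^esub>a\<in>A. c a \<odot>\<^bsub>M\<^esub> a)"
    using fg unfolding finitely_generated_module_def by blast
  have "x \<in> free_module_lift R M (\<lambda>a. a) ` carrier (free_module R A)" if x: "x \<in> carrier M" for x
  proof -
    obtain c where c: "c \<in> A \<rightarrow> carrier R" and x_eq: "x = (\<Oplus>\<^bsub>M\<^esub>a\<in>A. c a \<odot>\<^bsub>M\<^esub> a)"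
      using gen[OF x] by blast
    let ?d = "\<lambda>a. if a \<in> A then c a else \<zero>\<^bsub>R\<^esub>"
    have d: "?d \<in> carrier (free_module R A)"
      by (rule free_module_memI[OF A(1) _ _ M.R.is_cring]) (use c in auto)
    have "free_module_lift R M (\<lambda>a. a) ?d = (\<Oplus>\<^bsub>M\<^esub>a\<in>A. ?d a \<odot>\<^bsub>M\<^esub> a)"
    proof (rule free_module_lift_eq[OF M _ _ A(1) _ subset_refl])
      show "(\<lambda>a. a) \<in> A \<rightarrow> carrier M" using A(2) by auto
      show "?d \<in> UNIV \<rightarrow> carrier R" using free_module_memD(1)[OF d] by simp
      show "{a. ?d a \<noteq> \<zero>\<^bsub>R\<^esub>} \<subseteq> A" by auto
    qed
    also have "\<dots> = x"
      unfolding x_eq by (rule M.M.finsum_cong') (use c A(2) in auto)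
    finally show ?thesis using d by (intro image_eqI[of _ _ ?d]) simp_all
  qed
  then show thesis by (intro that[OF A]) blast
qed

theorem theorem3p3:
  fixes R :: "('r, 'x) ring_scheme"
    and S :: "('s, 'y) ring_scheme"
    and M :: "('r, 'm, 'z) module_scheme"
    and \<phi> :: "'r \<Rightarrow> 's"
  assumes "cring R"
    and "module R M"
    and "finitely_generated_module R M"
    and "flat_module R M"
    and "cring S"
    and "\<phi> \<in> ring_hom R S"
    and "a_kernel R S \<phi> \<subseteq> jacobson_radical R"
  shows "projective_module R M \<longleftrightarrow> projective_module S (base_change R \<phi> S M)"
proof -
  obtain A where A: "finite A" "A \<subseteq> carrier M"
    "carrier M \<subseteq> free_module_lift R M (\<lambda>a. a) ` carrier (free_module R A)"
    using finitely_generated_moduleE[OF assms(2,3)] .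
  have "finite_base_change R M S \<phi> A"
    using assms(2,5,6) A by (simp add: finite_base_change_def finite_base_change_axioms_def)
  then interpret finite_base_change R M S \<phi> A .
  show ?thesis
    using projective_base_change projective_if_base_change[OF assms(4,7)] by (rule iffI)
qed

end
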